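(* LoMuF (on capacitated undirected graphs) is polynomial-time reducible to Di-LoMuF (on capacitated directed graphs).
   Context: Undirected setting. $G=(V,E,\vec{c})$ with $\vec{c}\in\mathbb{R}_+^E$, and edges carry an arbitrary fixed orientation. A flow $\vec{f}\in\mathbb{R}^E$, where negative values mean transport against the orientation, satisfies a demand vector $\vec{d}\in\mathbb{R}^V$ (zero sum) if inflow minus outflow at every $v$ equals $\vec{d}(v)$. A family of flows is valid if $\sum_i|\vec{f}_i(e)|\le\vec{c}(e)$ for all $e$. Directed setting. $G=(V,A,\vec{c})$ with arcs $A$ and $\vec{c}\in\mathbb{R}_+^A$. Flows are $\vec{f}\in\mathbb{R}_+^A$, transported only along arc directions. $\vec{f}$ satisfies $\vec{d}$ if for each $v$ the flow on arcs entering $v$ minus the flow on arcs leaving $v$ equals $\vec{d}(v)$. Validity means $\sum_i\vec{f}_i(a)\le\vec{c}(a)$ for all arcs $a$. In both settings, $\lambda(G;\vec{d}_1,\dots,\vec{d}_k)$ is the maximum $\lambda\ge0$ such that some valid family has $\vec{f}_i$ satisfying $\lambda\vec{d}_i$ for all $i$. A supply vector is $\vec{s}\in\mathbb{R}_-^V$. $\vec{s}\circ v$ is the demand vector equal to $\vec{s}(u)$ for $u\ne v$ and to $-\sum_{w\neq v}\vec{s}(w)$ at $v$. LoMuF (resp. Di-LoMuF) is the problem: given an undirected (resp. directed) capacitated graph $G$ and supply vectors $\vec{s}_1,\dots,\vec{s}_k$, find $v_1,\dots,v_k\in V$ maximizing $\lambda(G;\vec{s}_1\circ v_1,\dots,\vec{s}_k\circ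 v_k)$. *)

theory Defs
  imports
    "Graph_Theory.Digraph"
    "HOL-Library.Extended_Real"
    "HOL-Computational_Algebra.Polynomial"
begin

section \<open>Multi-commodity flows\<close>

text \<open>
  One type of graph serves both settings: in the undirected setting, the arcs are the edges, and
  \<^const>\<open>tail\<close> and \<^const>\<open>head\<close> give their arbitrary fixed orientation.
  The \<^term>\<open>k\<close> commodities are numbered from \<open>0\<close> to \<open>k - 1\<close>.
\<close>

definition satisfies_demand ::
    "('v, 'e) pre_digraph \<Rightarrow> ('e \<Rightarrow> real) \<Rightarrow> ('v \<Rightarrow> real) \<Rightarrow> bool" where
  "satisfies_demand G f d \<longleftrightarrow>
     (\<forall>v\<in>verts G. (\<Sum>e\<in>in_arcs G v. f e) - (\<Sum>e\<in>out_arcs G v. f e) = d v)"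

definition undirected_valid ::
    "('v, 'e) pre_digraph \<Rightarrow> ('e \<Rightarrow> real) \<Rightarrow> nat \<Rightarrow> (nat \<Rightarrow> 'e \<Rightarrow> real) \<Rightarrow> bool" where
  "undirected_valid G c k f \<longleftrightarrow> (\<forall>e\<in>arcs G. (\<Sum>i<k. \<bar>f i e\<bar>) \<le> c e)"

definition directed_valid ::
    "('v, 'e) pre_digraph \<Rightarrow> ('e \<Rightarrow> real) \<Rightarrow> nat \<Rightarrow> (nat \<Rightarrow> 'e \<Rightarrow> real) \<Rightarrow> bool" where
  "directed_valid G c k f \<longleftrightarrow>
     (\<forall>a\<in>arcs G. (\<forall>i<k. 0 \<le> f i a) \<and> (\<Sum>i<k. f i a) \<le> c a)"

text \<open>
  The value \<open>\<lambda>(G; d\<^sub>1, \<dots>, d\<^sub>k)\<close>, taken as a supremum in the extended reals: it is \<open>\<infinity>\<close> if all the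
  demand vectors vanish, when no maximum exists, and the maximum otherwise.
\<close>

definition flow_value ::
    "((nat \<Rightarrow> 'e \<Rightarrow> real) \<Rightarrow> bool) \<Rightarrow> ('v, 'e) pre_digraph \<Rightarrow> nat \<Rightarrow> (nat \<Rightarrow> 'v \<Rightarrow> real) \<Rightarrow> ereal" where
  "flow_value valid G k d =
     Sup {ereal l | l. 0 \<le> l \<and>
       (\<exists>f. valid f \<and> (\<forall>i<k. satisfies_demand G (f i) (\<lambda>v. l * d i v)))}"

definition undirected_lambda ::
    "('v, 'e) pre_digraph \<Rightarrow> ('e \<Rightarrow> real) \<Rightarrow> nat \<Rightarrow> (nat \<Rightarrow> 'v \<Rightarrow> real) \<Rightarrow> ereal" where
  "undirected_lambda G c k = flow_value (undirected_valid G c k) G k"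

definition directed_lambda ::
    "('v, 'e) pre_digraph \<Rightarrow> ('e \<Rightarrow> real) \<Rightarrow> nat \<Rightarrow> (nat \<Rightarrow> 'v \<Rightarrow> real) \<Rightarrow> ereal" where
  "directed_lambda G c k = flow_value (directed_valid G c k) G k"

definition located_demand :: "'v set \<Rightarrow> ('v \<Rightarrow> real) \<Rightarrow> 'v \<Rightarrow> 'v \<Rightarrow> real" where
  "located_demand V s v = (\<lambda>u. if u = v then - (\<Sum>w\<in>V - {v}. s w) else s u)"


section \<open>Instances\<close>

text \<open>
  Problem instances are finite data, so capacities and supplies are rational here; flows and
  \<open>\<lambda>\<close> remain real. The vertices are \<open>0, \<dots>, n_verts - 1\<close>, and \<open>supplies I ! i ! v\<close> is the supply
  of commodity \<open>i\<close> at \<open>v\<close>.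
\<close>

record flow_instance =
  n_verts :: nat
  cap_arcs :: "((nat \<times> nat) \<times> rat) list"
  supplies :: "rat list list"

definition graph_of :: "flow_instance \<Rightarrow> (nat, nat \<times> nat) pre_digraph" where
  "graph_of I = \<lparr>verts = {..<n_verts I}, arcs = fst ` set (cap_arcs I), tail = fst, head = snd\<rparr>"

definition capacity :: "flow_instance \<Rightarrow> nat \<times> nat \<Rightarrow> real" where
  "capacity I a = real_of_rat (the (map_of (cap_arcs I) a))"

definition commodities :: "flow_instance \<Rightarrow> nat" where
  "commodities I = length (supplies I)"

definition supply_at :: "flow_instance \<Rightarrow> nat \<Rightarrow> nat \<Rightarrow> real" where
  "supply_at I i v = real_of_rat (supplies I ! i ! v)"

definition directed_instance :: "flow_instance \<Rightarrow> bool" where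
  "directed_instance I \<longleftrightarrow>
     0 < n_verts I \<and> digraph (graph_of I) \<and>
     distinct (map fst (cap_arcs I)) \<and> (\<forall>(a, c)\<in>set (cap_arcs I). 0 \<le> c) \<and>
     (\<forall>s\<in>set (supplies I). length s = n_verts I \<and> (\<forall>q\<in>set s. q \<le> 0))"

text \<open>In a simple undirected graph, each edge is listed in only one of its two orientations.\<close>

definition undirected_instance :: "flow_instance \<Rightarrow> bool" where
  "undirected_instance I \<longleftrightarrow>
     directed_instance I \<and> (\<forall>(u, v)\<in>arcs (graph_of I). (v, u) \<notin> arcs (graph_of I))"

definition placement :: "flow_instance \<Rightarrow> nat list \<Rightarrow> bool" where
  "placement I vs \<longleftrightarrow> length vs = commodities I \<and> set vs \<subseteq> verts (graph_of I)"

definition placement_demand :: "flow_instance \<Rightarrow> nat list \<Rightarrow> nat \<Rightarrow> nat \<Rightarrow> real" where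
  "placement_demand I vs i = located_demand (verts (graph_of I)) (supply_at I i) (vs ! i)"

definition undirected_placement_value :: "flow_instance \<Rightarrow> nat list \<Rightarrow> ereal" where
  "undirected_placement_value I vs =
     undirected_lambda (graph_of I) (capacity I) (commodities I) (placement_demand I vs)"

definition directed_placement_value :: "flow_instance \<Rightarrow> nat list \<Rightarrow> ereal" where
  "directed_placement_value I vs =
     directed_lambda (graph_of I) (capacity I) (commodities I) (placement_demand I vs)"


section \<open>Binary encodings\<close>

text \<open>
  All the codes are prefix-free, so they can be concatenated. Numbers are written in binary, apart
  from the number of vertices of a graph, which is in unary as usual; rational numbers are written
  as fractions in lowest terms.
\<close>

fun enc_list :: "('a \<Rightarrow> bool list) \<Rightarrow> 'a list \<Rightarrow> bool list" where
  "enc_list enc [] = [False]"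
| "enc_list enc (x # xs) = True # enc x @ enc_list enc xs"

fun binary_digits :: "nat \<Rightarrow> bool list" where
  "binary_digits n = (if n = 0 then [] else odd n # binary_digits (n div 2))"

declare binary_digits.simps [simp del]

definition enc_nat :: "nat \<Rightarrow> bool list" where
  "enc_nat n = enc_list (\<lambda>b. [b]) (binary_digits n)"

definition enc_int :: "int \<Rightarrow> bool list" where
  "enc_int i = (i < 0) # enc_nat (nat \<bar>i\<bar>)"

definition enc_rat :: "rat \<Rightarrow> bool list" where
  "enc_rat q = enc_int (fst (quotient_of q)) @ enc_int (snd (quotient_of q))"

definition enc_cap_arc :: "(nat \<times> nat) \<times> rat \<Rightarrow> bool list" where
  "enc_cap_arc = (\<lambda>((u, v), c). enc_nat u @ enc_nat v @ enc_rat c)"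

definition enc_instance :: "flow_instance \<Rightarrow> bool list" where
  "enc_instance I =
     enc_list (\<lambda>_. []) (replicate (n_verts I) ()) @
     enc_list enc_cap_arc (cap_arcs I) @
     enc_list (enc_list enc_rat) (supplies I)"

definition enc_placement :: "nat list \<Rightarrow> bool list" where
  "enc_placement = enc_list enc_nat"

definition prefix_code :: "('a \<Rightarrow> bool list) \<Rightarrow> bool" where
  "prefix_code enc \<longleftrightarrow> (\<forall>x y r s. enc x @ r = enc y @ s \<longrightarrow> x = y \<and> r = s)"

lemma prefix_codeD: "prefix_code enc \<Longrightarrow> enc x @ r = enc y @ s \<longleftrightarrow> x = y \<and> r = s"
  unfolding prefix_code_def by blast

lemma prefix_code_list:
  assumes "prefix_code enc"
  shows "prefix_code (enc_list enc)"
proof -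
  have "enc_list enc xs @ r = enc_list enc ys @ s \<longrightarrow> xs = ys \<and> r = s" for xs ys r s
  proof (induction xs arbitrary: ys)
    case Nil
    show ?case by (cases ys) auto
  next
    case (Cons x xs)
    show ?case using Cons by (cases ys) (auto simp: prefix_codeD[OF assms])
  qed
  then show ?thesis by (auto simp: prefix_code_def)
qed

lemma binary_digits_inject: "binary_digits m = binary_digits n \<Longrightarrow> m = n"
proof (induction m arbitrary: n rule: less_induct)
  case (less m)
  show ?case
  proof (cases "m = 0 \<or> n = 0")
    case True
    then show ?thesis using less.prems
      by (auto simp: binary_digits.simps[of m] binary_digits.simps[of n] split: if_splits)
  next
    case False
    then have "odd m = odd n" "binary_digits (m div 2) = binary_digits (n div 2)"
      using less.prems binary_digits.simps[of m] binary_digits.simps[of n] by auto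
    moreover from this have "m div 2 = n div 2" using less.IH False by simp
    ultimately show ?thesis by presburger
  qed
qed

lemma prefix_code_nat: "prefix_code enc_nat"
proof -
  have "prefix_code (\<lambda>b. [b])" by (auto simp: prefix_code_def)
  from prefix_codeD[OF prefix_code_list[OF this]] show ?thesis
    unfolding prefix_code_def enc_nat_def using binary_digits_inject by metis
qed

lemma prefix_code_int: "prefix_code enc_int"
  unfolding prefix_code_def enc_int_def
  by (auto simp: prefix_codeD[OF prefix_code_nat] abs_if nat_eq_iff split: if_splits)

lemma prefix_code_rat: "prefix_code enc_rat"
  unfolding prefix_code_def enc_rat_def
  by (auto simp: prefix_codeD[OF prefix_code_int] intro!: quotient_of_inject prod_eqI)

lemma prefix_code_cap_arc: "prefix_code enc_cap_arc"
  unfolding prefix_code_def enc_cap_arc_def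
  by (auto simp: prefix_codeD[OF prefix_code_nat] prefix_codeD[OF prefix_code_rat])

lemma prefix_code_instance: "prefix_code enc_instance"
proof -
  have "prefix_code (\<lambda>_::unit. [])" by (auto simp: prefix_code_def)
  note codes = prefix_codeD[OF prefix_code_list[OF this]]
    prefix_codeD[OF prefix_code_list[OF prefix_code_cap_arc]]
    prefix_codeD[OF prefix_code_list[OF prefix_code_list[OF prefix_code_rat]]]
  have "m = n" if "replicate m () = replicate n ()" for m n
    using arg_cong[OF that, of length] by simp
  then show ?thesis unfolding prefix_code_def enc_instance_def by (auto simp: codes)
qed

lemma prefix_code_placement: "prefix_code enc_placement"
  unfolding enc_placement_def by (rule prefix_code_list[OF prefix_code_nat])


section \<open>Polynomial time\<close>

text \<open>
  Deterministic multi-tape Turing machines over the symbols \<open>0\<close>, \<open>1\<close> and blank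
  (\<^const>\<open>None\<close>), with two-way infinite tapes. The states are \<open>0, \<dots>, n_states\<close>, with initial state
  \<open>0\<close> and halting state \<open>n_states\<close>. The input is on tape \<open>0\<close> and the output on tape \<open>1\<close>.
\<close>

datatype head_move = Move_Left | Stay | Move_Right

type_synonym tape = "(int \<Rightarrow> bool option) \<times> int"

record turing_machine =
  n_tapes :: nat
  n_states :: nat
  transition :: "nat \<Rightarrow> bool option list \<Rightarrow> nat \<times> (bool option \<times> head_move) list"

definition turing_machine :: "turing_machine \<Rightarrow> bool" where
  "turing_machine M \<longleftrightarrow> 2 \<le> n_tapes M \<and>
     (\<forall>q<n_states M. \<forall>syms. length syms = n_tapes M \<longrightarrow>
        fst (transition M q syms) \<le> n_states M \<and>
        length (snd (transition M q syms)) = n_tapes M)"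

fun displacement :: "head_move \<Rightarrow> int" where
  "displacement Move_Left = - 1"
| "displacement Stay = 0"
| "displacement Move_Right = 1"

fun tape_read :: "tape \<Rightarrow> bool option" where
  "tape_read (cells, pos) = cells pos"

fun tape_act :: "bool option \<times> head_move \<Rightarrow> tape \<Rightarrow> tape" where
  "tape_act (a, mv) (cells, pos) = (cells(pos := a), pos + displacement mv)"

fun machine_step :: "turing_machine \<Rightarrow> nat \<times> tape list \<Rightarrow> nat \<times> tape list" where
  "machine_step M (q, tapes) =
     (if q = n_states M then (q, tapes)
      else let (q', acts) = transition M q (map tape_read tapes)
           in (q', map2 tape_act acts tapes))"

definition string_cells :: "bool list \<Rightarrow> int \<Rightarrow> bool option" where
  "string_cells x p = (if 0 \<le> p \<and> p < int (length x) then Some (x ! nat p) else None)"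

definition initial_config :: "turing_machine \<Rightarrow> bool list \<Rightarrow> nat \<times> tape list" where
  "initial_config M x =
     (0, (string_cells x, 0) # replicate (n_tapes M - 1) (string_cells [], 0))"

text \<open>Configurations in the halting state do not change, so this says: within \<open>t\<close> steps.\<close>

definition computes_within :: "turing_machine \<Rightarrow> bool list \<Rightarrow> nat \<Rightarrow> bool list \<Rightarrow> bool" where
  "computes_within M x t y \<longleftrightarrow>
     (case (machine_step M ^^ t) (initial_config M x) of
        (q, tapes) \<Rightarrow> q = n_states M \<and> fst (tapes ! 1) = string_cells y)"

definition polytime_computable ::
    "'a set \<Rightarrow> ('a \<Rightarrow> bool list) \<Rightarrow> ('b \<Rightarrow> bool list) \<Rightarrow> ('a \<Rightarrow> 'b) \<Rightarrow> bool" where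
  "polytime_computable D enc_in enc_out f \<longleftrightarrow>
     (\<exists>M (p :: nat poly). turing_machine M \<and>
        (\<forall>x\<in>D. computes_within M (enc_in x) (poly p (length (enc_in x))) (enc_out (f x))))"


section \<open>Search problems and reductions\<close>

record ('x, 'y) search_problem =
  instances :: "'x set"
  solutions :: "'x \<Rightarrow> 'y set"
  instance_code :: "'x \<Rightarrow> bool list"
  solution_code :: "'y \<Rightarrow> bool list"

text \<open>
  A polynomial-time reduction between search problems: \<open>F\<close> translates instances of \<open>P\<close> into
  instances of \<open>Q\<close>, and \<open>B\<close> turns every solution of the translated instance into a solution of the
  original one. Solvable instances must become solvable ones, since otherwise \<open>B\<close> would be
  unconstrained.
\<close>

definition polytime_reducible ::
    "('x, 'y) search_problem \<Rightarrow> ('z, 'w) search_problem \<Rightarrow> bool" where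
  "polytime_reducible P Q \<longleftrightarrow>
     (\<exists>F B.
        polytime_computable (instances P) (instance_code P) (instance_code Q) F \<and>
        polytime_computable {(x, y). x \<in> instances P \<and> y \<in> solutions Q (F x)}
          (\<lambda>(x, y). instance_code P x @ solution_code Q y) (solution_code P) (\<lambda>(x, y). B x y) \<and>
        (\<forall>x\<in>instances P.
           F x \<in> instances Q \<and>
           (solutions P x \<noteq> {} \<longrightarrow> solutions Q (F x) \<noteq> {}) \<and>
           (\<forall>y\<in>solutions Q (F x). B x y \<in> solutions P x)))"

definition LoMuF :: "(flow_instance, nat list) search_problem" where
  "LoMuF = \<lparr>
     instances = {I. undirected_instance I},
     solutions = (\<lambda>I. {vs. is_arg_max (undirected_placement_value I) (placement I) vs}),
     instance_code = enc_instance,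
     solution_code = enc_placement\<rparr>"

definition Di_LoMuF :: "(flow_instance, nat list) search_problem" where
  "Di_LoMuF = \<lparr>
     instances = {I. directed_instance I},
     solutions = (\<lambda>I. {vs. is_arg_max (directed_placement_value I) (placement I) vs}),
     instance_code = enc_instance,
     solution_code = enc_placement\<rparr>"

end

theory Submission
  imports Defs
begin

text \<open>
  An undirected edge \<open>uv\<close> of capacity \<open>c\<close> becomes the gadget \<open>u \<rightarrow> x\<close>, \<open>v \<rightarrow> x\<close>, \<open>x \<rightarrow> y\<close>, \<open>y \<rightarrow> u\<close>, \<open>y \<rightarrow> v\<close> with
  all capacities \<open>c\<close>, whose bottleneck \<open>x \<rightarrow> y\<close> is shared by the two directions. A sink placed at \<open>x\<close>
  would escape the bottleneck, so the sinks are forced away from the gadgets: each vertex \<open>v\<close> gets a copy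
  \<open>v'\<close> without outgoing arcs, and a new vertex \<open>z\<close>, where every commodity has supply \<open>- 1\<close>, reaches only the
  copies. The arcs \<open>v \<rightarrow> v'\<close> and \<open>z \<rightarrow> v'\<close> have capacity \<open>2 ^ (4 * L)\<close> for the input length \<open>L\<close>. This
  exceeds what any finite value \<open>\<lambda>\<close> of the input needs, while a placement of value \<open>\<infinity>\<close> still gets a directed
  value above all the finite ones. If some sink is not at a copy, then \<open>\<lambda> = 0\<close> or the commodity is zero.

  For the running times, programs with loops over several tapes are compiled to Turing machines.
\<close>


section \<open>Programs for Turing machines\<close>

text \<open>What forces the sinks onto copies: \<open>z\<close> has no incoming arcs and reaches
  only copies, and a copy has no outgoing arcs. So at \<open>\<lambda> > 0\<close> the unit supply
  of \<open>z\<close> must end at a copy that is itself the sink. The only escape is a sink at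
  \<open>z\<close>, which can receive nothing, so that all other supplies vanish. As
  \<open>z\<close> reaches every copy alike, it does not bias the choice among them.

  For sinks at copies the supply of \<open>z\<close> keeps directed values finite, whereas
  undirected ones may be infinite. Equality of values is thus out of reach, and optimality is
  transferred by two inequalities: pulling back a directed placement never lowers its value, and
  undirected feasibility lifts for every \<open>\<lambda>\<close> up to a common bound on the finite
  values.

  The exponent \<open>4 * L\<close>: with \<open>p = 2 ^ L\<close>, a finite value is at most
  \<open>p ^ 2\<close>, as a nonzero supply is at least \<open>1 / p\<close> and the total capacity
  at most \<open>p\<close>. The strict bound \<open>p ^ 2 + 1\<close> is rounded up to
  \<open>p ^ 3\<close>, and an arc to a copy carries at most \<open>p\<close> times the value. The
  same number \<open>4 * L\<close> leaves room for all vertex numbers, so one pass over the input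
  yields both.\<close>

text \<open>
  The cells to the left of the head, nearest first, and the cells from the head on. The left list starts
  at cell \<open>- 1\<close>, which stays blank and so marks the left end of the contents for rewinding.
\<close>

type_synonym ltape = "bool option list \<times> bool option list"

fun rd :: "ltape \<Rightarrow> bool option" where
  "rd (l, []) = None"
| "rd (l, a # r) = a"

text \<open>No trailing blanks are stored, so an erased tape is literally empty again.\<close>

fun bcons :: "bool option \<Rightarrow> bool option list \<Rightarrow> bool option list" where
  "bcons None [] = []"
| "bcons a r = a # r"

fun wr :: "bool option \<Rightarrow> ltape \<Rightarrow> ltape" where
  "wr a (l, r) = (l, bcons a (tl r))"

fun mv :: "head_move \<Rightarrow> ltape \<Rightarrow> ltape" where
  "mv Move_Right (l, r) = (rd (l, r) # l, tl r)"
| "mv Stay t = t"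
| "mv Move_Left (l, r) = (tl l, bcons (hd l) r)"

definition nth_cell :: "bool option list \<Rightarrow> int \<Rightarrow> bool option" where
  "nth_cell xs p = (if 0 \<le> p \<and> p < int (length xs) then xs ! nat p else None)"

text \<open>The shift by one accounts for lists that start at cell \<open>- 1\<close>: entry
  \<open>0\<close> of the joined list is that cell, and an empty left list puts the head on
  it.\<close>

definition ctape :: "ltape \<Rightarrow> tape" where
  "ctape t = (\<lambda>p. nth_cell (rev (fst t) @ snd t) (p + 1), int (length (fst t)) - 1)"

text \<open>A dropped trailing blank cannot be observed, since \<open>nth_cell\<close> reads blanks
  outside the list.\<close>

lemma nth_cell_bcons: "nth_cell (xs @ bcons a r) = nth_cell (xs @ a # r)"
  by (cases a; cases r) (auto simp: nth_cell_def fun_eq_iff nth_append nat_less_iff)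

lemma tape_read_ctape: "tape_read (ctape t) = rd t"
  by (cases t rule: rd.cases) (auto simp: ctape_def nth_cell_def nth_append)

text \<open>The premise excludes the one move that the lists cannot express: with an empty left list
  the head is at cell \<open>- 1\<close>, and they have no cell further to the left.\<close>

lemma tape_act_ctape:
  assumes "m = Move_Left \<Longrightarrow> fst t \<noteq> []"
  shows "tape_act (a, m) (ctape t) = ctape (mv m (wr a t))"
proof -
  obtain l r where t: "t = (l, r)" by (cases t)
  have w: "(\<lambda>p. nth_cell (rev l @ r) (p + 1))(int (length l) - 1 := a) =
      (\<lambda>p. nth_cell (rev l @ a # tl r) (p + 1))"
  proof
    fix p :: int
    consider "p < int (length l) - 1" | "p = int (length l) - 1" | "p > int (length l) - 1" by linarith
    then show "((\<lambda>p. nth_cell (rev l @ r) (p + 1))(int (length l) - 1 := a)) p =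
      nth_cell (rev l @ a # tl r) (p + 1)"
    proof cases
      case 3
      define d where "d = nat (p - int (length l))"
      have p: "p = int (length l) + int d" using 3 by (simp add: d_def)
      show ?thesis unfolding p
        by (cases r) (auto simp: nth_cell_def nth_append nat_add_distrib)
    qed (auto simp: nth_cell_def nth_append nat_less_iff)
  qed
  show ?thesis
  proof (cases m)
    case Move_Left
    then obtain b l' where l: "l = b # l'" using assms t by (cases l) auto
    show ?thesis using w nth_cell_bcons[of "rev l' @ [b]"]
      by (simp add: t ctape_def Move_Left l nth_cell_bcons)
  next
    case Stay
    show ?thesis using w by (simp add: t ctape_def Stay nth_cell_bcons)
  next
    case Move_Right
    have "rd (l, bcons a (tl r)) # tl (bcons a (tl r)) = a # tl r"
      if "bcons a (tl r) \<noteq> []" using that by (cases a; cases "tl r") auto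
    moreover have "nth_cell (rev l @ [None]) = nth_cell (rev l)"
      by (auto simp: nth_cell_def nth_append fun_eq_iff)
    moreover have "a = None" "tl r = []" if "bcons a (tl r) = []"
      using that by (cases a; cases "tl r"; simp)+
    ultimately show ?thesis using w
      by (cases "bcons a (tl r) = []") (auto simp: t ctape_def Move_Right)
  qed
qed

section \<open>Structured multi-tape programs and their compilation\<close>

datatype prog =
  Nop
| Op nat nat "bool option \<Rightarrow> bool option \<Rightarrow> bool option" head_move
| Seq prog prog
| If nat "bool option set" prog prog
| While nat "bool option set" prog

text \<open>\<open>Op i j f m\<close> writes on tape \<open>j\<close> the value of \<open>f\<close>
  at the symbols under the heads \<open>i\<close> and \<open>j\<close>, and then moves head
  \<open>j\<close>. A test costs one step, as it occupies one state of the code. The side condition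
  on left moves is part of a derivation, so a derivable run never leaves the left end.\<close>

inductive runs :: "prog \<Rightarrow> ltape list \<Rightarrow> nat \<Rightarrow> ltape list \<Rightarrow> bool" where
  Nop: "runs Nop s 1 s"
| Op: "(m = Move_Left \<Longrightarrow> fst (s ! j) \<noteq> []) \<Longrightarrow>
    runs (Op i j f m) s 1 (s[j := mv m (wr (f (rd (s ! i)) (rd (s ! j))) (s ! j))])"
| Seq: "runs p s t s' \<Longrightarrow> runs q s' t' s'' \<Longrightarrow> runs (Seq p q) s (t + t') s''"
| If_True: "rd (s ! i) \<in> A \<Longrightarrow> runs p s t s' \<Longrightarrow> runs (If i A p q) s (1 + t) s'"
| If_False: "rd (s ! i) \<notin> A \<Longrightarrow> runs q s t s' \<Longrightarrow> runs (If i A p q) s (1 + t) s'"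
| While_False: "rd (s ! i) \<notin> A \<Longrightarrow> runs (While i A p) s 1 s"
| While_True: "rd (s ! i) \<in> A \<Longrightarrow> runs p s t s' \<Longrightarrow> runs (While i A p) s' t' s'' \<Longrightarrow>
    runs (While i A p) s (1 + t + t') s''"

fun n_labels :: "prog \<Rightarrow> nat" where
  "n_labels Nop = 1"
| "n_labels (Op i j f m) = 1"
| "n_labels (Seq p q) = n_labels p + n_labels q"
| "n_labels (If i A p q) = 1 + n_labels p + n_labels q"
| "n_labels (While i A p) = 1 + n_labels p"

fun tapes_below :: "nat \<Rightarrow> prog \<Rightarrow> bool" where
  "tapes_below K Nop = True"
| "tapes_below K (Op i j f m) = (i < K \<and> j < K)"
| "tapes_below K (Seq p q) = (tapes_below K p \<and> tapes_below K q)"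
| "tapes_below K (If i A p q) = (i < K \<and> tapes_below K p \<and> tapes_below K q)"
| "tapes_below K (While i A p) = (i < K \<and> tapes_below K p)"

definition idle :: "bool option list \<Rightarrow> (bool option \<times> head_move) list" where
  "idle syms = map (\<lambda>a. (a, Stay)) syms"

text \<open>The code of a program occupies the states from \<open>b\<close> on and leaves to state \<open>x\<close>.\<close>

fun code :: "prog \<Rightarrow> nat \<Rightarrow> nat \<Rightarrow> nat \<Rightarrow> bool option list \<Rightarrow>
    nat \<times> (bool option \<times> head_move) list" where
  "code Nop b x q syms = (x, idle syms)"
| "code (Op i j f m) b x q syms = (x, (idle syms)[j := (f (syms ! i) (syms ! j), m)])"
| "code (Seq p p') b x q syms =
    (if q < b + n_labels p then code p b (b + n_labels p) q syms
     else code p' (b + n_labels p) x q syms)"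
| "code (If i A p p') b x q syms =
    (if q = b then (if syms ! i \<in> A then b + 1 else b + 1 + n_labels p, idle syms)
     else if q < b + 1 + n_labels p then code p (b + 1) x q syms
     else code p' (b + 1 + n_labels p) x q syms)"
| "code (While i A p) b x q syms =
    (if q = b then (if syms ! i \<in> A then b + 1 else x, idle syms)
     else code p (b + 1) b q syms)"

lemma n_labels_pos: "0 < n_labels p"
  by (induction p) auto

lemma length_snd_code: "length (snd (code p b x q syms)) = length syms"
  by (induction p b x q syms rule: code.induct) (auto simp: idle_def)

lemma fst_code_le:
  "b + n_labels p \<le> m \<Longrightarrow> x \<le> m \<Longrightarrow> fst (code p b x q syms) \<le> m"
proof (induction p b x q syms rule: code.induct)
  case (3 p p' b x q syms)
  then show ?case using n_labels_pos[of p'] by auto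
next
  case (4 i A p p' b x q syms)
  then show ?case using n_labels_pos[of p'] by auto
qed auto

definition machine_of :: "nat \<Rightarrow> prog \<Rightarrow> turing_machine" where
  "machine_of K p = \<lparr>n_tapes = K, n_states = n_labels p, transition = code p 0 (n_labels p)\<rparr>"

lemma turing_machine_machine_of: "2 \<le> K \<Longrightarrow> turing_machine (machine_of K p)"
  by (auto simp: turing_machine_def machine_of_def length_snd_code intro!: fst_code_le)

lemma idle_ctape: "map2 tape_act (idle (map rd s)) (map ctape s) = map ctape s"
proof (rule nth_equalityI)
  fix i assume "i < length (map2 tape_act (idle (map rd s)) (map ctape s))"
  then have i: "i < length s" by (simp add: idle_def)
  have "tape_act (rd t, Stay) (ctape t) = ctape t" for t
    unfolding tape_read_ctape[symmetric] by (cases "ctape t") auto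
  then show "map2 tape_act (idle (map rd s)) (map ctape s) ! i = map ctape s ! i"
    using i by (simp add: idle_def)
qed (simp add: idle_def)

text \<open>The start \<open>b\<close> and the exit \<open>x\<close> vary in the induction: the
  first half of a sequence exits into the second half, and the body of a loop exits into its own
  test.\<close>

lemma machine_step_runs:
  assumes "runs p s t s'" and "tapes_below (length s) p"
    and "\<And>q. b \<le> q \<Longrightarrow> q < b + n_labels p \<Longrightarrow> transition M q = code p b x q"
    and "b + n_labels p \<le> n_states M"
  shows "length s' = length s \<and> (machine_step M ^^ t) (b, map ctape s) = (x, map ctape s')"
  using assms
proof (induction arbitrary: b x rule: runs.induct)
  case (Nop s)
  have "map tape_read (map ctape s) = map rd s" by (simp add: tape_read_ctape)
  then show ?case using Nop idle_ctape[of s] by (simp add: o_def tape_read_ctape)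
next
  case (Op m s j i f)
  let ?a = "(f (rd (s ! i)) (rd (s ! j)), m)"
  have "map2 tape_act ((idle (map rd s))[j := ?a]) (map ctape s) =
      (map2 tape_act (idle (map rd s)) (map ctape s))[j := tape_act ?a (map ctape s ! j)]"
    using Op.prems(1) by (intro nth_equalityI) (auto simp: idle_def nth_list_update)
  also have "\<dots> = map ctape (s[j := mv m (wr (f (rd (s ! i)) (rd (s ! j))) (s ! j))])"
    using Op by (simp add: idle_ctape map_update tape_act_ctape del: tape_act.simps)
  finally show ?case using Op by (simp add: o_def tape_read_ctape)
next
  case (Seq p s t s' q t' s'')
  have 1: "length s' = length s \<and> (machine_step M ^^ t) (b, map ctape s) = (b + n_labels p, map ctape s')"
    using Seq.prems by (intro Seq.IH) auto
  have 2: "length s'' = length s' \<and>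
      (machine_step M ^^ t') (b + n_labels p, map ctape s') = (x, map ctape s'')"
    using Seq.prems 1 by (intro Seq.IH) auto
  \<comment> \<open>In \<open>funpow_add\<close> the right summand is executed earlier, so the sum
    has to be reversed.\<close>
  have "t + t' = t' + t" by simp
  then show ?case using 1 2 by (simp only: funpow_add o_apply)
next
  case (If_True s i A p t s' q)
  have "map tape_read (map ctape s) = map rd s" by (simp add: tape_read_ctape)
  then have "machine_step M (b, map ctape s) = (b + 1, map ctape s)"
    using If_True.prems If_True.hyps idle_ctape[of s] by (simp add: o_def tape_read_ctape)
  moreover have "length s' = length s \<and> (machine_step M ^^ t) (b + 1, map ctape s) = (x, map ctape s')"
    using If_True.prems by (intro If_True.IH) auto
  ultimately show ?case by (simp add: funpow_swap1 del: machine_step.simps)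
next
  case (If_False s i A q t s' p)
  have "map tape_read (map ctape s) = map rd s" by (simp add: tape_read_ctape)
  then have "machine_step M (b, map ctape s) = (b + 1 + n_labels p, map ctape s)"
    using If_False.prems If_False.hyps idle_ctape[of s] n_labels_pos[of q]
    by (simp add: o_def tape_read_ctape)
  moreover have "length s' = length s \<and>
      (machine_step M ^^ t) (b + 1 + n_labels p, map ctape s) = (x, map ctape s')"
    using If_False.prems by (intro If_False.IH) auto
  ultimately show ?case by (simp add: funpow_swap1 del: machine_step.simps)
next
  case (While_False s i A p)
  have "map tape_read (map ctape s) = map rd s" by (simp add: tape_read_ctape)
  then show ?case using While_False idle_ctape[of s] by (simp add: o_def tape_read_ctape)
next
  case (While_True s i A p t s' t' s'')
  have "map tape_read (map ctape s) = map rd s" by (simp add: tape_read_ctape)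
  then have 1: "machine_step M (b, map ctape s) = (b + 1, map ctape s)"
    using While_True.prems While_True.hyps idle_ctape[of s] by (simp add: o_def tape_read_ctape)
  have 2: "length s' = length s \<and> (machine_step M ^^ t) (b + 1, map ctape s) = (b, map ctape s')"
    using While_True.prems by (intro While_True.IH) auto
  have 3: "length s'' = length s' \<and> (machine_step M ^^ t') (b, map ctape s') = (x, map ctape s'')"
    using While_True.prems 2 by (intro While_True.IH) auto
  have "1 + t + t' = t' + t + 1" by simp
  then show ?case using 1 2 3
    by (simp only: funpow_add o_apply) (auto simp del: machine_step.simps)
qed

section \<open>Execution within a time bound on explicit tape contents\<close>

definition reach :: "prog \<Rightarrow> ltape list \<Rightarrow> nat \<Rightarrow> ltape list \<Rightarrow> bool" where
  "reach p s t s' \<longleftrightarrow> (\<exists>t'\<le>t. runs p s t' s')"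

text \<open>The head stands between the two texts, on the first symbol of \<open>b\<close>. The
  extra \<open>None\<close> is the blank cell \<open>- 1\<close> that marks the left end.\<close>

definition tp :: "bool list \<Rightarrow> bool list \<Rightarrow> ltape" where
  "tp a b = (rev (map Some a) @ [None], map Some b)"

lemma computes_within_machine_of:
  assumes "reach p (tp [] x # replicate (K - 1) (tp [] [])) t s'" and "tapes_below K p"
    and "2 \<le> K" and "s' ! 1 = tp y []" and "t \<le> T"
  shows "computes_within (machine_of K p) x T y"
proof -
  let ?M = "machine_of K p" and ?s = "tp [] x # replicate (K - 1) (tp [] [])"
  obtain t' where t': "t' \<le> t" "runs p ?s t' s'" using assms(1) by (auto simp: reach_def)
  have ct: "ctape (tp [] w) = (string_cells w, 0)" for w
    by (auto simp: ctape_def tp_def nth_cell_def string_cells_def nth_Cons' nat_less_iff fun_eq_iff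
        nat_diff_distrib' intro!: arg_cong[of _ _ "nth w"])
  have "length s' = length ?s \<and> (machine_step ?M ^^ t') (0, map ctape ?s) = (n_labels p, map ctape s')"
    using assms t' by (intro machine_step_runs[where p = p]) (auto simp: machine_of_def)
  moreover have "(0, map ctape ?s) = initial_config ?M x"
    by (simp add: initial_config_def ct machine_of_def)
  \<comment> \<open>The halting state absorbs the steps that are left up to the bound
    \<open>T\<close>.\<close>
  moreover have "(machine_step ?M ^^ d) (n_labels p, map ctape s') = (n_labels p, map ctape s')" for d
    by (induction d) (auto simp: machine_of_def)
  moreover have "T = (T - t') + t'" using t' assms by simp
  ultimately have *: "length s' = K" "(machine_step ?M ^^ T) (initial_config ?M x) = (n_labels p, map ctape s')"
    using assms(3) by (auto, metis (no_types, lifting) funpow_add o_apply)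
  have "fst (ctape (tp y [])) = string_cells y"
    by (auto simp: ctape_def tp_def nth_cell_def string_cells_def nth_Cons' nat_less_iff fun_eq_iff
        nat_diff_distrib' intro!: arg_cong[of _ _ "nth y"])
  then show ?thesis
    using * assms by (simp add: computes_within_def machine_of_def)
qed



text \<open>The output tape and the step counts should stay in the form \<open>1\<close>.\<close>

declare One_nat_def [simp del]

lemma reach_mono: "reach p s t s' \<Longrightarrow> t \<le> t' \<Longrightarrow> reach p s t' s'"
  unfolding reach_def by (meson le_trans)

lemma reach_Nop: "reach Nop s 1 s"
  unfolding reach_def using runs.Nop by blast

lemma reach_Op:
  "s' = s[j := mv m (wr (f (rd (s ! i)) (rd (s ! j))) (s ! j))] \<Longrightarrow>
    (m = Move_Left \<Longrightarrow> fst (s ! j) \<noteq> []) \<Longrightarrow> reach (Op i j f m) s 1 s'"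
  unfolding reach_def using runs.Op[of m s j i f] by blast

lemma reach_Seq: "reach p s t s' \<Longrightarrow> reach q s' t' s'' \<Longrightarrow> reach (Seq p q) s (t + t') s''"
  unfolding reach_def by (meson runs.Seq add_mono)

lemma reach_If:
  "(rd (s ! i) \<in> A \<Longrightarrow> reach p s t s') \<Longrightarrow> (rd (s ! i) \<notin> A \<Longrightarrow> reach q s t s') \<Longrightarrow>
    reach (If i A p q) s (1 + t) s'"
  unfolding reach_def
  by (cases "rd (s ! i) \<in> A") (meson runs.If_True runs.If_False add_left_mono)+

lemma reach_While_False: "rd (s ! i) \<notin> A \<Longrightarrow> reach (While i A p) s 1 s"
  unfolding reach_def using runs.While_False by blast

lemma reach_While_True:
  "rd (s ! i) \<in> A \<Longrightarrow> reach p s t s' \<Longrightarrow> reach (While i A p) s' t' s'' \<Longrightarrow>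
    reach (While i A p) s (1 + t + t') s''"
  unfolding reach_def by (meson runs.While_True add_mono order_refl)

text \<open>\<open>S k\<close> is the configuration at the test before round \<open>k\<close>. The
  induction counts the rounds that remain, so that its hypothesis is the rest of the
  execution.\<close>

lemma reach_While:
  assumes "\<And>k. k < n \<Longrightarrow> rd (S k ! i) \<in> A \<and> reach p (S k) t (S (Suc k))"
    and "rd (S n ! i) \<notin> A"
  shows "reach (While i A p) (S 0) (n * (t + 1) + 1) (S n)"
proof -
  have "reach (While i A p) (S (n - k)) (k * (t + 1) + 1) (S n)" if "k \<le> n" for k
    using that
  proof (induction k)
    case 0
    then show ?case using reach_While_False[OF assms(2)] by simp
  next
    case (Suc k)
    then have "Suc (n - Suc k) = n - k" by simp
    then show ?case
      using reach_While_True[of "S (n - Suc k)" i A p t "S (n - k)", OF _ _ Suc.IH]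
        assms(1)[of "n - Suc k"] Suc.prems by (auto elim!: reach_mono)
  qed
  from this[of n] show ?thesis by simp
qed

fun seqs :: "prog list \<Rightarrow> prog" where
  "seqs [] = Nop"
| "seqs (p # ps) = Seq p (seqs ps)"

lemma reach_seqs_Nil: "reach (seqs []) s 1 s"
  by (simp add: reach_Nop)

lemma reach_seqs_Cons:
  "reach p s t s' \<Longrightarrow> reach (seqs ps) s' t' s'' \<Longrightarrow> reach (seqs (p # ps)) s (t + t') s''"
  by (simp add: reach_Seq)

lemma tapes_below_seqs: "tapes_below K (seqs ps) \<longleftrightarrow> (\<forall>p\<in>set ps. tapes_below K p)"
  by (induction ps) auto

section \<open>Moving, writing, copying, rewinding and erasing\<close>

abbreviation nonblank :: "bool option set" where
  "nonblank \<equiv> {Some True, Some False}"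

lemma rd_tp [simp]: "rd (tp a []) = None" "rd (tp a (x # b)) = Some x"
  by (simp_all add: tp_def)

lemma tp_right: "mv Move_Right (wr (Some x) (tp a (y # b))) = tp (a @ [x]) b"
  by (simp add: tp_def)

lemma tp_write: "wr (Some x) (tp a (y # b)) = tp a (x # b)"
  by (simp add: tp_def)

lemma tp_append: "mv Move_Right (wr (Some x) (tp a [])) = tp (a @ [x]) []"
  by (simp add: tp_def)

definition right :: "nat \<Rightarrow> prog" where
  "right i = Op i i (\<lambda>_ b. b) Move_Right"

lemma reach_right:
  "s ! i = tp a (x # b) \<Longrightarrow> s' = s[i := tp (a @ [x]) b] \<Longrightarrow> reach (right i) s 1 s'"
  unfolding right_def by (rule reach_Op) (simp_all add: tp_right)

fun put :: "nat \<Rightarrow> bool list \<Rightarrow> prog" where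
  "put j [] = Nop"
| "put j (x # w) = Seq (Op j j (\<lambda>_ _. Some x) Move_Right) (put j w)"

lemma tapes_below_put [simp]: "j < K \<Longrightarrow> tapes_below K (put j w)"
  by (induction w) auto

lemma reach_put:
  "s ! j = tp a [] \<Longrightarrow> j < length s \<Longrightarrow> s' = s[j := tp (a @ w) []] \<Longrightarrow> reach (put j w) s (length w + 1) s'"
proof (induction w arbitrary: a s)
  case Nil
  then have "s' = s" by (metis append_Nil2 list_update_id)
  then show ?case using reach_Nop by simp
next
  case (Cons x w)
  let ?s = "s[j := tp (a @ [x]) []]"
  have 1: "reach (Op j j (\<lambda>_ _. Some x) Move_Right) s 1 ?s"
    using Cons.prems by (intro reach_Op) (simp_all add: tp_append)
  have 2: "reach (put j w) ?s (length w + 1) s'"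
    using Cons.prems by (intro Cons.IH[where a = "a @ [x]"]) simp_all
  show ?case using reach_mono[OF reach_Seq[OF 1 2]] by simp
qed

definition copy :: "nat \<Rightarrow> nat \<Rightarrow> prog" where
  "copy i j = Seq (Op i j (\<lambda>a _. a) Move_Right) (right i)"

lemma reach_copy:
  "s ! i = tp a (x # b) \<Longrightarrow> s ! j = tp c [] \<Longrightarrow> i \<noteq> j \<Longrightarrow>
    s' = s[i := tp (a @ [x]) b, j := tp (c @ [x]) []] \<Longrightarrow> reach (copy i j) s 2 s'"
  unfolding copy_def one_add_one[symmetric]
  by (rule reach_Seq, rule reach_Op, rule refl, simp, rule reach_right[of _ _ a x b])
    (simp_all add: tp_append list_update_swap)

text \<open>The head may stand on the blank after the text, where the loop would stop at once; hence
  the move before it. The loop ends on the blank at cell \<open>- 1\<close>, and the last move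
  returns to cell \<open>0\<close>.\<close>

definition rewind :: "nat \<Rightarrow> prog" where
  "rewind i = Seq (Op i i (\<lambda>_ b. b) Move_Left)
     (Seq (While i nonblank (Op i i (\<lambda>_ b. b) Move_Left)) (right i))"

lemma wr_rd_tp: "wr (rd (tp a b)) (tp a b) = tp a b"
  by (cases b) (simp_all add: tp_def)

lemma mv_left_tp:
  "mv Move_Left (tp [] b) = ([], bcons None (map Some b))"
  "mv Move_Left (tp (a @ [x]) b) = tp a (x # b)"
  by (simp_all add: tp_def)

text \<open>Describing the tape as the result of a left move covers both a head inside the text and
  the final position on cell \<open>- 1\<close>.\<close>

lemma reach_left_loop:
  "s ! i = mv Move_Left (tp a b) \<Longrightarrow> i < length s \<Longrightarrow>
    s' = s[i := ([], bcons None (map Some (a @ b)))] \<Longrightarrow>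
    reach (While i nonblank (Op i i (\<lambda>_ b. b) Move_Left)) s (2 * length a + 1) s'"
proof (induction a arbitrary: b s rule: rev_induct)
  case Nil
  then have "s' = s" by (metis append_Nil list_update_id mv_left_tp(1))
  moreover have "rd (s ! i) \<notin> nonblank" using Nil by (cases b) (auto simp: mv_left_tp)
  ultimately show ?case using reach_While_False by simp
next
  case (snoc x a)
  have "reach (While i nonblank (Op i i (\<lambda>_ b. b) Move_Left)) s (1 + 1 + (2 * length a + 1)) s'"
  proof (rule reach_While_True)
    show "rd (s ! i) \<in> nonblank" using snoc.prems by (simp add: mv_left_tp)
    show "reach (Op i i (\<lambda>_ b. b) Move_Left) s 1 (s[i := mv Move_Left (tp a (x # b))])"
      using snoc.prems by (intro reach_Op) (auto simp: mv_left_tp tp_write, simp add: tp_def)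
    show "reach (While i nonblank (Op i i (\<lambda>_ b. b) Move_Left))
        (s[i := mv Move_Left (tp a (x # b))]) (2 * length a + 1) s'"
      using snoc.prems by (intro snoc.IH) auto
  qed
  then show ?case by simp
qed

lemma reach_rewind:
  assumes "s ! i = tp a b" "i < length s" "s' = s[i := tp [] (a @ b)]"
  shows "reach (rewind i) s (2 * length a + 3) s'"
proof -
  have "reach (rewind i) s (1 + ((2 * length a + 1) + 1)) s'"
    unfolding rewind_def
  proof (intro reach_Seq)
    show "reach (Op i i (\<lambda>_ b. b) Move_Left) s 1 (s[i := mv Move_Left (tp a b)])"
      using assms by (intro reach_Op) (simp_all add: wr_rd_tp, simp add: tp_def)
    show "reach (While i nonblank (Op i i (\<lambda>_ b. b) Move_Left)) (s[i := mv Move_Left (tp a b)])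
        (2 * length a + 1) (s[i := ([], bcons None (map Some (a @ b)))])"
      using assms by (intro reach_left_loop) simp_all
    show "reach (right i) (s[i := ([], bcons None (map Some (a @ b)))]) 1 s'"
      unfolding right_def using assms
      by (intro reach_Op) (cases "a @ b"; simp add: tp_def)+
  qed
  then show ?thesis by (rule reach_mono) simp
qed

text \<open>Erasing proceeds from the right end, where a written blank is dropped at once; this
  leaves literally the empty tape. Erasing from the left would store blanks.\<close>

definition clear :: "nat \<Rightarrow> prog" where
  "clear i = Seq (While i nonblank (right i)) (Seq (Op i i (\<lambda>_ b. b) Move_Left)
     (Seq (While i nonblank (Op i i (\<lambda>_ _. None) Move_Left)) (right i)))"

lemma reach_erase_loop:
  "s ! i = mv Move_Left (tp a []) \<Longrightarrow> i < length s \<Longrightarrow> s' = s[i := ([], [])] \<Longrightarrow>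
    reach (While i nonblank (Op i i (\<lambda>_ _. None) Move_Left)) s (2 * length a + 1) s'"
proof (induction a arbitrary: s rule: rev_induct)
  case Nil
  then have "s' = s" by (metis bcons.simps(1) list.simps(8) list_update_id mv_left_tp(1))
  moreover have "rd (s ! i) \<notin> nonblank" using Nil by (auto simp: mv_left_tp)
  ultimately show ?case using reach_While_False by simp
next
  case (snoc x a)
  have "reach (While i nonblank (Op i i (\<lambda>_ _. None) Move_Left)) s (1 + 1 + (2 * length a + 1)) s'"
  proof (rule reach_While_True)
    show "rd (s ! i) \<in> nonblank" using snoc.prems by (simp add: mv_left_tp)
    show "reach (Op i i (\<lambda>_ _. None) Move_Left) s 1 (s[i := mv Move_Left (tp a [])])"
      using snoc.prems by (intro reach_Op) (simp_all add: mv_left_tp, simp_all add: tp_def)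
    show "reach (While i nonblank (Op i i (\<lambda>_ _. None) Move_Left))
        (s[i := mv Move_Left (tp a [])]) (2 * length a + 1) s'"
      using snoc.prems by (intro snoc.IH) simp_all
  qed
  then show ?case by simp
qed

lemma reach_right_loop:
  assumes "s ! i = tp a b" "i < length s" "s' = s[i := tp (a @ b) []]"
  shows "reach (While i nonblank (right i)) s (2 * length b + 1) s'"
proof -
  define S where "S k = s[i := tp (a @ take k b) (drop k b)]" for k
  have "reach (While i nonblank (right i)) (S 0) (length b * (1 + 1) + 1) (S (length b))"
  proof (rule reach_While)
    fix k assume k: "k < length b"
    then have "drop k b = b ! k # drop (Suc k) b" "take (Suc k) b = take k b @ [b ! k]"
      by (simp_all add: Cons_nth_drop_Suc take_Suc_conv_app_nth)
    then show "rd (S k ! i) \<in> nonblank \<and> reach (right i) (S k) 1 (S (Suc k))"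
      using assms unfolding S_def by (auto intro!: reach_right)
  qed (use assms in \<open>simp add: S_def\<close>)
  moreover have "S 0 = s" using assms by (simp add: S_def list_update_same_conv)
  ultimately show ?thesis using assms by (simp add: S_def mult.commute)
qed

lemma reach_clear:
  assumes "s ! i = tp a b" "i < length s" "s' = s[i := tp [] []]"
  shows "reach (clear i) s (4 * (length a + length b) + 4) s'"
proof -
  have "reach (clear i) s ((2 * length b + 1) + (1 + ((2 * length (a @ b) + 1) + 1))) s'"
    unfolding clear_def
  proof (intro reach_Seq)
    show "reach (While i nonblank (right i)) s (2 * length b + 1) (s[i := tp (a @ b) []])"
      using assms by (intro reach_right_loop) simp_all
    show "reach (Op i i (\<lambda>_ b. b) Move_Left) (s[i := tp (a @ b) []]) 1
        (s[i := mv Move_Left (tp (a @ b) [])])"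
      using assms wr_rd_tp[of "a @ b" "[]"] by (intro reach_Op) (simp_all, simp add: tp_def)
    show "reach (While i nonblank (Op i i (\<lambda>_ _. None) Move_Left))
        (s[i := mv Move_Left (tp (a @ b) [])]) (2 * length (a @ b) + 1) (s[i := ([], [])])"
      using assms by (intro reach_erase_loop) simp_all
    show "reach (right i) (s[i := ([], [])]) 1 s'"
      unfolding right_def using assms by (intro reach_Op) (simp_all add: tp_def)
  qed
  then show ?thesis by (rule reach_mono) simp
qed

text \<open>The source tape is restored by the rewinding, so the same code can be written to the
  output many times.\<close>

definition emit :: "nat \<Rightarrow> prog" where
  "emit i = Seq (While i nonblank (copy i 1)) (rewind i)"

lemma reach_emit:
  assumes "s ! i = tp [] w" "s ! 1 = tp y []" "i \<noteq> 1" "i < length s" "1 < length s"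
    "s' = s[1 := tp (y @ w) []]"
  shows "reach (emit i) s (5 * length w + 4) s'"
proof -
  define S where "S k = s[i := tp (take k w) (drop k w), 1 := tp (y @ take k w) []]" for k
  have 1: "reach (While i nonblank (copy i 1)) (S 0) (length w * (2 + 1) + 1) (S (length w))"
  proof (rule reach_While)
    fix k assume k: "k < length w"
    then have "drop k w = w ! k # drop (Suc k) w" "take (Suc k) w = take k w @ [w ! k]"
      by (simp_all add: Cons_nth_drop_Suc take_Suc_conv_app_nth)
    then show "rd (S k ! i) \<in> nonblank \<and> reach (copy i 1) (S k) 2 (S (Suc k))"
      using assms unfolding S_def
      by (auto intro!: reach_copy simp: list_update_swap[of 1 i])
  qed (use assms in \<open>simp add: S_def\<close>)
  have "s[1 := tp (y @ w) [], i := tp [] w] = s[1 := tp (y @ w) []]"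
    using assms by (metis list_update_id list_update_swap)
  then have 2: "reach (rewind i) (S (length w)) (2 * length w + 3) s'"
    using assms by (intro reach_rewind[of _ _ w "[]"]) (auto simp: S_def list_update_swap[of i 1])
  have "S 0 = s" using assms list_update_id[of s i] list_update_id[of s 1] by (simp add: S_def)
  then show ?thesis
    unfolding emit_def using reach_mono[OF reach_Seq[OF 1 2], of "5 * length w + 4"] by simp
qed

section \<open>Copying self-delimiting codes\<close>

lemma enc_list_conv: "enc_list enc xs = concat (map (\<lambda>x. True # enc x) xs) @ [False]"
  by (induction xs) auto

abbreviation enc_bits :: "bool list \<Rightarrow> bool list" where
  "enc_bits \<equiv> enc_list (\<lambda>b. [b])"

lemma length_enc_bits: "length (enc_bits ds) = 2 * length ds + 1"
  by (induction ds) auto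

definition copy_bits :: "nat \<Rightarrow> nat \<Rightarrow> prog" where
  "copy_bits i j = Seq (While i {Some True} (Seq (copy i j) (copy i j))) (copy i j)"

text \<open>Each round of the loop passes a marker and its digit, and the loop stops on the closing
  \<open>False\<close>. The text passed so far lacks this symbol, which explains the form
  \<open>a' @ [False] = a @ enc_bits ds\<close>.\<close>

lemma reach_copy_bits:
  "s ! i = tp a (enc_bits ds @ b) \<Longrightarrow> s ! j = tp c [] \<Longrightarrow> i \<noteq> j \<Longrightarrow> i < length s \<Longrightarrow> j < length s \<Longrightarrow>
    s' = s[i := tp (a @ enc_bits ds) b, j := tp (c @ enc_bits ds) []] \<Longrightarrow>
    reach (copy_bits i j) s (5 * length (enc_bits ds)) s'"
proof -
  have loop: "s ! i = tp a (enc_bits ds @ b) \<Longrightarrow> s ! j = tp c [] \<Longrightarrow> i \<noteq> j \<Longrightarrow> i < length s \<Longrightarrow>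
    j < length s \<Longrightarrow> \<exists>a' c'. a' @ [False] = a @ enc_bits ds \<and> c' @ [False] = c @ enc_bits ds \<and>
    reach (While i {Some True} (Seq (copy i j) (copy i j))) s (5 * length ds + 1)
      (s[i := tp a' (False # b), j := tp c' []])" for s a c
  proof (induction ds arbitrary: s a c)
    case Nil
    then have "s[i := tp a (False # b), j := tp c []] = s"
      using list_update_id[of s i] list_update_id[of s j] by simp
    then show ?case using Nil by (auto intro!: reach_While_False)
  next
    case (Cons d ds)
    let ?s1 = "s[i := tp (a @ [True]) (d # enc_bits ds @ b), j := tp (c @ [True]) []]"
    let ?s = "s[i := tp (a @ [True, d]) (enc_bits ds @ b), j := tp (c @ [True, d]) []]"
    have 1: "reach (Seq (copy i j) (copy i j)) s (2 + 2) ?s"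
    proof (rule reach_Seq)
      show "reach (copy i j) s 2 ?s1" using Cons.prems by (intro reach_copy) auto
      show "reach (copy i j) ?s1 2 ?s" using Cons.prems
        by (intro reach_copy[where a = "a @ [True]" and c = "c @ [True]"])
          (auto simp: list_update_swap[of i j])
    qed
    obtain a' c' where a': "a' @ [False] = (a @ [True, d]) @ enc_bits ds"
      "c' @ [False] = (c @ [True, d]) @ enc_bits ds"
      and 2: "reach (While i {Some True} (Seq (copy i j) (copy i j))) ?s (5 * length ds + 1)
        (?s[i := tp a' (False # b), j := tp c' []])"
      using Cons.IH[of ?s "a @ [True, d]" "c @ [True, d]"] Cons.prems by auto
    have 3: "?s[i := tp a' (False # b), j := tp c' []] = s[i := tp a' (False # b), j := tp c' []]"
      using Cons.prems by (simp add: list_update_swap[of i j])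
    have "reach (While i {Some True} (Seq (copy i j) (copy i j))) s (5 * length (d # ds) + 1)
        (s[i := tp a' (False # b), j := tp c' []])"
      using reach_mono[OF reach_While_True[OF _ 1 2[unfolded 3]]] Cons.prems by simp
    moreover have "a' @ [False] = a @ enc_bits (d # ds)" "c' @ [False] = c @ enc_bits (d # ds)"
      using a' by simp_all
    ultimately show ?case by blast
  qed
  assume s: "s ! i = tp a (enc_bits ds @ b)" "s ! j = tp c []" "i \<noteq> j" "i < length s" "j < length s"
    "s' = s[i := tp (a @ enc_bits ds) b, j := tp (c @ enc_bits ds) []]"
  from loop[OF s(1-5)] obtain a' c' where a': "a' @ [False] = a @ enc_bits ds"
    "c' @ [False] = c @ enc_bits ds"
    "reach (While i {Some True} (Seq (copy i j) (copy i j))) s (5 * length ds + 1)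
      (s[i := tp a' (False # b), j := tp c' []])" by blast
  have "reach (copy i j) (s[i := tp a' (False # b), j := tp c' []]) 2 s'"
    using s a' by (intro reach_copy) (auto simp: list_update_swap[of i j])
  from reach_Seq[OF a'(3) this] show "reach (copy_bits i j) s (5 * length (enc_bits ds)) s'"
    unfolding copy_bits_def by (rule reach_mono) (simp add: length_enc_bits)
qed

text \<open>Numerator and denominator are both coded as integers, so a sign bit precedes each of the
  two numbers.\<close>

definition copy_rat :: "nat \<Rightarrow> nat \<Rightarrow> prog" where
  "copy_rat i j = seqs [copy i j, copy_bits i j, copy i j, copy_bits i j]"

lemma reach_copy_nat:
  "s ! i = tp a (enc_nat n @ b) \<Longrightarrow> s ! j = tp c [] \<Longrightarrow> i \<noteq> j \<Longrightarrow> i < length s \<Longrightarrow> j < length s \<Longrightarrow>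
    s' = s[i := tp (a @ enc_nat n) b, j := tp (c @ enc_nat n) []] \<Longrightarrow>
    reach (copy_bits i j) s (5 * length (enc_nat n)) s'"
  unfolding enc_nat_def by (rule reach_copy_bits)

lemma reach_copy_rat:
  assumes "s ! i = tp a (enc_rat q @ b)" "s ! j = tp c []" "i \<noteq> j" "i < length s" "j < length s"
    "s' = s[i := tp (a @ enc_rat q) b, j := tp (c @ enc_rat q) []]"
  shows "reach (copy_rat i j) s (5 * length (enc_rat q)) s'"
proof -
  obtain x n y m where q: "enc_rat q = x # enc_nat n @ y # enc_nat m"
    by (simp add: enc_rat_def enc_int_def)
  have "reach (copy_rat i j) s (2 + (5 * length (enc_nat n) + (2 + (5 * length (enc_nat m) + 1)))) s'"
    unfolding copy_rat_def
    apply (rule reach_seqs_Cons)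
     apply (rule reach_copy[of s i a x "enc_nat n @ y # enc_nat m @ b" j c])
        apply (use assms q in \<open>simp_all\<close>)[3]
     apply (rule refl)
    apply (rule reach_seqs_Cons)
     apply (rule reach_copy_nat[of _ i "a @ [x]" n "y # enc_nat m @ b" j "c @ [x]"])
          apply (use assms q in \<open>simp_all\<close>)[5]
     apply (rule refl)
    apply (rule reach_seqs_Cons)
     apply (rule reach_copy[of _ i "a @ x # enc_nat n" y "enc_nat m @ b" j "c @ x # enc_nat n"])
        apply (use assms q in \<open>simp_all\<close>)[3]
     apply (rule refl)
    apply (rule reach_seqs_Cons)
     apply (rule reach_copy_nat[of _ i "a @ x # enc_nat n @ [y]" m b j "c @ x # enc_nat n @ [y]"])
          apply (use assms q in \<open>simp_all\<close>)[5]
     apply (rule refl)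
    using assms q by (simp add: list_update_swap[of i j] reach_Nop)
  then show ?thesis by (rule reach_mono) (simp add: q)
qed



text \<open>These rules evaluate updates of explicit tape lists at numeral positions without
  rewriting the numerals to successors.\<close>

lemma nth_update_Cons_simps [simp]:
  "(x # xs) ! 1 = xs ! 0"
  "(x # xs)[1 := y] = x # xs[0 := y]"
  "(x # xs)[numeral n := y] = x # xs[pred_numeral n := y]"
  "(x # xs)[0 := y] = y # xs"
  "(x # xs)[Suc m := y] = x # xs[m := y]"
  by (simp_all add: One_nat_def numeral_eq_Suc)

declare list_update.simps(2) [simp del]

lemma reach_weaken: "reach p s t s1 \<Longrightarrow> s1 = s' \<Longrightarrow> t \<le> t' \<Longrightarrow> reach p s t' s'"
  using reach_mono by blast

section \<open>Binary increment\<close>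

fun inc_bits :: "bool list \<Rightarrow> bool list" where
  "inc_bits [] = [True]"
| "inc_bits (False # ds) = True # ds"
| "inc_bits (True # ds) = False # inc_bits ds"

lemma binary_digits_Suc: "binary_digits (Suc n) = inc_bits (binary_digits n)"
proof (induction n rule: less_induct)
  case (less n)
  show ?case
  proof (cases "even n")
    case True
    then have "Suc n div 2 = n div 2" by simp
    with True show ?thesis
      using binary_digits.simps[of "Suc n"] binary_digits.simps[of n]
      by (cases "n = 0") (auto simp: binary_digits.simps[of 0])
  next
    case False
    then have "Suc n div 2 = Suc (n div 2)" "n \<noteq> 0" by (auto elim: oddE)
    with False show ?thesis
      using binary_digits.simps[of "Suc n"] binary_digits.simps[of n] less[of "n div 2"] by auto
  qed
qed

text \<open>After the first move the head is on a digit, or on the blank if there is none. The loop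
  turns digits \<open>True\<close> into \<open>False\<close> and steps over the next marker. A digit
  \<open>False\<close> absorbs the carry. On the blank the number has to grow: the closing
  \<open>False\<close> to the left becomes a marker, followed by the new digit \<open>True\<close>
  and a new closing \<open>False\<close>.\<close>

definition inc :: "nat \<Rightarrow> prog" where
  "inc i = seqs [right i,
     While i {Some True} (Seq (Op i i (\<lambda>_ _. Some False) Move_Right) (right i)),
     If i {Some False} (Op i i (\<lambda>_ _. Some True) Stay)
       (Seq (Op i i (\<lambda>_ b. b) Move_Left)
         (Seq (Op i i (\<lambda>_ _. Some True) Move_Right) (put i [True, False]))),
     rewind i]"

text \<open>The invariant is that the passed text followed by the incremented rest is the
  incremented whole. The head is one symbol inside the code of the rest, whence \<open>hd\<close>
  and \<open>tl\<close>; if no digit is left, that symbol is the closing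
  \<open>False\<close>.\<close>

lemma reach_inc_loop:
  "s ! i = tp (a @ [hd (enc_bits ds)]) (tl (enc_bits ds)) \<Longrightarrow> i < length s \<Longrightarrow>
    \<exists>a' ds'. a' @ enc_bits (inc_bits ds') = a @ enc_bits (inc_bits ds) \<and>
      (ds' = [] \<or> hd ds' = False) \<and>
      reach (While i {Some True} (Seq (Op i i (\<lambda>_ _. Some False) Move_Right) (right i))) s
        (3 * length ds + 1) (s[i := tp (a' @ [hd (enc_bits ds')]) (tl (enc_bits ds'))])"
proof (induction ds arbitrary: a s)
  case Nil
  then show ?case using list_update_id[of s i]
    by (rule_tac exI[of _ a], rule_tac exI[of _ "[]"]) (auto intro!: reach_While_False)
next
  case (Cons d ds)
  show ?case
  proof (cases d)
    case False
    then show ?thesis using Cons.prems list_update_id[of s i]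
      by (rule_tac exI[of _ a], rule_tac exI[of _ "d # ds"])
        (auto intro!: reach_mono[OF reach_While_False])
  next
    case True
    obtain t r where tr: "enc_bits ds = t # r" by (cases ds) auto
    let ?s1 = "s[i := tp (a @ [True, False]) (enc_bits ds)]"
    let ?s2 = "s[i := tp ((a @ [True, False]) @ [t]) r]"
    obtain a' ds' where a': "a' @ enc_bits (inc_bits ds') = (a @ [True, False]) @ enc_bits (inc_bits ds)"
      "ds' = [] \<or> hd ds' = False"
      "reach (While i {Some True} (Seq (Op i i (\<lambda>_ _. Some False) Move_Right) (right i))) ?s2
        (3 * length ds + 1) (?s2[i := tp (a' @ [hd (enc_bits ds')]) (tl (enc_bits ds'))])"
      using Cons.IH[of ?s2 "a @ [True, False]"] Cons.prems tr by auto
    have "reach (Op i i (\<lambda>_ _. Some False) Move_Right) s 1 ?s1"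
      using Cons.prems True by (intro reach_Op) (simp_all add: tp_right)
    moreover have "reach (right i) ?s1 1 ?s2"
      using Cons.prems tr by (intro reach_right) auto
    ultimately have "reach (While i {Some True} (Seq (Op i i (\<lambda>_ _. Some False) Move_Right) (right i))) s
        (1 + (1 + 1) + (3 * length ds + 1)) (?s2[i := tp (a' @ [hd (enc_bits ds')]) (tl (enc_bits ds'))])"
      using Cons.prems True a'(3) by (intro reach_While_True reach_Seq) auto
    then show ?thesis using a' True by (rule_tac exI[of _ a'], rule_tac exI[of _ ds']) (auto elim: reach_mono)
  qed
qed

lemma reach_inc_bits:
  assumes s: "s ! i = tp [] (enc_bits ds)" "i < length s"
    "s' = s[i := tp [] (enc_bits (inc_bits ds))]"
  shows "reach (inc i) s (10 * length (enc_bits ds) + 20) s'"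
proof -
  obtain t r where tr: "enc_bits ds = t # r" by (cases ds) auto
  let ?s1 = "s[i := tp [t] r]"
  have 1: "reach (right i) s 1 ?s1" using s tr by (intro reach_right) auto
  obtain a' ds' where a': "a' @ enc_bits (inc_bits ds') = enc_bits (inc_bits ds)"
    "ds' = [] \<or> hd ds' = False"
    and 2: "reach (While i {Some True} (Seq (Op i i (\<lambda>_ _. Some False) Move_Right) (right i))) ?s1
        (3 * length ds + 1) (s[i := tp (a' @ [hd (enc_bits ds')]) (tl (enc_bits ds'))])"
    using reach_inc_loop[of ?s1 i "[]" ds] s tr by auto
  let ?s2 = "s[i := tp (a' @ [hd (enc_bits ds')]) (tl (enc_bits ds'))]"
  let ?If = "If i {Some False} (Op i i (\<lambda>_ _. Some True) Stay)
       (Seq (Op i i (\<lambda>_ b. b) Move_Left)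
         (Seq (Op i i (\<lambda>_ _. Some True) Move_Right) (put i [True, False])))"
  obtain b c where bc: "b @ c = enc_bits (inc_bits ds)" and
    3: "reach ?If ?s2 (1 + (1 + (1 + 3))) (s[i := tp b c])"
  proof (cases ds')
    case Nil
    have l1: "reach (Op i i (\<lambda>_ b. b) Move_Left) ?s2 1 (s[i := tp a' [False]])"
      using s Nil wr_rd_tp[of "a' @ [False]" "[]"]
      by (intro reach_Op) (simp_all add: mv_left_tp, simp add: tp_def)
    have l2: "reach (Op i i (\<lambda>_ _. Some True) Move_Right) (s[i := tp a' [False]]) 1
        (s[i := tp (a' @ [True]) []])"
      using s by (intro reach_Op) (simp_all add: tp_right)
    have l3: "reach (put i [True, False]) (s[i := tp (a' @ [True]) []]) (length [True, False] + 1)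
        (s[i := tp (a' @ [True, True, False]) []])"
      using s by (intro reach_put) auto
    have "reach (Seq (Op i i (\<lambda>_ b. b) Move_Left)
         (Seq (Op i i (\<lambda>_ _. Some True) Move_Right) (put i [True, False]))) ?s2 (1 + (1 + 3))
         (s[i := tp (a' @ [True, True, False]) []])"
      by (rule reach_mono[OF reach_Seq[OF l1 reach_Seq[OF l2 l3]]]) simp
    then have "reach ?If ?s2 (1 + (1 + (1 + 3))) (s[i := tp (a' @ [True, True, False]) []])"
      using Nil s by (intro reach_If) auto
    then show ?thesis using a' Nil by (intro that[of "a' @ [True, True, False]" "[]"]) auto
  next
    case (Cons d ds'')
    have "reach (Op i i (\<lambda>_ _. Some True) Stay) ?s2 1 (s[i := tp (a' @ [True]) (True # enc_bits ds'')])"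
      using Cons s by (intro reach_Op) (auto simp: tp_write)
    then have "reach ?If ?s2 (1 + (1 + (1 + 3))) (s[i := tp (a' @ [True]) (True # enc_bits ds'')])"
      using Cons s a'(2) by (intro reach_If) (auto elim: reach_mono)
    then show ?thesis using a' Cons by (intro that[of "a' @ [True]" "True # enc_bits ds''"]) auto
  qed
  have 4: "reach (rewind i) (s[i := tp b c]) (2 * length b + 3) s'"
    using s bc by (intro reach_rewind) auto
  have "length (inc_bits ds) \<le> length ds + 1" by (induction ds rule: inc_bits.induct) auto
  then have "length b \<le> 2 * length ds + 3" using arg_cong[OF bc, of length] by (simp add: length_enc_bits)
  then show ?thesis unfolding inc_def
    by (intro reach_mono[OF reach_seqs_Cons[OF 1 reach_seqs_Cons[OF 2
            reach_seqs_Cons[OF 3 reach_seqs_Cons[OF 4 reach_seqs_Nil]]]]])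
      (simp add: length_enc_bits)
qed

lemma reach_inc:
  "s ! i = tp [] (enc_nat n) \<Longrightarrow> i < length s \<Longrightarrow> s' = s[i := tp [] (enc_nat (Suc n))] \<Longrightarrow>
    reach (inc i) s (10 * length (enc_nat n) + 20) s'"
  unfolding enc_nat_def binary_digits_Suc by (rule reach_inc_bits)



text \<open>Rules for symbolic execution, numbered by their side conditions.\<close>

lemmas exec2 = reach_seqs_Cons[OF reach_right]
lemmas exec3 = reach_seqs_Cons[OF reach_put] reach_seqs_Cons[OF reach_rewind]
  reach_seqs_Cons[OF reach_clear] reach_seqs_Cons[OF reach_inc]
lemmas exec6 = reach_seqs_Cons[OF reach_emit] reach_seqs_Cons[OF reach_copy_nat]
  reach_seqs_Cons[OF reach_copy_rat]


section \<open>Computing the directed instance\<close>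

text \<open>
  The vertex \<open>z\<close> is \<open>0\<close>; a vertex \<open>v\<close> becomes \<open>2 * v + 1\<close> with copy \<open>4 * v + 2\<close>; and the gadget of the
  edge with index \<open>t\<close> uses \<open>x = 4 * j + 2\<close> and \<open>y = 2 * j + 1\<close> for \<open>j = n + t\<close>. The codes of these
  numbers arise from those of \<open>v\<close> and \<open>j\<close> by prepending fixed bits. Unused numbers are isolated vertices.
\<close>

definition vertex_arcs :: "rat \<Rightarrow> nat \<Rightarrow> ((nat \<times> nat) \<times> rat) list" where
  "vertex_arcs B v = [((2 * v + 1, 4 * v + 2), B), ((0, 4 * v + 2), B)]"

definition edge_arcs :: "nat \<Rightarrow> (nat \<times> nat) \<times> rat \<Rightarrow> ((nat \<times> nat) \<times> rat) list" where
  "edge_arcs j = (\<lambda>((u, v), c). [((2 * u + 1, 4 * j + 2), c), ((2 * v + 1, 4 * j + 2), c),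
     ((4 * j + 2, 2 * j + 1), c), ((2 * j + 1, 2 * u + 1), c), ((2 * j + 1, 2 * v + 1), c)])"

text \<open>The order is that of the vertex numbers: \<open>z\<close> comes first, and since
  \<open>v\<close> has become \<open>2 * v + 1\<close>, each supply is followed by a
  \<open>0\<close> for the even number after it.\<close>

definition spread_row :: "nat \<Rightarrow> rat list \<Rightarrow> rat list" where
  "spread_row p s = - 1 # concat (map (\<lambda>q. [q, 0]) s) @ replicate p 0"

text \<open>One quantity serves twice, as the number of extra vertices that makes room for the
  numbers \<open>4 * j + 2\<close> and as the exponent of the large capacity.\<close>

definition slack :: "flow_instance \<Rightarrow> nat" where
  "slack I = 4 * length (enc_instance I)"

definition to_directed :: "flow_instance \<Rightarrow> flow_instance" where
  "to_directed I = \<lparr>n_verts = 1 + 2 * n_verts I + slack I,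
     cap_arcs = concat (map (vertex_arcs (2 ^ slack I)) [0..<n_verts I]) @
       concat (map (\<lambda>t. edge_arcs (n_verts I + t) (cap_arcs I ! t)) [0..<length (cap_arcs I)]),
     supplies = map (spread_row (slack I)) (supplies I)\<rparr>"

text \<open>A loop that writes a list has produced, after each round, a code without its closing
  symbol; this form is additive in the list.\<close>

definition enc_items :: "('a \<Rightarrow> bool list) \<Rightarrow> 'a list \<Rightarrow> bool list" where
  "enc_items enc xs = concat (map (\<lambda>x. True # enc x) xs)"

lemma enc_list_items: "enc_list enc xs = enc_items enc xs @ [False]"
  by (simp add: enc_list_conv enc_items_def)

lemma enc_items_simps [simp]:
  "enc_items enc [] = []"
  "enc_items enc (x # xs) = True # enc x @ enc_items enc xs"
  "enc_items enc (xs @ ys) = enc_items enc xs @ enc_items enc ys"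
  by (simp_all add: enc_items_def)

lemma enc_items_take_Suc:
  "k < length xs \<Longrightarrow> enc_items enc (take (Suc k) xs) = enc_items enc (take k xs) @ True # enc (xs ! k)"
  by (simp add: take_Suc_conv_app_nth)

lemma enc_items_drop:
  "k < length xs \<Longrightarrow> enc_items enc (drop k xs) = True # enc (xs ! k) @ enc_items enc (drop (Suc k) xs)"
  by (simp add: Cons_nth_drop_Suc[symmetric])

lemma length_enc_le: "x \<in> set xs \<Longrightarrow> length (enc x) \<le> length (enc_list enc xs)"
  by (induction xs) auto

lemma length_le_enc_list: "length xs \<le> length (enc_list enc xs)"
  by (induction xs) auto

lemma enc_items_units: "enc_items (\<lambda>_. []) (replicate n ()) = replicate n True"
  by (induction n) simp_all

lemma enc_nat_0: "enc_nat 0 = [False]"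
  by (simp add: enc_nat_def binary_digits.simps)

lemma enc_nat_double_Suc: "enc_nat (2 * k + 1) = True # True # enc_nat k"
  by (simp add: enc_nat_def binary_digits.simps[of "2 * k + 1"])

lemma enc_nat_double: "0 < k \<Longrightarrow> enc_nat (2 * k) = True # False # enc_nat k"
  by (simp add: enc_nat_def binary_digits.simps[of "2 * k"])

text \<open>This is the reason for \<open>4 * k + 2\<close> instead of \<open>4 * k\<close>: its
  code extends that of \<open>k\<close> even for \<open>k = 0\<close>, whereas doubling
  \<open>0\<close> adds no digit.\<close>

lemma enc_nat_quad: "enc_nat (4 * k + 2) = True # False # True # True # enc_nat k"
  using enc_nat_double[of "2 * k + 1"] enc_nat_double_Suc[of k] by (simp add: algebra_simps)

lemmas enc_nat_quad' = enc_nat_quad[simplified]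

lemma enc_nat_1: "enc_nat 1 = [True, True, False]"
  by (simp add: enc_nat_def binary_digits.simps)

lemma enc_rat_of_int: "enc_rat (of_int i) = (i < 0) # enc_nat (nat \<bar>i\<bar>) @ [False, True, True, False]"
  by (simp add: enc_rat_def enc_int_def enc_nat_1[unfolded One_nat_def])

lemma enc_rat_0: "enc_rat 0 = [False, False, False, True, True, False]"
  using enc_rat_of_int[of 0] by (simp add: enc_nat_0)

lemma enc_rat_minus_1: "enc_rat (- 1) = [True, True, True, False, False, True, True, False]"
  using enc_rat_of_int[of "- 1"] by (simp add: enc_nat_1[unfolded One_nat_def])

lemma enc_nat_power2: "enc_nat (2 ^ k) = concat (replicate k [True, False]) @ [True, True, False]"
  by (induction k) (simp_all add: enc_nat_1 enc_nat_double)

lemma enc_rat_power2: "enc_rat (2 ^ k) =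
    False # concat (replicate k [True, False]) @ [True, True, False, False, True, True, False]"
  using enc_rat_of_int[of "2 ^ k"] by (simp add: enc_nat_power2 nat_power_eq)

lemma length_enc_nat_le: "length (enc_nat j) \<le> 2 * j + 1"
proof -
  have "length (binary_digits j) \<le> j"
  proof (induction j rule: less_induct)
    case (less j)
    show ?case
    proof (cases "j = 0")
      case False
      then have "length (binary_digits (j div 2)) \<le> j div 2" using less by simp
      then show ?thesis using False binary_digits.simps[of j] by simp
    qed (simp add: binary_digits.simps)
  qed
  then show ?thesis by (simp add: enc_nat_def length_enc_bits)
qed

text \<open>
  Tape 2 holds the code of the running index \<open>j\<close>, tapes 3 to 5 the two ends and the capacity of the
  current edge, tape 6 the code of the large capacity, and tape 7 the zeros that fill up a row of supplies.
\<close>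

definition scan_unit :: "nat \<Rightarrow> prog" where
  "scan_unit d = seqs [put 1 (replicate d True), put 6 [True, False, True, False, True, False, True, False],
     put 7 (let z = True # enc_rat 0 in z @ z @ z @ z), right 0]"

text \<open>Every input symbol adds four vertices, four doublings of the large capacity and four
  zeros of padding. A symbol of the unary vertex count adds two more vertices, hence the
  \<open>6\<close>. The initial \<open>True\<close> counts \<open>z\<close>. On tape 6 the initial
  \<open>False\<close> is the sign, and the final bits are the leading digit, the closing symbol and
  the denominator \<open>1\<close>.\<close>

definition scan_input :: prog where
  "scan_input = seqs [put 1 [True], put 6 [False],
     While 0 {Some True} (scan_unit 6), While 0 nonblank (scan_unit 4),
     put 1 [False], put 6 [True, True, False, False, True, True, False], put 2 [False],
     rewind 0, rewind 2, rewind 6, rewind 7]"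

text \<open>Each arc begins with an item marker \<open>True\<close>. Otherwise
  \<open>True, True\<close> extends the code of \<open>v\<close> to that of
  \<open>2 * v + 1\<close>, \<open>True, False, True, True\<close> extends it to that of
  \<open>4 * v + 2\<close>, and a single \<open>False\<close> is the code of
  \<open>0\<close>.\<close>

definition write_vertex_arcs :: prog where
  "write_vertex_arcs = seqs [
     put 1 [True, True, True], emit 2, put 1 [True, False, True, True], emit 2, emit 6,
     put 1 [True, False, True, False, True, True], emit 2, emit 6, inc 2, right 0]"

definition write_edge_arcs :: prog where
  "write_edge_arcs = seqs [right 0, copy_bits 0 3, copy_bits 0 4, copy_rat 0 5,
     rewind 3, rewind 4, rewind 5,
     put 1 [True, True, True], emit 3, put 1 [True, False, True, True], emit 2, emit 5,
     put 1 [True, True, True], emit 4, put 1 [True, False, True, True], emit 2, emit 5,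
     put 1 [True, True, False, True, True], emit 2, put 1 [True, True], emit 2, emit 5,
     put 1 [True, True, True], emit 2, put 1 [True, True], emit 3, emit 5,
     put 1 [True, True, True], emit 2, put 1 [True, True], emit 4, emit 5,
     inc 2, clear 3, clear 4, clear 5]"

definition write_supply :: prog where
  "write_supply = seqs [right 0, put 1 [True], copy_rat 0 1, put 1 (True # enc_rat 0)]"

text \<open>The first \<open>True\<close> marks the row and the second its first entry, the supply
  \<open>- 1\<close> of \<open>z\<close>.\<close>

definition write_row :: prog where
  "write_row = seqs [right 0, put 1 (True # True # enc_rat (- 1)), While 0 {Some True} write_supply,
     right 0, emit 7, put 1 [False]]"

definition reduction_prog :: prog where
  "reduction_prog = seqs [scan_input, While 0 {Some True} write_vertex_arcs, right 0,
     While 0 {Some True} write_edge_arcs, right 0, put 1 [False],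
     While 0 {Some True} write_row, put 1 [False]]"

section \<open>The loop bodies for vertices, edges and supplies\<close>

abbreviation st :: "bool list \<Rightarrow> bool list \<Rightarrow> bool list \<Rightarrow> nat \<Rightarrow> bool list \<Rightarrow> bool list \<Rightarrow> ltape list" where
  "st a b y j bg pd \<equiv> [tp a b, tp y [], tp [] (enc_nat j), tp [] [], tp [] [], tp [] [],
     tp [] bg, tp [] pd]"

text \<open>\<open>W\<close> bounds the codes that a round handles, and its factor is a generous
  bound on the costs that symbolic execution adds up.\<close>

lemma reach_write_vertex_arcs:
  assumes "length (enc_nat v) \<le> W" "length (enc_rat B) \<le> W" "1 \<le> W"
  shows "reach write_vertex_arcs (st a (x # b) y v (enc_rat B) pd) (100 * W)
    (st (a @ [x]) b (y @ enc_items enc_cap_arc (vertex_arcs B v)) (Suc v) (enc_rat B) pd)"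
  unfolding write_vertex_arcs_def
  apply (rule reach_weaken)
    apply ((rule exec3, simp, simp, simp | rule exec6, simp, simp, simp, simp, simp, simp
      | rule exec2, simp, simp)+, rule reach_seqs_Nil)
  using assms by (simp_all add: vertex_arcs_def enc_cap_arc_def enc_nat_double_Suc enc_nat_quad' enc_nat_0)

lemma reach_write_edge_arcs:
  assumes "e = ((u, v), c)" "length (enc_cap_arc e) \<le> W" "length (enc_nat j) \<le> W" "1 \<le> W"
  shows "reach write_edge_arcs (st a (True # enc_cap_arc e @ b) y j bg pd) (300 * W)
    (st (a @ True # enc_cap_arc e) b (y @ enc_items enc_cap_arc (edge_arcs j e)) (Suc j) bg pd)"
  unfolding write_edge_arcs_def assms(1) enc_cap_arc_def prod.case append_assoc
  apply (rule reach_weaken)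
    apply ((rule exec3, simp, simp, simp | rule exec6, simp, simp, simp, simp, simp, simp
      | rule exec2, simp, simp)+, rule reach_seqs_Nil)
  using assms by (simp_all add: edge_arcs_def enc_cap_arc_def enc_nat_double_Suc enc_nat_quad' enc_nat_0)

lemma reach_write_supply:
  assumes "length (enc_rat q) \<le> W" "1 \<le> W"
  shows "reach write_supply (st a (True # enc_rat q @ b) y j bg pd) (20 * W)
    (st (a @ True # enc_rat q) b (y @ enc_items enc_rat [q, 0]) j bg pd)"
  unfolding write_supply_def
  apply (rule reach_weaken)
    apply ((rule exec3, simp, simp, simp | rule exec6, simp, simp, simp, simp, simp, simp
      | rule exec2, simp, simp)+, rule reach_seqs_Nil)
  using assms by (simp_all add: enc_rat_0)


section \<open>Scanning the input\<close>

definition repeat4 :: "nat \<Rightarrow> bool list \<Rightarrow> bool list" where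
  "repeat4 k z = concat (replicate (4 * k) z)"

lemma repeat4_simps: "repeat4 0 z = []" "repeat4 (Suc k) z = repeat4 k z @ z @ z @ z @ z"
proof -
  have "4 * Suc k = 4 * k + 4" by simp
  then have "repeat4 (Suc k) z = concat (replicate (4 * k + 4) z)" by (simp only: repeat4_def)
  also have "\<dots> = repeat4 k z @ concat (replicate 4 z)"
    by (simp only: replicate_add concat_append repeat4_def)
  finally show "repeat4 (Suc k) z = repeat4 k z @ z @ z @ z @ z" by (simp add: numeral_eq_Suc)
qed (simp add: repeat4_def)

lemma length_repeat4: "length (repeat4 k z) = 4 * k * length z"
  by (induction k) (simp_all add: repeat4_simps algebra_simps)

definition pad :: "nat \<Rightarrow> bool list" where
  "pad k = repeat4 k (True # enc_rat 0)"

abbreviation sc :: "bool list \<Rightarrow> bool list \<Rightarrow> bool list \<Rightarrow> nat \<Rightarrow> ltape list" where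
  "sc a b y k \<equiv> [tp a b, tp y [], tp [] [], tp [] [], tp [] [], tp [] [],
     tp (False # repeat4 k [True, False]) [], tp (pad k) []]"

lemma reach_scan_unit:
  "d \<le> 6 \<Longrightarrow> reach (scan_unit d) (sc a (x # b) y k) 100
    (sc (a @ [x]) b (y @ replicate d True) (Suc k))"
  unfolding scan_unit_def Let_def
  apply (rule reach_weaken)
    apply ((rule exec3, simp, simp, simp | rule exec2, simp, simp)+, rule reach_seqs_Nil)
  by (simp_all add: repeat4_simps pad_def enc_rat_0)

lemma replicate_diff: "k < n \<Longrightarrow> replicate (n - k) x = x # replicate (n - Suc k) x"
  by (metis Suc_diff_Suc replicate_Suc)

lemma replicate_snoc: "replicate k x @ [x] = replicate (Suc k) x"
  by (simp add: replicate_append_same)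

lemma reach_scan_input:
  assumes x: "x = replicate n True @ False # w"
  shows "reach scan_input (tp [] x # replicate 7 (tp [] [])) (1000 * (length x + 1))
    (st [] x (replicate (1 + 2 * n + 4 * length x) True @ [False]) 0
      (enc_rat (2 ^ (4 * length x))) (pad (length x)))"
proof -
  let ?w = "False # w"
  define S where "S k = sc (replicate k True) (replicate (n - k) True @ ?w) (replicate (1 + 6 * k) True) k"
    for k
  have "reach (While 0 {Some True} (scan_unit 6)) (S 0) (n * (100 + 1) + 1) (S n)"
  proof (rule reach_While)
    fix k assume "k < n"
    then have S: "S k = sc (replicate k True) (True # replicate (n - Suc k) True @ ?w)
        (replicate (1 + 6 * k) True) k"
      by (simp add: S_def replicate_diff)
    have "1 + 6 * k + 6 = 1 + 6 * Suc k" by simp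
    then have y: "replicate (1 + 6 * k) True @ replicate 6 True = replicate (1 + 6 * Suc k) True"
      by (simp only: replicate_add[symmetric])
    have "reach (scan_unit 6) (S k) 100 (S (Suc k))"
      unfolding S unfolding S_def y[symmetric] replicate_snoc[symmetric] by (rule reach_scan_unit) simp
    then show "rd (S k ! 0) \<in> {Some True} \<and> reach (scan_unit 6) (S k) 100 (S (Suc k))"
      by (simp add: S)
  qed (simp add: S_def)
  moreover define R where "R k = sc (replicate n True @ take k ?w) (drop k ?w)
      (replicate (1 + 6 * n + 4 * k) True) (n + k)" for k
  have "reach (While 0 nonblank (scan_unit 4)) (R 0) (length ?w * (100 + 1) + 1) (R (length ?w))"
  proof (rule reach_While)
    fix k assume k: "k < length ?w"
    have R: "R k = sc (replicate n True @ take k ?w) (?w ! k # drop (Suc k) ?w)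
        (replicate (1 + 6 * n + 4 * k) True) (n + k)"
      unfolding R_def using k by (simp only: Cons_nth_drop_Suc)
    have "1 + 6 * n + 4 * k + 4 = 1 + 6 * n + 4 * Suc k" by simp
    then have y: "replicate (1 + 6 * n + 4 * k) True @ replicate 4 True =
        replicate (1 + 6 * n + 4 * Suc k) True"
      by (simp only: replicate_add[symmetric])
    have "reach (scan_unit 4) (R k) 100 (R (Suc k))"
      unfolding R unfolding R_def y[symmetric] take_Suc_conv_app_nth[OF k] add_Suc_right append_assoc[symmetric]
      by (rule reach_scan_unit) simp
    then show "rd (R k ! 0) \<in> nonblank \<and> reach (scan_unit 4) (R k) 100 (R (Suc k))"
      by (simp add: R)
  qed (simp add: R_def)
  moreover have "S n = R 0" by (simp add: S_def R_def)
  moreover have "1 + 6 * n + 4 * length ?w = 1 + 2 * n + 4 * length x" "n + length ?w = length x"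
    by (simp_all add: x)
  moreover have "enc_rat (2 ^ (4 * length x)) =
      (False # repeat4 (length x) [True, False]) @ [True, True, False, False, True, True, False]"
    by (simp add: enc_rat_power2 repeat4_def)
  ultimately have
    "reach (While 0 {Some True} (scan_unit 6)) (S 0) (101 * n + 1) (S n)"
    "reach (While 0 nonblank (scan_unit 4)) (S n) (101 * length ?w + 1)
      (sc x [] (replicate (1 + 2 * n + 4 * length x) True) (length x))"
    by (simp_all add: x R_def mult.commute)
  note loops = reach_seqs_Cons[OF this(1)] reach_seqs_Cons[OF this(2)]
  have Big: "enc_rat (2 ^ (4 * length x)) =
      (False # repeat4 (length x) [True, False]) @ [True, True, False, False, True, True, False]"
    by (simp add: enc_rat_power2 repeat4_def)
  have S0: "S 0 = [tp [] x, tp [True] [], tp [] [], tp [] [], tp [] [], tp [] [],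
     tp [False] [], tp [] []]" by (simp add: S_def x pad_def repeat4_simps One_nat_def)
  show ?thesis
    unfolding scan_input_def Big
    apply (rule reach_weaken)
      apply (rule exec3, simp, simp, simp add: numeral_eq_Suc)
      apply (rule exec3, simp, simp, simp, fold S0, rule loops, rule loops)
      apply ((rule exec3, simp, simp, simp)+, rule reach_seqs_Nil)
    by (simp_all add: enc_nat_0 x length_repeat4 pad_def enc_rat_0)
qed


text \<open>There are at most \<open>W\<close> entries at a cost linear in \<open>W\<close> each,
  which makes the bound quadratic.\<close>

lemma reach_write_row:
  assumes "length (enc_list enc_rat qs) \<le> W" "length pd \<le> W" "1 \<le> W"
  shows "reach write_row (st a (True # enc_list enc_rat qs @ b) y j bg pd) (100 * W * W)
    (st (a @ True # enc_list enc_rat qs) b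
      (y @ [True, True] @ enc_rat (- 1) @ enc_items enc_rat (concat (map (\<lambda>q. [q, 0]) qs)) @ pd @ [False]) j bg pd)"
proof -
  have len: "length (enc_rat (qs ! k)) \<le> W" if "k < length qs" for k
    using assms(1) length_enc_le[of "qs ! k" qs enc_rat] that by simp
  have n: "length qs \<le> W" using assms(1) length_le_enc_list[of qs enc_rat] by linarith
  define S where "S k = st (a @ [True] @ enc_items enc_rat (take k qs)) (enc_items enc_rat (drop k qs) @ False # b)
      (y @ [True, True] @ enc_rat (- 1) @ enc_items enc_rat (concat (map (\<lambda>q. [q, 0]) (take k qs)))) j bg pd" for k
  have "reach (While 0 {Some True} write_supply) (S 0) (length qs * (20 * W + 1) + 1) (S (length qs))"
  proof (rule reach_While)
    fix k assume k: "k < length qs"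
    have "reach write_supply (S k) (20 * W) (S (Suc k))"
      using reach_write_supply[OF len[OF k] assms(3), of "a @ True # enc_items enc_rat (take k qs)"
          "enc_items enc_rat (drop (Suc k) qs) @ False # b" "y @ True # True # enc_rat (- 1) @
          enc_items enc_rat (concat (map (\<lambda>q. [q, 0]) (take k qs)))"] k
      by (simp add: S_def enc_items_drop take_Suc_conv_app_nth)
    then show "rd (S k ! 0) \<in> {Some True} \<and> reach write_supply (S k) (20 * W) (S (Suc k))"
      using k by (simp add: S_def enc_items_drop)
  qed (simp add: S_def)
  note loop = reach_seqs_Cons[OF this]
  have S0: "S 0 = st (a @ [True]) (enc_list enc_rat qs @ b) (y @ [True, True] @ enc_rat (- 1)) j bg pd"
    by (simp add: S_def enc_list_items)
  have Sn: "S (length qs) = st (a @ True # enc_items enc_rat qs) (False # b)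
      (y @ [True, True] @ enc_rat (- 1) @ enc_items enc_rat (concat (map (\<lambda>q. [q, 0]) qs))) j bg pd"
    by (simp add: S_def)
  have "length qs * (20 * W + 1) \<le> W * (20 * W + 1)" using n by (rule mult_le_mono1)
  moreover have "W \<le> W * W" "1 \<le> W * W" using assms(3) mult_le_mono[of 1 W 1 W] by auto
  moreover have "W * (20 * W + 1) = 20 * (W * W) + W" by (simp add: algebra_simps)
  ultimately have time: "length qs * (20 * W + 1) + 50 * W \<le> 100 * W * W" by linarith
  show ?thesis
    unfolding write_row_def
    apply (rule reach_weaken)
      apply (rule exec2, simp, simp, rule exec3, simp, simp, simp)
      apply (rule loop[unfolded S0 Sn append_assoc append.simps])
      apply ((rule exec3, simp, simp, simp | rule exec6, simp, simp, simp, simp, simp, simp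
        | rule exec2, simp, simp)+, rule reach_seqs_Nil)
     apply (simp add: enc_list_items enc_rat_minus_1)
    apply (rule le_trans[OF _ time])
    using assms by (simp add: enc_rat_minus_1)
qed


section \<open>The whole reduction program\<close>

lemma enc_instance_items:
  "enc_instance I = replicate (n_verts I) True @ False # enc_items enc_cap_arc (cap_arcs I) @
     False # enc_items (enc_list enc_rat) (supplies I) @ [False]"
  by (simp add: enc_instance_def enc_list_items enc_items_units)

lemma enc_items_pad: "enc_items enc_rat (replicate (4 * k) 0) = pad k"
  by (simp add: enc_items_def pad_def repeat4_def)

lemma reach_reduction_prog:
  fixes I
  defines "x \<equiv> enc_instance I"
  defines "L \<equiv> length x"
  shows "\<exists>s. s ! 1 = tp (enc_instance (to_directed I)) [] \<and>
    reach reduction_prog (tp [] x # replicate 7 (tp [] [])) (1000000 * (L + 1) ^ 3) s"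
proof -
  \<comment> \<open>The factor \<open>28\<close> is the length of the four coded zeros, of seven
    symbols each with the marker, that every input symbol puts on the padding tape.\<close>
  define n as ss B W where "n = n_verts I" and "as = cap_arcs I" and "ss = supplies I"
    and "B = (2 ^ (4 * L) :: rat)" and "W = 28 * (L + 1)"
  let ?bg = "enc_rat B" and ?pd = "pad L"
  let ?ea = "enc_items enc_cap_arc" and ?es = "enc_items (enc_list enc_rat)"
  have x: "x = replicate n True @ False # ?ea as @ False # ?es ss @ [False]"
    unfolding x_def n_def as_def ss_def by (rule enc_instance_items)
  have lens: "n + length as \<le> L" "length ss \<le> L"
    using length_le_enc_list[of as enc_cap_arc] length_le_enc_list[of ss "enc_list enc_rat"]
    by (simp_all add: L_def x enc_list_items)
  have W: "1 \<le> W" "length ?bg \<le> W" "length ?pd \<le> W" "L \<le> W"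
    using enc_rat_power2[of "4 * L", folded repeat4_def]
    by (simp_all add: W_def B_def pad_def length_repeat4 enc_rat_0)
  have cnt: "length (enc_nat j) \<le> W" if "j \<le> L" for j
    using length_enc_nat_le[of j] that by (simp add: W_def)
  define y0 where "y0 = replicate (1 + 2 * n + 4 * L) True @ [False]"
  define va where "va v = vertex_arcs B v" for v
  define y1 where "y1 = y0 @ ?ea (concat (map va [0..<n]))"
  define ed where "ed t = edge_arcs (n + t) (as ! t)" for t
  define y2 where "y2 = y1 @ ?ea (concat (map ed [0..<length as]))"
  define y3 where "y3 = y2 @ False # ?es (map (spread_row (4 * L)) ss)"

  \<comment> \<open>\<open>S1\<close>, \<open>S2\<close> and \<open>S3\<close> are the tapes at the
    tests of the three main loops.\<close>
  define S1 where "S1 k = st (replicate k True) (replicate (n - k) True @ False # ?ea as @ False # ?es ss @ [False])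
      (y0 @ ?ea (concat (map va [0..<k]))) k ?bg ?pd" for k
  have 1: "reach (While 0 {Some True} write_vertex_arcs) (S1 0) (n * (100 * W + 1) + 1) (S1 n)"
  proof (rule reach_While)
    fix k assume k: "k < n"
    then have "reach write_vertex_arcs (S1 k) (100 * W) (S1 (Suc k))"
      using reach_write_vertex_arcs[OF cnt W(2,1), of k "replicate k True" True _
          "y0 @ ?ea (concat (map va [0..<k]))"] lens(1)
      unfolding S1_def replicate_diff[OF k] replicate_snoc[symmetric] by (simp add: va_def)
    then show "rd (S1 k ! 0) \<in> {Some True} \<and> reach write_vertex_arcs (S1 k) (100 * W) (S1 (Suc k))"
      using k by (simp add: S1_def replicate_diff)
  qed (simp add: S1_def)

  \<comment> \<open>The counter on tape 2 is not reset: after the \<open>n\<close> vertices it goes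
    on with \<open>n + t\<close>, the index of the gadget.\<close>
  define S2 where "S2 t = st (replicate n True @ False # ?ea (take t as)) (?ea (drop t as) @ False # ?es ss @ [False])
      (y1 @ ?ea (concat (map ed [0..<t]))) (n + t) ?bg ?pd" for t
  have 2: "reach (While 0 {Some True} write_edge_arcs) (S2 0) (length as * (300 * W + 1) + 1) (S2 (length as))"
  proof (rule reach_While)
    fix t assume t: "t < length as"
    obtain u v c where e: "as ! t = ((u, v), c)" by (metis surj_pair)
    have "length (enc_cap_arc (as ! t)) \<le> L"
      using t length_enc_le[of "as ! t" as enc_cap_arc] by (simp add: L_def x enc_list_items)
    then have "length (enc_cap_arc (as ! t)) \<le> W" using W(4) by linarith
    then have "reach write_edge_arcs (S2 t) (300 * W) (S2 (Suc t))"
      using reach_write_edge_arcs[OF e _ cnt W(1), of "n + t" "replicate n True @ False # ?ea (take t as)" _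
          "y1 @ ?ea (concat (map ed [0..<t]))"] lens(1) t
      unfolding S2_def by (simp add: ed_def enc_items_drop take_Suc_conv_app_nth)
    then show "rd (S2 t ! 0) \<in> {Some True} \<and> reach write_edge_arcs (S2 t) (300 * W) (S2 (Suc t))"
      using t by (simp add: S2_def enc_items_drop)
  qed (simp add: S2_def)

  define S3 where "S3 i = st (replicate n True @ False # ?ea as @ False # ?es (take i ss)) (?es (drop i ss) @ [False])
      (y2 @ False # ?es (map (spread_row (4 * L)) (take i ss))) (n + length as) ?bg ?pd" for i
  have 3: "reach (While 0 {Some True} write_row) (S3 0) (length ss * (100 * W * W + 1) + 1) (S3 (length ss))"
  proof (rule reach_While)
    fix i assume i: "i < length ss"
    have "length (enc_list enc_rat (ss ! i)) \<le> L"
      using i length_enc_le[of "ss ! i" ss "enc_list enc_rat"] by (simp add: L_def x enc_list_items)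
    then have "length (enc_list enc_rat (ss ! i)) \<le> W" using W(4) by linarith
    then have "reach write_row (S3 i) (100 * W * W) (S3 (Suc i))"
      using reach_write_row[OF _ W(3,1), of "ss ! i" "replicate n True @ False # ?ea as @ False # ?es (take i ss)" _
          "y2 @ False # ?es (map (spread_row (4 * L)) (take i ss))"] i
      unfolding S3_def
      by (simp add: enc_items_drop take_Suc_conv_app_nth spread_row_def enc_list_items enc_items_pad)
    then show "rd (S3 i ! 0) \<in> {Some True} \<and> reach write_row (S3 i) (100 * W * W) (S3 (Suc i))"
      using i by (simp add: S3_def enc_items_drop)
  qed (simp add: S3_def)

  have S1: "S1 0 = st [] x y0 0 ?bg ?pd"
    "S1 n = st (replicate n True) (False # ?ea as @ False # ?es ss @ [False]) y1 n ?bg ?pd"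
    by (simp_all add: S1_def x y1_def)
  have S2: "S2 0 = st (replicate n True @ [False]) (?ea as @ False # ?es ss @ [False]) y1 n ?bg ?pd"
    "S2 (length as) = st (replicate n True @ False # ?ea as) (False # ?es ss @ [False])
      y2 (n + length as) ?bg ?pd"
    by (simp_all add: S2_def y2_def)
  have S3: "S3 0 = st (replicate n True @ False # ?ea as @ [False]) (?es ss @ [False])
      (y2 @ [False]) (n + length as) ?bg ?pd"
    "S3 (length ss) = st (replicate n True @ False # ?ea as @ False # ?es ss) [False]
      y3 (n + length as) ?bg ?pd"
    by (simp_all add: S3_def y3_def)
  have scan: "reach scan_input (tp [] x # replicate 7 (tp [] [])) (1000 * (L + 1)) (S1 0)"
    using reach_scan_input[OF x] unfolding S1 y0_def L_def[symmetric] B_def[symmetric] .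
  \<comment> \<open>The rows dominate, with at most \<open>L\<close> of them at a cost quadratic in
    \<open>L\<close>; hence the cubic time.\<close>
  have "n * (100 * W + 1) \<le> L * (100 * W + 1)" "length as * (300 * W + 1) \<le> L * (300 * W + 1)"
    "length ss * (100 * W * W + 1) \<le> L * (100 * W * W + 1)"
    using lens by (intro mult_le_mono1; linarith)+
  then have time: "1000 * (L + 1) + (n * (100 * W + 1) + 1 + (length as * (300 * W + 1) + 1 +
      (length ss * (100 * W * W + 1) + 1 + 20))) \<le> 1000000 * (L + 1) ^ 3"
    by (simp add: W_def power3_eq_cube algebra_simps)
  have out: "enc_instance (to_directed I) = y3 @ [False]"
  proof -
    have "slack I = 4 * L" by (simp add: slack_def L_def x_def)
    then show ?thesis
      unfolding enc_instance_items[of "to_directed I"]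
      by (simp add: to_directed_def y3_def y2_def y1_def y0_def va_def[abs_def] ed_def[abs_def]
          flip: n_def as_def ss_def B_def)
  qed
  let ?s = "st (replicate n True @ False # ?ea as @ False # ?es ss) [False]
      (y3 @ [False]) (n + length as) ?bg ?pd"
  have "reach reduction_prog (tp [] x # replicate 7 (tp [] [])) (1000000 * (L + 1) ^ 3)
    (st (replicate n True @ False # ?ea as @ False # ?es ss) [False]
      (y3 @ [False]) (n + length as) ?bg ?pd)"
    unfolding reduction_prog_def
    apply (rule reach_weaken)
      apply (rule reach_seqs_Cons[OF scan], rule reach_seqs_Cons[OF 1[unfolded S1(2)]])
      apply (rule exec2, simp, simp, rule reach_seqs_Cons[OF 2[unfolded S2]])
      apply (rule exec2, simp, simp, rule exec3, simp, simp, simp)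
      apply (rule reach_seqs_Cons[OF 3[unfolded S3 append_assoc append.simps]])
      apply ((rule exec3, simp, simp, simp)+, rule reach_seqs_Nil)
    using time by simp_all
  moreover have "?s ! 1 = tp (enc_instance (to_directed I)) []" by (simp add: out)
  ultimately show ?thesis by blast
qed

lemma tapes_below_reduction_prog: "tapes_below 8 reduction_prog"
  by (simp add: reduction_prog_def scan_input_def scan_unit_def write_vertex_arcs_def write_edge_arcs_def
      write_row_def write_supply_def tapes_below_seqs right_def copy_def rewind_def emit_def copy_bits_def
      copy_rat_def inc_def clear_def)

lemma polytime_to_directed: "polytime_computable D enc_instance enc_instance to_directed"
proof -
  have "computes_within (machine_of 8 reduction_prog) (enc_instance I)
      (poly (smult 1000000 ([:1, 1:] ^ 3)) (length (enc_instance I))) (enc_instance (to_directed I))" for I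
  proof -
    obtain s where s: "s ! 1 = tp (enc_instance (to_directed I)) []"
      "reach reduction_prog (tp [] (enc_instance I) # replicate (8 - 1) (tp [] []))
        (1000000 * (length (enc_instance I) + 1) ^ 3) s"
      using reach_reduction_prog[of I] by auto
    show ?thesis
      by (rule computes_within_machine_of[OF s(2) tapes_below_reduction_prog _ s(1)]) simp_all
  qed
  then show ?thesis
    unfolding polytime_computable_def
    by (intro exI[of _ "machine_of 8 reduction_prog"] exI[of _ "smult 1000000 ([:1, 1:] ^ 3)"])
      (simp add: turing_machine_machine_of)
qed


section \<open>Translating placements back\<close>

text \<open>The default \<open>0\<close> is a vertex, because an instance has at least one. Any
  vertex would serve for a sink outside the copies, as only zero demands are met at a positive value
  then.\<close>

definition sink_origin :: "nat \<Rightarrow> nat \<Rightarrow> nat" where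
  "sink_origin n w = (if w mod 4 = 2 \<and> w div 4 < n then w div 4 else 0)"

definition from_directed :: "flow_instance \<Rightarrow> nat list \<Rightarrow> nat list" where
  "from_directed I = map (sink_origin (n_verts I))"

text \<open>
  Comparison of binary numbers from the least significant bit on, where \<open>f\<close> is the result so far. The
  bits need not be of equal number.
\<close>

fun below :: "bool \<Rightarrow> bool list \<Rightarrow> bool list \<Rightarrow> bool" where
  "below f [] [] = f"
| "below f [] (e # es) = below (e \<or> f) [] es"
| "below f (d # ds) [] = below (f \<and> \<not> d) ds []"
| "below f (d # ds) (e # es) = below (if d = e then f else e) ds es"

fun bits_val :: "bool list \<Rightarrow> nat" where
  "bits_val [] = 0"
| "bits_val (d # ds) = of_bool d + 2 * bits_val ds"

text \<open>Digits arrive from the least significant one, so a later difference overrides the result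
  so far, and \<open>f\<close> survives only while the digits agree.\<close>

lemma below_iff: "below f ds es \<longleftrightarrow> bits_val ds < bits_val es \<or> bits_val ds = bits_val es \<and> f"
proof (induction f ds es rule: below.induct)
  case (4 f d ds e es)
  then show ?case by (cases d; cases e; simp) arith+
qed auto

lemma bits_val_binary_digits: "bits_val (binary_digits n) = n"
proof (induction n rule: less_induct)
  case (less n)
  then show ?case by (cases "n = 0") (auto simp: binary_digits.simps[of n] binary_digits.simps[of 0] elim: oddE)
qed

text \<open>
  Tape 2 holds the code of \<open>n\<close>, tape 3 the candidate \<open>v\<close>, tape 4 the flag for \<open>v < n\<close>, and tape 5 takes
  whatever has to be skipped.
\<close>

definition set_flag :: "bool \<Rightarrow> prog" where
  "set_flag b = Op 4 4 (\<lambda>_ _. Some b) Stay"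

definition compare_digit :: prog where
  "compare_digit = If 0 {Some True} (If 2 {Some False} (set_flag False) Nop)
     (If 2 {Some True} (set_flag True) Nop)"

definition compare_last :: prog where
  "compare_last = If 0 {Some True} (set_flag False) Nop"

abbreviation sb where
  "sb a b y p q v f \<equiv> [tp a b, tp y [], tp p q, tp v [], tp [] f, tp [] []]"

lemma reach_set_flag: "reach (set_flag c) (sb a b y p q v [f]) 1 (sb a b y p q v [c])"
  unfolding set_flag_def by (rule reach_Op) (simp_all add: tp_write)

lemma reach_compare_digit:
  "reach compare_digit (sb a (d # b) y p (e # q) v [f]) 3
    (sb a (d # b) y p (e # q) v [if d = e then f else e])"
proof -
  have "reach compare_digit (sb a (d # b) y p (e # q) v [f]) (1 + (1 + 1))
    (sb a (d # b) y p (e # q) v [if d = e then f else e])"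
    unfolding compare_digit_def
    using reach_set_flag[of _ a "d # b" y p "e # q" v f] reach_Nop[of "sb a (d # b) y p (e # q) v [f]"]
    by (cases d; cases e) (rule reach_If; rule reach_If; simp)+
  then show ?thesis by simp
qed

lemma reach_compare_last:
  "reach compare_last (sb a (d # b) y p q v [f]) 2 (sb a (d # b) y p q v [f \<and> \<not> d])"
proof -
  have "reach compare_last (sb a (d # b) y p q v [f]) (1 + 1) (sb a (d # b) y p q v [f \<and> \<not> d])"
    unfolding compare_last_def
    using reach_set_flag[of _ a "d # b" y p q v f] reach_Nop[of "sb a (d # b) y p q v [f]"]
    by (cases d) (rule reach_If; simp)+
  then show ?thesis by simp
qed

text \<open>If tape 2 stands on its closing \<open>False\<close>, the digits of \<open>n\<close> are
  used up, and a nonzero digit of the candidate refutes \<open>v < n\<close>. Tape 3 collects the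
  candidate for the output.\<close>

definition compare_step :: prog where
  "compare_step = seqs [copy 0 3, If 2 {Some True} (seqs [right 2, compare_digit, right 2]) compare_last,
     copy 0 3]"

definition compare_rest :: prog where
  "compare_rest = seqs [right 2, If 2 {Some True} (set_flag True) Nop, right 2]"

lemma reach_compare_step_Cons:
  "reach compare_step (sb a (True # d # b) y p (True # e # q) v [f]) 20
    (sb (a @ [True, d]) b y (p @ [True, e]) q (v @ [True, d]) [if d = e then f else e])"
proof -
  have "reach (seqs [right 2, compare_digit, right 2]) (sb (a @ [True]) (d # b) y p (True # e # q) (v @ [True]) [f]) 10
    (sb (a @ [True]) (d # b) y (p @ [True, e]) q (v @ [True]) [if d = e then f else e])"
    apply (rule reach_weaken)
      apply (rule exec2, simp, simp, rule reach_seqs_Cons, rule reach_compare_digit, rule exec2, simp, simp, rule reach_seqs_Nil)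
    by simp_all
  then have 1: "reach (If 2 {Some True} (seqs [right 2, compare_digit, right 2]) compare_last)
     (sb (a @ [True]) (d # b) y p (True # e # q) (v @ [True]) [f]) (1 + 10)
    (sb (a @ [True]) (d # b) y (p @ [True, e]) q (v @ [True]) [if d = e then f else e])"
    by (intro reach_If) simp_all
  show ?thesis unfolding compare_step_def
    apply (rule reach_weaken)
      apply (rule reach_seqs_Cons[OF reach_copy], simp, simp, simp, simp, rule reach_seqs_Cons[OF 1])
      apply (rule reach_seqs_Cons[OF reach_copy], simp, simp, simp, simp, rule reach_seqs_Nil)
    by simp_all
qed

lemma reach_compare_step_Nil:
  "reach compare_step (sb a (True # d # b) y p (False # q) v [f]) 20
    (sb (a @ [True, d]) b y p (False # q) (v @ [True, d]) [f \<and> \<not> d])"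
proof -
  have 1: "reach (If 2 {Some True} (seqs [right 2, compare_digit, right 2]) compare_last)
     (sb (a @ [True]) (d # b) y p (False # q) (v @ [True]) [f]) (1 + 2)
    (sb (a @ [True]) (d # b) y p (False # q) (v @ [True]) [f \<and> \<not> d])"
    using reach_compare_last by (intro reach_If) simp_all
  show ?thesis unfolding compare_step_def
    apply (rule reach_weaken)
      apply (rule reach_seqs_Cons[OF reach_copy], simp, simp, simp, simp, rule reach_seqs_Cons[OF 1])
      apply (rule reach_seqs_Cons[OF reach_copy], simp, simp, simp, simp, rule reach_seqs_Nil)
    by simp_all
qed

lemma reach_compare_rest:
  "reach compare_rest (sb a b y p (True # e # q) v [f]) 10 (sb a b y (p @ [True, e]) q v [e \<or> f])"
proof -
  have 1: "reach (If 2 {Some True} (set_flag True) Nop) (sb a b y (p @ [True]) (e # q) v [f]) (1 + 1)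
    (sb a b y (p @ [True]) (e # q) v [e \<or> f])"
    using reach_set_flag[of True a b y "p @ [True]" "e # q" v f]
      reach_Nop[of "sb a b y (p @ [True]) (e # q) v [f]"] by (cases e) (intro reach_If; simp)+
  show ?thesis unfolding compare_rest_def
    apply (rule reach_weaken)
      apply (rule exec2, simp, simp, rule reach_seqs_Cons[OF 1], rule exec2, simp, simp, rule reach_seqs_Nil)
    by simp_all
qed

text \<open>\<open>es'\<close> are the digits of \<open>n\<close> for which the candidate has none
  left; they remain to be compared with zeros.\<close>

lemma reach_compare_loop:
  "\<exists>a' v' p' es' f'. reach (While 0 {Some True} compare_step)
      (sb a (enc_bits ds @ b) y p (enc_bits es) v [f]) (21 * length ds + 1)
      (sb a' (False # b) y p' (enc_bits es') v' [f']) \<and>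
    a' @ [False] = a @ enc_bits ds \<and> v' @ [False] = v @ enc_bits ds \<and>
    p' @ enc_bits es' = p @ enc_bits es \<and> below f' [] es' = below f ds es"
proof (induction ds arbitrary: a p es v f)
  case Nil
  have "reach (While 0 {Some True} compare_step) (sb a (enc_bits [] @ b) y p (enc_bits es) v [f])
      (21 * length [] + 1) (sb a (False # b) y p (enc_bits es) v [f])"
    by (simp add: reach_While_False)
  then show ?case by (intro exI conjI, assumption) simp_all
next
  case (Cons d ds)
  define p1 es1 f1 where "p1 = (if es = [] then p else p @ [True, hd es])" and "es1 = tl es"
    and "f1 = (if es = [] then f \<and> \<not> d else if d = hd es then f else hd es)"
  have step: "reach compare_step (sb a (enc_bits (d # ds) @ b) y p (enc_bits es) v [f]) 20
      (sb (a @ [True, d]) (enc_bits ds @ b) y p1 (enc_bits es1) (v @ [True, d]) [f1])"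
    using reach_compare_step_Cons[of a d "enc_bits ds @ b" y p "hd es" "enc_bits (tl es)" v f]
      reach_compare_step_Nil[of a d "enc_bits ds @ b" y p "[]" v f]
    by (cases es) (simp_all add: p1_def es1_def f1_def)
  have eqs: "p1 @ enc_bits es1 = p @ enc_bits es" "below f1 ds es1 = below f (d # ds) es"
    by (cases es; simp add: p1_def es1_def f1_def)+
  obtain a' v' p' es' f' where IH: "reach (While 0 {Some True} compare_step)
      (sb (a @ [True, d]) (enc_bits ds @ b) y p1 (enc_bits es1) (v @ [True, d]) [f1]) (21 * length ds + 1)
      (sb a' (False # b) y p' (enc_bits es') v' [f'])"
    "a' @ [False] = (a @ [True, d]) @ enc_bits ds" "v' @ [False] = (v @ [True, d]) @ enc_bits ds"
    "p' @ enc_bits es' = p1 @ enc_bits es1" "below f' [] es' = below f1 ds es1"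
    using Cons.IH[of "a @ [True, d]" p1 es1 "v @ [True, d]" f1] by blast
  have "reach (While 0 {Some True} compare_step) (sb a (enc_bits (d # ds) @ b) y p (enc_bits es) v [f])
      (21 * length (d # ds) + 1) (sb a' (False # b) y p' (enc_bits es') v' [f'])"
    by (rule reach_mono[OF reach_While_True[OF _ step IH(1)]]) simp_all
  moreover have "a' @ [False] = a @ enc_bits (d # ds)" "v' @ [False] = v @ enc_bits (d # ds)"
    "p' @ enc_bits es' = p @ enc_bits es" "below f' [] es' = below f (d # ds) es"
    using IH(2-5) eqs by simp_all
  ultimately show ?case by blast
qed

lemma reach_compare_rest_loop:
  "\<exists>p'. reach (While 2 {Some True} compare_rest) (sb a b y p (enc_bits es) v [f]) (11 * length es + 1)
      (sb a b y p' [False] v [below f [] es]) \<and> p' @ [False] = p @ enc_bits es"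
proof (induction es arbitrary: p f)
  case Nil
  have "reach (While 2 {Some True} compare_rest) (sb a b y p (enc_bits []) v [f]) (11 * length [] + 1)
      (sb a b y p [False] v [below f [] []])"
    by (simp add: reach_While_False)
  then show ?case by (intro exI conjI, assumption) simp_all
next
  case (Cons e es)
  obtain p' where IH: "reach (While 2 {Some True} compare_rest) (sb a b y (p @ [True, e]) (enc_bits es) v [e \<or> f])
      (11 * length es + 1) (sb a b y p' [False] v [below (e \<or> f) [] es])" "p' @ [False] = (p @ [True, e]) @ enc_bits es"
    using Cons.IH[of "p @ [True, e]" "e \<or> f"] by blast
  have step: "reach compare_rest (sb a b y p (enc_bits (e # es)) v [f]) 10
      (sb a b y (p @ [True, e]) (enc_bits es) v [e \<or> f])"
    using reach_compare_rest by simp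
  have "reach (While 2 {Some True} compare_rest) (sb a b y p (enc_bits (e # es)) v [f]) (11 * length (e # es) + 1)
      (sb a b y p' [False] v [below f [] (e # es)])"
    by (rule reach_mono[OF reach_While_True[OF _ step]], simp, use IH in simp, simp)
  moreover have "p' @ [False] = p @ enc_bits (e # es)" using IH(2) by simp
  ultimately show ?case by blast
qed

text \<open>Starting with the flag \<open>False\<close> makes the comparison strict. The input is
  passed once: the candidate is written only after the decision, from its copy on tape 3.\<close>

definition decode_sink :: prog where
  "decode_sink = seqs [put 4 [False], rewind 4, While 0 {Some True} compare_step, copy 0 3,
     While 2 {Some True} compare_rest, rewind 2, rewind 3,
     If 4 {Some True} (emit 3) (put 1 [False]), clear 3, clear 4]"

lemma reach_decode_sink:
  assumes "length (enc_nat v) \<le> W" "length (enc_nat n) \<le> W" "1 \<le> W"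
  shows "reach decode_sink (sb a (enc_nat v @ b) y [] (enc_nat n) [] []) (200 * W)
    (sb (a @ enc_nat v) b (y @ enc_nat (if v < n then v else 0)) [] (enc_nat n) [] [])"
proof -
  define ds es where "ds = binary_digits v" and "es = binary_digits n"
  have e: "enc_nat v = enc_bits ds" "enc_nat n = enc_bits es" by (simp_all add: enc_nat_def ds_def es_def)
  obtain a' v' p' es' f' where 1: "reach (While 0 {Some True} compare_step)
      (sb a (enc_bits ds @ b) y [] (enc_bits es) [] [False]) (21 * length ds + 1)
      (sb a' (False # b) y p' (enc_bits es') v' [f'])"
    and eqs: "a' @ [False] = a @ enc_bits ds" "v' @ [False] = enc_bits ds"
    "p' @ enc_bits es' = enc_bits es" "below f' [] es' = below False ds es"
    using reach_compare_loop[of a ds b y "[]" es "[]" False] by auto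
  obtain p'' where 2: "reach (While 2 {Some True} compare_rest)
      (sb (a @ enc_bits ds) b y p' (enc_bits es') (enc_bits ds) [f']) (11 * length es' + 1)
      (sb (a @ enc_bits ds) b y p'' [False] (enc_bits ds) [below f' [] es'])" "p'' @ [False] = p' @ enc_bits es'"
    using reach_compare_rest_loop by blast
  have below: "below f' [] es' \<longleftrightarrow> v < n"
    using eqs(4) below_iff[of False ds es] by (simp add: ds_def es_def bits_val_binary_digits)
  let ?s = "[tp (a @ enc_bits ds) b, tp y [], tp [] (enc_bits es), tp [] (enc_bits ds), tp [] [v < n], tp [] []]"
  have "reach (If 4 {Some True} (emit 3) (put 1 [False])) ?s (1 + (5 * length (enc_bits ds) + 4))
      (?s[1 := tp (y @ enc_nat (if v < n then v else 0)) []])"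
  proof (rule reach_If)
    assume "rd (?s ! 4) \<in> {Some True}"
    then show "reach (emit 3) ?s (5 * length (enc_bits ds) + 4)
        (?s[1 := tp (y @ enc_nat (if v < n then v else 0)) []])"
      by (intro reach_emit[where w = "enc_bits ds"]) (simp_all add: e)
  next
    assume "rd (?s ! 4) \<notin> {Some True}"
    then show "reach (put 1 [False]) ?s (5 * length (enc_bits ds) + 4)
        (?s[1 := tp (y @ enc_nat (if v < n then v else 0)) []])"
      by (intro reach_mono[OF reach_put]) (simp_all add: enc_nat_0)
  qed
  note 3 = reach_seqs_Cons[OF this]
  have len: "length es' \<le> W" "length ds \<le> W" "length (enc_bits ds) \<le> W" "length p'' \<le> W"
    using assms arg_cong[OF eqs(3), of length] arg_cong[OF 2(2), of length] unfolding e
    by (simp_all add: length_enc_bits)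
  have p: "p'' @ [False] = enc_bits es" using 2 eqs by simp
  show ?thesis
    unfolding decode_sink_def e
    apply (rule reach_weaken)
      apply (rule exec3, simp, simp, simp)
      apply (rule exec3, simp, simp, simp)
      apply (rule reach_seqs_Cons[OF 1])
      apply (rule reach_seqs_Cons[OF reach_copy], simp, simp, simp, simp)
      apply (simp only: eqs, rule reach_seqs_Cons[OF 2(1)])
      apply (rule exec3, simp, simp, simp)
      apply (rule exec3, simp, simp, simp)
      apply (simp only: below p, rule 3)
      apply ((rule exec3, simp, simp, simp)+, rule reach_seqs_Nil)
     apply simp
    using len assms(3) by simp
qed


section \<open>Decoding one sink\<close>

definition skip_bits :: prog where
  "skip_bits = seqs [copy_bits 0 5, clear 5]"

definition skip_rat :: prog where
  "skip_rat = seqs [copy_rat 0 5, clear 5]"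

lemma reach_skip_bits:
  "length (enc_bits ds) \<le> W \<Longrightarrow> 1 \<le> W \<Longrightarrow>
    reach skip_bits (sb a (enc_bits ds @ b) y p q v f) (20 * W) (sb (a @ enc_bits ds) b y p q v f)"
  unfolding skip_bits_def
  apply (rule reach_weaken)
    apply (rule reach_seqs_Cons[OF reach_copy_bits], simp, simp, simp, simp, simp, simp)
    apply (rule exec3, simp, simp, simp, rule reach_seqs_Nil)
  by simp_all

lemma reach_skip_rat:
  "length (enc_rat c) \<le> W \<Longrightarrow> 1 \<le> W \<Longrightarrow>
    reach skip_rat (sb a (enc_rat c @ b) y p q v f) (20 * W) (sb (a @ enc_rat c) b y p q v f)"
  unfolding skip_rat_def
  apply (rule reach_weaken)
    apply (rule exec6, simp, simp, simp, simp, simp, simp, rule exec3, simp, simp, simp, rule reach_seqs_Nil)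
  by simp_all

text \<open>With the least significant digit in front, \<open>4 * v + 2\<close> shows as the digits
  \<open>False\<close>, \<open>True\<close> followed by the code of \<open>v\<close>. The first test
  sorts out \<open>0\<close>, which has no digits; after a first digit \<open>False\<close> there is
  always another one, since the code has no leading zeros, so the marker in between is passed
  without a test.\<close>

definition decode :: prog where
  "decode = seqs [right 0, put 1 [True], If 0 {Some True}
     (seqs [right 0, If 0 {Some True} (seqs [right 0, skip_bits, put 1 [False]])
       (seqs [right 0, right 0, If 0 {Some True} (seqs [right 0, decode_sink])
          (seqs [right 0, skip_bits, put 1 [False]])])])
     (seqs [right 0, put 1 [False]])]"

lemma enc_nat_pos: "0 < w \<Longrightarrow> enc_nat w = True # odd w # enc_nat (w div 2)"
  by (simp add: enc_nat_def binary_digits.simps[of w])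

lemma reach_decode:
  assumes W: "length (enc_nat w) \<le> W" "length (enc_nat n) \<le> W" "1 \<le> W"
  shows "reach decode (sb a (True # enc_nat w @ b) y [] (enc_nat n) [] []) (300 * W)
    (sb (a @ True # enc_nat w) b (y @ True # enc_nat (sink_origin n w)) [] (enc_nat n) [] [])"
proof -
  have skip: "reach (seqs [right 0, skip_bits, put 1 [False]]) (sb a (x # enc_nat m @ b) y p q [] [])
      (30 * W) (sb (a @ x # enc_nat m) b (y @ enc_nat 0) p q [] [])"
    if "length (enc_nat m) \<le> W" for a x m b y p q
    unfolding enc_nat_def[of m]
    apply (rule reach_weaken)
      apply (rule exec2, simp, simp, rule reach_seqs_Cons, rule reach_skip_bits)
        apply (rule that[unfolded enc_nat_def], rule W(3), rule exec3, simp, simp, simp, rule reach_seqs_Nil)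
    using W by (simp_all add: enc_nat_0)
  let ?if3 = "If 0 {Some True} (seqs [right 0, decode_sink]) (seqs [right 0, skip_bits, put 1 [False]])"
  have if3: "reach ?if3 (sb a (x # enc_nat m @ b) y [] (enc_nat n) [] []) (1 + 230 * W)
      (sb (a @ x # enc_nat m) b (y @ enc_nat (if x \<and> m < n then m else 0)) [] (enc_nat n) [] [])"
    if m: "length (enc_nat m) \<le> W" for a x m b y
  proof (cases x)
    case True
    have "reach (seqs [right 0, decode_sink]) (sb a (True # enc_nat m @ b) y [] (enc_nat n) [] []) (230 * W)
      (sb (a @ True # enc_nat m) b (y @ enc_nat (if m < n then m else 0)) [] (enc_nat n) [] [])"
      apply (rule reach_weaken)
        apply (rule exec2, simp, simp, rule reach_seqs_Cons, rule reach_decode_sink[OF m W(2,3)], rule reach_seqs_Nil)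
      using W by simp_all
    then show ?thesis using True by (intro reach_If) simp_all
  next
    case False
    have "reach (seqs [right 0, skip_bits, put 1 [False]])
        (sb a (False # enc_nat m @ b) y [] (enc_nat n) [] []) (230 * W)
        (sb (a @ False # enc_nat m) b (y @ enc_nat 0) [] (enc_nat n) [] [])"
      by (rule reach_mono[OF skip[OF m]]) simp
    then show ?thesis using False by (intro reach_If) simp_all
  qed
  let ?if2 = "If 0 {Some True} (seqs [right 0, skip_bits, put 1 [False]]) (seqs [right 0, right 0, ?if3])"
  let ?if1 = "If 0 {Some True} (seqs [right 0, ?if2]) (seqs [right 0, put 1 [False]])"
  have if1: "reach ?if1 (sb a (enc_nat w @ b) y [] (enc_nat n) [] []) (1 + 250 * W)
      (sb (a @ enc_nat w) b (y @ enc_nat (sink_origin n w)) [] (enc_nat n) [] [])" for a b y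
  proof (cases "w = 0")
    case True
    have "reach (seqs [right 0, put 1 [False]]) (sb a (False # b) y [] (enc_nat n) [] []) (250 * W)
      (sb (a @ [False]) b (y @ [False]) [] (enc_nat n) [] [])"
      apply (rule reach_weaken)
        apply (rule exec2, simp, simp, rule exec3, simp, simp, simp, rule reach_seqs_Nil)
      using W(3) by simp_all
    then show ?thesis using True by (intro reach_If) (simp_all add: enc_nat_0 sink_origin_def)
  next
    case False
    define m where "m = w div 2"
    have w: "enc_nat w = True # odd w # enc_nat m" using False by (simp add: enc_nat_pos m_def)
    have "reach ?if2 (sb (a @ [True]) (odd w # enc_nat m @ b) y [] (enc_nat n) [] []) (1 + 240 * W)
      (sb (a @ [True] @ odd w # enc_nat m) b (y @ enc_nat (sink_origin n w)) [] (enc_nat n) [] [])"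
    proof (cases "odd w")
      case True
      then have "w mod 4 \<noteq> 2" by presburger
      then have "sink_origin n w = 0" by (simp add: sink_origin_def)
      moreover have "reach (seqs [right 0, skip_bits, put 1 [False]])
          (sb (a @ [True]) (True # enc_nat m @ b) y [] (enc_nat n) [] []) (240 * W)
          (sb (a @ [True] @ True # enc_nat m) b (y @ enc_nat 0) [] (enc_nat n) [] [])"
        using reach_mono[OF skip[of m "a @ [True]" True b y], of "240 * W"] W(1) by (simp add: w)
      ultimately show ?thesis using True by (intro reach_If) simp_all
    next
      case even: False
      define k where "k = m div 2"
      have "0 < m" using False even by (auto simp: m_def elim: evenE)
      then have m: "enc_nat m = True # odd m # enc_nat k" by (simp add: enc_nat_pos k_def)
      have "w mod 4 = 2 \<longleftrightarrow> odd m" "w div 4 = k" using even unfolding m_def k_def by presburger+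
      then have sink: "sink_origin n w = (if odd m \<and> k < n then k else 0)" by (simp add: sink_origin_def)
      have len: "length (enc_nat k) \<le> W" using W(1) by (simp add: w m)
      have "reach (seqs [right 0, right 0, ?if3])
          (sb (a @ [True]) (False # enc_nat m @ b) y [] (enc_nat n) [] []) (240 * W)
          (sb (a @ [True] @ False # enc_nat m) b (y @ enc_nat (sink_origin n w)) [] (enc_nat n) [] [])"
        unfolding m sink
        apply (rule reach_weaken)
          apply (rule exec2, simp, simp, rule exec2, simp, simp)
          apply (rule reach_seqs_Cons, rule if3[OF len], rule reach_seqs_Nil)
        using W(3) by simp_all
      then show ?thesis using even by (intro reach_If) simp_all
    qed
    note if2 = reach_seqs_Cons[OF this]
    have "reach (seqs [right 0, ?if2]) (sb a (enc_nat w @ b) y [] (enc_nat n) [] []) (250 * W)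
      (sb (a @ enc_nat w) b (y @ enc_nat (sink_origin n w)) [] (enc_nat n) [] [])"
      unfolding w
      apply (rule reach_weaken)
        apply (rule exec2, simp, simp)
        apply (rule if2, rule reach_seqs_Nil)
      using W(3) by simp_all
    then show ?thesis by (intro reach_If) (simp_all add: w)
  qed
  note if1' = reach_seqs_Cons[OF if1]
  show ?thesis unfolding decode_def
    apply (rule reach_weaken)
      apply (rule exec2, simp, simp, rule exec3, simp, simp, simp, rule if1', rule reach_seqs_Nil)
    using W(3) by simp_all
qed

section \<open>The whole back translation\<close>

definition read_vertices :: prog where
  "read_vertices = seqs [put 2 [False], rewind 2, While 0 {Some True} (seqs [inc 2, right 0]), right 0]"

definition skip_arc :: prog where
  "skip_arc = seqs [right 0, skip_bits, skip_bits, skip_rat]"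

definition skip_row :: prog where
  "skip_row = seqs [right 0, While 0 {Some True} (seqs [right 0, skip_rat]), right 0]"

definition back_prog :: prog where
  "back_prog = seqs [read_vertices, While 0 {Some True} skip_arc, right 0,
     While 0 {Some True} skip_row, right 0, While 0 {Some True} decode, put 1 [False]]"


lemma reach_read_vertices:
  fixes n :: nat and w :: "bool list"
  defines "W \<equiv> 2 * n + 1"
  shows "reach read_vertices (tp [] (replicate n True @ False # w) # replicate 5 (tp [] [])) (100 * W * W)
    (sb (replicate n True @ [False]) w [] [] (enc_nat n) [] [])"
proof -
  define S where "S k = sb (replicate k True) (replicate (n - k) True @ False # w) [] [] (enc_nat k) [] []" for k
  have "reach (While 0 {Some True} (seqs [inc 2, right 0])) (S 0) (n * (40 * W + 1) + 1) (S n)"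
  proof (rule reach_While)
    fix k assume k: "k < n"
    have len: "length (enc_nat k) \<le> W" using length_enc_nat_le[of k] k by (simp add: W_def)
    have "reach (seqs [inc 2, right 0]) (S k) (40 * W) (S (Suc k))"
      unfolding S_def replicate_diff[OF k] replicate_snoc[symmetric]
      apply (rule reach_weaken)
        apply (rule exec3, simp, simp, simp, rule exec2, simp, simp, rule reach_seqs_Nil)
      using len by (simp_all add: W_def)
    then show "rd (S k ! 0) \<in> {Some True} \<and> reach (seqs [inc 2, right 0]) (S k) (40 * W) (S (Suc k))"
      using k by (simp add: S_def replicate_diff)
  qed (simp add: S_def)
  note loop = reach_seqs_Cons[OF this]
  have S0: "[tp [] (replicate n True @ False # w), tp [] [], tp [] [False], tp [] [], tp [] [], tp [] []] = S 0"
    by (simp add: S_def enc_nat_0)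
  have Sn: "S n = sb (replicate n True) (False # w) [] [] (enc_nat n) [] []"
    by (simp add: S_def)
  have time: "n * (40 * W + 1) + 50 \<le> 100 * W * W"
    by (simp add: W_def algebra_simps)
  show ?thesis unfolding read_vertices_def
    apply (rule reach_weaken)
      apply (rule exec3, simp, simp, simp add: numeral_eq_Suc)
      apply (rule exec3, simp, simp, simp)
      apply (unfold S0, rule loop[unfolded Sn], rule exec2, simp, simp, rule reach_seqs_Nil)
     apply simp
    apply (rule le_trans[OF _ time])
    by simp
qed

lemma reach_skip_arc:
  assumes "length (enc_cap_arc e) \<le> W" "1 \<le> W"
  shows "reach skip_arc (sb a (True # enc_cap_arc e @ b) y p q v f) (100 * W)
    (sb (a @ True # enc_cap_arc e) b y p q v f)"
proof -
  obtain i j c where e: "e = ((i, j), c)" by (metis surj_pair)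
  have l: "length (enc_bits (binary_digits i)) \<le> W" "length (enc_bits (binary_digits j)) \<le> W"
    "length (enc_rat c) \<le> W" using assms(1) by (simp_all add: e enc_cap_arc_def enc_nat_def)
  show ?thesis unfolding skip_arc_def e enc_cap_arc_def prod.case append_assoc enc_nat_def
    apply (rule reach_weaken)
      apply (rule exec2, simp, simp)
      apply (rule reach_seqs_Cons, rule reach_skip_bits[OF l(1) assms(2)])
      apply (rule reach_seqs_Cons, rule reach_skip_bits[OF l(2) assms(2)])
      apply (rule reach_seqs_Cons, rule reach_skip_rat[OF l(3) assms(2)], rule reach_seqs_Nil)
    using assms(2) by simp_all
qed

lemma reach_skip_row:
  assumes "length (enc_list enc_rat qs) \<le> W" "1 \<le> W"
  shows "reach skip_row (sb a (True # enc_list enc_rat qs @ b) y p q v f) (100 * W * W)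
    (sb (a @ True # enc_list enc_rat qs) b y p q v f)"
proof -
  have len: "length (enc_rat (qs ! k)) \<le> W" if "k < length qs" for k
    using assms(1) length_enc_le[of "qs ! k" qs enc_rat] that by simp
  have n: "length qs \<le> W" using assms(1) length_le_enc_list[of qs enc_rat] by linarith
  define S where "S k = sb (a @ True # enc_items enc_rat (take k qs)) (enc_items enc_rat (drop k qs) @ False # b) y p q v f" for k
  have "reach (While 0 {Some True} (seqs [right 0, skip_rat])) (S 0) (length qs * (30 * W + 1) + 1) (S (length qs))"
  proof (rule reach_While)
    fix k assume k: "k < length qs"
    have "reach (seqs [right 0, skip_rat]) (S k) (30 * W) (S (Suc k))"
      unfolding S_def enc_items_drop[OF k] enc_items_take_Suc[OF k] append_Cons append_assoc
      apply (rule reach_weaken)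
        apply (rule exec2, simp, simp, rule reach_seqs_Cons, rule reach_skip_rat[OF len[OF k] assms(2)], rule reach_seqs_Nil)
      using assms(2) by simp_all
    then show "rd (S k ! 0) \<in> {Some True} \<and> reach (seqs [right 0, skip_rat]) (S k) (30 * W) (S (Suc k))"
      using k by (simp add: S_def enc_items_drop)
  qed (simp add: S_def)
  note loop = reach_seqs_Cons[OF this]
  have S0: "S 0 = sb (a @ [True]) (enc_list enc_rat qs @ b) y p q v f"
    by (simp add: S_def enc_list_items)
  have Sn: "S (length qs) = sb (a @ True # enc_items enc_rat qs) (False # b) y p q v f"
    by (simp add: S_def)
  have "length qs * (30 * W + 1) \<le> W * (30 * W + 1)" using n by (rule mult_le_mono1)
  moreover have "W \<le> W * W" "1 \<le> W * W" using assms(2) mult_le_mono[of 1 W 1 W] by auto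
  moreover have "W * (30 * W + 1) = 30 * (W * W) + W" by (simp add: algebra_simps)
  ultimately have time: "length qs * (30 * W + 1) + 10 \<le> 100 * (W * W)" by linarith
  show ?thesis unfolding skip_row_def
    apply (rule reach_weaken)
      apply (rule exec2, simp, simp, rule loop[unfolded S0 Sn], rule exec2, simp, simp, rule reach_seqs_Nil)
     apply (simp add: enc_list_items)
    apply (rule le_trans[OF _ time[folded mult.assoc]])
    by simp
qed

text \<open>The arcs and rows are passed only to reach the placement, whose code follows that of the
  instance. The unary vertex count is turned into binary for the comparisons.\<close>

lemma reach_back_prog:
  fixes I ws
  defines "x \<equiv> enc_instance I @ enc_placement ws"
  defines "L \<equiv> length x"
  shows "\<exists>s. s ! 1 = tp (enc_placement (from_directed I ws)) [] \<and>
    reach back_prog (tp [] x # replicate 5 (tp [] [])) (10000 * (L + 1) ^ 3) s"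
proof -
  define n as ss W where "n = n_verts I" and "as = cap_arcs I" and "ss = supplies I" and "W = 2 * L + 2"
  let ?ea = "enc_items enc_cap_arc" and ?es = "enc_items (enc_list enc_rat)" and ?ew = "enc_items enc_nat"
  have x: "x = replicate n True @ False # ?ea as @ False # ?es ss @ False # ?ew ws @ [False]"
    unfolding x_def n_def as_def ss_def by (simp add: enc_instance_items enc_placement_def enc_list_items)
  have lens: "n \<le> L" "length as \<le> L" "length ss \<le> L" "length ws \<le> L"
    using length_le_enc_list[of as enc_cap_arc] length_le_enc_list[of ss "enc_list enc_rat"]
      length_le_enc_list[of ws enc_nat]
    by (simp_all add: L_def x enc_list_items)
  have W: "1 \<le> W" "length (enc_nat n) \<le> W" "L \<le> W" "2 * n + 1 \<le> W"
    using length_enc_nat_le[of n] lens(1) by (simp_all add: W_def)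
  define pa where "pa = replicate n True @ [False]"
  define S1 where "S1 k = sb (pa @ ?ea (take k as)) (?ea (drop k as) @ False # ?es ss @ False # ?ew ws @ [False])
      [] [] (enc_nat n) [] []" for k
  have 1: "reach (While 0 {Some True} skip_arc) (S1 0) (length as * (100 * W + 1) + 1) (S1 (length as))"
  proof (rule reach_While)
    fix k assume k: "k < length as"
    have "length (enc_cap_arc (as ! k)) \<le> L"
      using k length_enc_le[of "as ! k" as enc_cap_arc] by (simp add: L_def x enc_list_items)
    then have "length (enc_cap_arc (as ! k)) \<le> W" using W(3) by linarith
    then have "reach skip_arc (S1 k) (100 * W) (S1 (Suc k))"
      unfolding S1_def enc_items_drop[OF k] enc_items_take_Suc[OF k] append_Cons append_assoc
      using reach_skip_arc[OF _ W(1), of "as ! k" "pa @ ?ea (take k as)"] by simp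
    then show "rd (S1 k ! 0) \<in> {Some True} \<and> reach skip_arc (S1 k) (100 * W) (S1 (Suc k))"
      using k by (simp add: S1_def enc_items_drop)
  qed (simp add: S1_def)
  define pb where "pb = pa @ ?ea as @ [False]"
  define S2 where "S2 k = sb (pb @ ?es (take k ss)) (?es (drop k ss) @ False # ?ew ws @ [False])
      [] [] (enc_nat n) [] []" for k
  have 2: "reach (While 0 {Some True} skip_row) (S2 0) (length ss * (100 * W * W + 1) + 1) (S2 (length ss))"
  proof (rule reach_While)
    fix k assume k: "k < length ss"
    have "length (enc_list enc_rat (ss ! k)) \<le> L"
      using k length_enc_le[of "ss ! k" ss "enc_list enc_rat"] by (simp add: L_def x enc_list_items)
    then have "length (enc_list enc_rat (ss ! k)) \<le> W" using W(3) by linarith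
    then have "reach skip_row (S2 k) (100 * W * W) (S2 (Suc k))"
      unfolding S2_def enc_items_drop[OF k] enc_items_take_Suc[OF k] append_Cons append_assoc
      using reach_skip_row[OF _ W(1), of "ss ! k" "pb @ ?es (take k ss)"] by simp
    then show "rd (S2 k ! 0) \<in> {Some True} \<and> reach skip_row (S2 k) (100 * W * W) (S2 (Suc k))"
      using k by (simp add: S2_def enc_items_drop)
  qed (simp add: S2_def)
  define pc where "pc = pb @ ?es ss @ [False]"
  define S3 where "S3 k = sb (pc @ ?ew (take k ws)) (?ew (drop k ws) @ [False])
      (?ew (map (sink_origin n) (take k ws))) [] (enc_nat n) [] []" for k
  have 3: "reach (While 0 {Some True} decode) (S3 0) (length ws * (300 * W + 1) + 1) (S3 (length ws))"
  proof (rule reach_While)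
    fix k assume k: "k < length ws"
    have "length (enc_nat (ws ! k)) \<le> L"
      using k length_enc_le[of "ws ! k" ws enc_nat] by (simp add: L_def x enc_list_items)
    then have "length (enc_nat (ws ! k)) \<le> W" using W(3) by linarith
    then have "reach decode (S3 k) (300 * W) (S3 (Suc k))"
      unfolding S3_def enc_items_drop[OF k] enc_items_take_Suc[OF k] append_Cons append_assoc
      using reach_decode[OF _ W(2,1), of "ws ! k" "pc @ ?ew (take k ws)" _ "?ew (map (sink_origin n) (take k ws))"] k
      by (simp add: take_Suc_conv_app_nth)
    then show "rd (S3 k ! 0) \<in> {Some True} \<and> reach decode (S3 k) (300 * W) (S3 (Suc k))"
      using k by (simp add: S3_def enc_items_drop)
  qed (simp add: S3_def)
  have S1: "S1 0 = sb pa (?ea as @ False # ?es ss @ False # ?ew ws @ [False]) [] [] (enc_nat n) [] []"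
    "S1 (length as) = sb (pa @ ?ea as) (False # ?es ss @ False # ?ew ws @ [False]) [] [] (enc_nat n) [] []"
    by (simp_all add: S1_def)
  have S2: "S2 0 = sb (pa @ ?ea as @ [False]) (?es ss @ False # ?ew ws @ [False]) [] [] (enc_nat n) [] []"
    "S2 (length ss) = sb (pb @ ?es ss) (False # ?ew ws @ [False]) [] [] (enc_nat n) [] []"
    by (simp_all add: S2_def pb_def)
  have S3: "S3 0 = sb (pb @ ?es ss @ [False]) (?ew ws @ [False]) [] [] (enc_nat n) [] []"
    "S3 (length ws) = sb (pc @ ?ew ws) [False] (?ew (map (sink_origin n) ws)) [] (enc_nat n) [] []"
    by (simp_all add: S3_def pc_def)
  have read: "reach read_vertices (tp [] x # replicate 5 (tp [] [])) (100 * W * W) (S1 0)"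
    unfolding S1 x pa_def
    by (rule reach_mono[OF reach_read_vertices]) (intro mult_le_mono order_refl W)
  have "length as * (100 * W + 1) \<le> L * (100 * W + 1)" "length ws * (300 * W + 1) \<le> L * (300 * W + 1)"
    "length ss * (100 * W * W + 1) \<le> L * (100 * W * W + 1)"
    using lens by (intro mult_le_mono1; linarith)+
  then have time: "100 * W * W + (length as * (100 * W + 1) + (length ws * (300 * W + 1) +
      (length ss * (100 * W * W + 1) + 20))) \<le> 10000 * (L + 1) ^ 3"
    by (simp add: W_def power3_eq_cube algebra_simps)
  let ?s = "sb (pc @ ?ew ws) [False] (?ew (map (sink_origin n) ws) @ [False]) [] (enc_nat n) [] []"
  have "reach back_prog (tp [] x # replicate 5 (tp [] [])) (10000 * (L + 1) ^ 3) ?s"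
    unfolding back_prog_def
    apply (rule reach_weaken)
      apply (rule reach_seqs_Cons[OF read], rule reach_seqs_Cons[OF 1[unfolded S1(2)]])
      apply (rule exec2, simp, simp, rule reach_seqs_Cons[OF 2[unfolded S2]])
      apply (rule exec2, simp, simp, rule reach_seqs_Cons[OF 3[unfolded S3]])
      apply (rule exec3, simp, simp, simp, rule reach_seqs_Nil)
     apply simp
    apply (rule le_trans[OF _ time])
    by simp
  moreover have "?s ! 1 = tp (enc_placement (from_directed I ws)) []"
    by (simp add: enc_placement_def from_directed_def enc_list_items n_def)
  ultimately show ?thesis by blast
qed

lemma tapes_below_back_prog: "tapes_below 6 back_prog"
  by (simp add: back_prog_def read_vertices_def skip_arc_def skip_row_def skip_bits_def skip_rat_def
      decode_def decode_sink_def compare_step_def compare_rest_def compare_digit_def compare_last_def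
      set_flag_def tapes_below_seqs right_def copy_def rewind_def emit_def copy_bits_def
      copy_rat_def inc_def clear_def)

lemma polytime_from_directed:
  "polytime_computable D (\<lambda>(I, ws). enc_instance I @ enc_placement ws) enc_placement
    (\<lambda>(I, ws). from_directed I ws)"
proof -
  have "computes_within (machine_of 6 back_prog) x
      (poly (smult 10000 ([:1, 1:] ^ 3)) (length x)) (enc_placement (from_directed I ws))"
    if x: "x = enc_instance I @ enc_placement ws" for I ws x
  proof -
    obtain s where s: "s ! 1 = tp (enc_placement (from_directed I ws)) []"
      "reach back_prog (tp [] x # replicate (6 - 1) (tp [] [])) (10000 * (length x + 1) ^ 3) s"
      using reach_back_prog[of I ws] unfolding x by auto
    show ?thesis
      by (rule computes_within_machine_of[OF s(2) tapes_below_back_prog _ s(1)]) simp_all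
  qed
  then show ?thesis
    unfolding polytime_computable_def
    by (intro exI[of _ "machine_of 6 back_prog"] exI[of _ "smult 10000 ([:1, 1:] ^ 3)"])
      (auto simp: turing_machine_machine_of)
qed


section \<open>Comparing the flows\<close>

definition incidence :: "'a \<times> 'a \<Rightarrow> 'a \<Rightarrow> real" where
  "incidence a v = of_bool (snd a = v) - of_bool (fst a = v)"

text \<open>Distinctness turns sums over the arc set into sums over the arc list, and the incidence
  coefficient merges inflow and outflow. The list form suits the constructed instance, whose arcs
  are concatenated from the gadgets.\<close>

lemma satisfies_demand_iff:
  assumes "distinct (map fst (cap_arcs I))"
  shows "satisfies_demand (graph_of I) f d \<longleftrightarrow>
    (\<forall>v<n_verts I. (\<Sum>(a, c)\<leftarrow>cap_arcs I. f a * incidence a v) = d v)"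
proof -
  have "(\<Sum>e\<in>in_arcs (graph_of I) v. f e) - (\<Sum>e\<in>out_arcs (graph_of I) v. f e) =
      (\<Sum>(a, c)\<leftarrow>cap_arcs I. f a * incidence a v)" for v
  proof -
    let ?A = "fst ` set (cap_arcs I)"
    have "(\<Sum>e\<in>in_arcs (graph_of I) v. f e) = (\<Sum>a\<in>?A. f a * of_bool (snd a = v))"
      by (rule sum.mono_neutral_cong_left) (auto simp: in_arcs_def graph_of_def)
    moreover have "(\<Sum>e\<in>out_arcs (graph_of I) v. f e) = (\<Sum>a\<in>?A. f a * of_bool (fst a = v))"
      by (rule sum.mono_neutral_cong_left) (auto simp: out_arcs_def graph_of_def)
    ultimately have "(\<Sum>e\<in>in_arcs (graph_of I) v. f e) - (\<Sum>e\<in>out_arcs (graph_of I) v. f e) =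
        (\<Sum>a\<in>set (map fst (cap_arcs I)). f a * incidence a v)"
      by (simp only: sum_subtractf[symmetric] incidence_def right_diff_distrib set_map)
    also have "\<dots> = (\<Sum>a\<leftarrow>map fst (cap_arcs I). f a * incidence a v)"
      using assms by (rule sum_list_distinct_conv_sum_set[symmetric])
    finally show ?thesis by (simp add: o_def case_prod_unfold)
  qed
  moreover have "verts (graph_of I) = {..<n_verts I}" by (simp add: graph_of_def)
  ultimately show ?thesis by (simp add: satisfies_demand_def lessThan_def)
qed

lemma capacity_eq: "distinct (map fst (cap_arcs I)) \<Longrightarrow> (a, c) \<in> set (cap_arcs I) \<Longrightarrow>
    capacity I a = real_of_rat c"
  by (simp add: capacity_def)

lemma distinct_concat_upt:
  assumes "\<And>i. i < n \<Longrightarrow> distinct (g i)"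
    and "\<And>i j. i < j \<Longrightarrow> j < n \<Longrightarrow> set (g i) \<inter> set (g j) = {}"
  shows "distinct (concat (map g [0..<n]))"
  using assms
proof (induction n)
  case (Suc n)
  have "distinct (concat (map g [0..<n]))" using Suc.prems by (intro Suc.IH) auto
  moreover have "(\<Union>i<n. set (g i)) \<inter> set (g n) = {}" using Suc.prems(2)[of _ n] by blast
  ultimately show ?case using Suc.prems(1)[of n] by (simp add: atLeast0LessThan)
qed simp

lemma sum_list_concat_upt:
  fixes f :: "'a \<Rightarrow> 'b :: comm_monoid_add"
  shows "(\<Sum>x\<leftarrow>concat (map g [0..<n]). f x) = (\<Sum>i<n. \<Sum>x\<leftarrow>g i. f x)"
  by (induction n) (simp_all add: lessThan_Suc add.commute)

lemma nth_spread:
  "k < length s \<Longrightarrow> concat (map (\<lambda>q. [q, z]) s) ! (2 * k) = s ! k"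
  "k < length s \<Longrightarrow> concat (map (\<lambda>q. [q, z]) s) ! Suc (2 * k) = z"
proof (induction s arbitrary: k)
  case (Cons q s)
  { case 1 then show ?case using Cons.IH(1) by (cases k) auto }
  { case 2 then show ?case using Cons.IH(2) by (cases k) auto }
qed simp_all

lemma length_spread: "length (concat (map (\<lambda>q. [q, z]) s)) = 2 * length s"
  by (induction s) auto

lemma length_spread_row: "length (spread_row p s) = 1 + 2 * length s + p"
  by (simp add: spread_row_def length_spread)

lemma nth_spread_row:
  "spread_row p s ! 0 = - 1"
  "2 * v + 1 < 1 + 2 * length s + p \<Longrightarrow> spread_row p s ! (2 * v + 1) = (if v < length s then s ! v else 0)"
  "2 * v + 2 < 1 + 2 * length s + p \<Longrightarrow> spread_row p s ! (2 * v + 2) = 0"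
proof -
  have "(concat (map (\<lambda>q. [q, 0]) s) @ replicate p 0) ! i = (0 :: rat)"
    if "2 * length s \<le> i" "i < 2 * length s + p" for i
    using that by (simp add: nth_append length_spread)
  note pad = this
  show "spread_row p s ! 0 = - 1" by (simp add: spread_row_def)
  show "spread_row p s ! (2 * v + 1) = (if v < length s then s ! v else 0)"
    if "2 * v + 1 < 1 + 2 * length s + p"
    using that pad[of "2 * v"] nth_spread(1)[of v s 0]
    by (auto simp: spread_row_def nth_append length_spread)
  show "spread_row p s ! (2 * v + 2) = 0" if "2 * v + 2 < 1 + 2 * length s + p"
    using that pad[of "2 * v + 1"] nth_spread(2)[of v s 0]
    by (cases "v < length s") (auto simp: spread_row_def nth_append length_spread)
qed

text \<open>Both functions serve two purposes: for \<open>v < n\<close>, \<open>mid v\<close> is the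
  vertex \<open>v\<close> and \<open>sink v\<close> its copy, while at \<open>n + t\<close> they are
  the gadget vertices \<open>y\<close> and \<open>x\<close> of edge \<open>t\<close>.\<close>

definition mid :: "nat \<Rightarrow> nat" where "mid v = 2 * v + 1"
definition sink :: "nat \<Rightarrow> nat" where "sink v = 4 * v + 2"

lemma mid_sink_simps [simp]:
  "mid u = mid v \<longleftrightarrow> u = v" "sink u = sink v \<longleftrightarrow> u = v"
  "mid u \<noteq> sink v" "sink v \<noteq> mid u" "mid u \<noteq> 0" "0 \<noteq> mid u" "sink u \<noteq> 0" "0 \<noteq> sink u"
  by (simp_all add: mid_def sink_def) presburger+

section \<open>Feasible values of the undirected instance\<close>

locale lomuf_instance =
  fixes I :: flow_instance
  assumes undirected: "undirected_instance I"
begin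

definition "n = n_verts I"
definition "m = length (cap_arcs I)"
definition "k = commodities I"
definition "src t = fst (fst (cap_arcs I ! t))"
definition "tgt t = snd (fst (cap_arcs I ! t))"
definition "cp t = real_of_rat (snd (cap_arcs I ! t))"
definition "s = supply_at I"
definition "D = to_directed I"
definition "N = n_verts D"
definition "big = (2 :: real) ^ slack I"

lemma arc_eq: "cap_arcs I ! t = ((src t, tgt t), snd (cap_arcs I ! t))"
  by (simp add: src_def tgt_def)

lemma directed_instance_I: "directed_instance I"
  using undirected by (simp add: undirected_instance_def)

lemma n_pos: "0 < n"
  using directed_instance_I by (simp add: directed_instance_def n_def)

lemma distinct_arcs: "distinct (map fst (cap_arcs I))"
  using directed_instance_I by (simp add: directed_instance_def)

lemma arc_in_arcs: "t < m \<Longrightarrow> (src t, tgt t) \<in> arcs (graph_of I)"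
  unfolding m_def src_def tgt_def graph_of_def by (auto intro!: image_eqI[OF _ nth_mem])

lemma endpoints: "t < m \<Longrightarrow> src t < n" "t < m \<Longrightarrow> tgt t < n" "t < m \<Longrightarrow> src t \<noteq> tgt t"
proof -
  interpret digraph "graph_of I" using directed_instance_I by (simp add: directed_instance_def)
  assume t: "t < m"
  show "src t < n" "tgt t < n" "src t \<noteq> tgt t"
    using wellformed[OF arc_in_arcs[OF t]] no_loops[OF arc_in_arcs[OF t]]
    by (auto simp: graph_of_def n_def)
qed

lemma cp_nonneg:
  assumes "t < m"
  shows "0 \<le> cp t"
proof -
  have "cap_arcs I ! t \<in> set (cap_arcs I)" using assms by (simp add: m_def)
  then have "0 \<le> snd (cap_arcs I ! t)" using directed_instance_I unfolding directed_instance_def by fastforce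
  then show ?thesis by (simp add: cp_def)
qed

lemma row_length: "i < k \<Longrightarrow> length (supplies I ! i) = n"
  using directed_instance_I by (simp add: directed_instance_def k_def n_def commodities_def)

lemma s_nonpos: "i < k \<Longrightarrow> v < n \<Longrightarrow> s i v \<le> 0"
  using directed_instance_I row_length[of i]
  by (auto simp: directed_instance_def k_def commodities_def s_def supply_at_def in_set_conv_nth
      of_rat_le_0_iff) (metis nth_mem)

lemma sum_s_nonpos: "i < k \<Longrightarrow> (\<Sum>v<n. s i v) \<le> 0"
  by (intro sum_nonpos) (simp add: s_nonpos)

definition arc_at :: "nat \<Rightarrow> nat \<times> nat" where "arc_at t = (src t, tgt t)"

lemma inj_arc_at: "inj_on arc_at {..<m}"
proof -
  have "arc_at t = map fst (cap_arcs I) ! t" if "t < m" for t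
    using that by (simp add: arc_at_def src_def tgt_def m_def)
  then show ?thesis using distinct_arcs by (auto intro!: inj_onI simp: m_def distinct_conv_nth) metis
qed

lemma arcs_eq: "arcs (graph_of I) = arc_at ` {..<m}"
proof -
  have "set (cap_arcs I) = (!) (cap_arcs I) ` {..<m}"
    by (auto simp: m_def set_conv_nth)
  then show ?thesis by (simp add: graph_of_def image_image arc_at_def src_def tgt_def)
qed

lemma capacity_arc_at: "t < m \<Longrightarrow> capacity I (arc_at t) = cp t"
  using capacity_eq[OF distinct_arcs, of "arc_at t" "snd (cap_arcs I ! t)"]
  by (metis arc_at_def arc_eq cp_def m_def nth_mem)

text \<open>Flows are indexed by positions in the arc list, because the gadgets are numbered by
  positions.\<close>

definition undirected_feasible :: "real \<Rightarrow> nat list \<Rightarrow> bool" where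
  "undirected_feasible l vs \<longleftrightarrow> 0 \<le> l \<and> (\<exists>h. (\<forall>t<m. (\<Sum>i<k. \<bar>h i t\<bar>) \<le> cp t) \<and>
     (\<forall>i<k. \<forall>v<n. (\<Sum>t<m. h i t * incidence (arc_at t) v) = l * placement_demand I vs i v))"

lemma undirected_value_eq:
  "undirected_placement_value I vs = Sup {ereal l | l. undirected_feasible l vs}"
proof -
  have sum: "(\<Sum>(a, c)\<leftarrow>cap_arcs I. f a * incidence a v) = (\<Sum>t<m. f (arc_at t) * incidence (arc_at t) v)"
    for f :: "nat \<times> nat \<Rightarrow> real" and v
    by (simp add: sum_list_sum_nth m_def case_prod_unfold arc_at_def src_def tgt_def atLeast0LessThan)
  have sat: "satisfies_demand (graph_of I) f d \<longleftrightarrow>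
      (\<forall>v<n. (\<Sum>t<m. f (arc_at t) * incidence (arc_at t) v) = d v)" for f d
    unfolding satisfies_demand_iff[OF distinct_arcs] sum n_def ..
  have valid: "undirected_valid (graph_of I) (capacity I) k f \<longleftrightarrow>
      (\<forall>t<m. (\<Sum>i<k. \<bar>f i (arc_at t)\<bar>) \<le> cp t)" for f
    by (auto simp: undirected_valid_def arcs_eq capacity_arc_at)
  have "(\<exists>f. undirected_valid (graph_of I) (capacity I) k f \<and>
      (\<forall>i<k. satisfies_demand (graph_of I) (f i) (\<lambda>v. l * placement_demand I vs i v))) \<longleftrightarrow>
      (\<exists>h. (\<forall>t<m. (\<Sum>i<k. \<bar>h i t\<bar>) \<le> cp t) \<and>
     (\<forall>i<k. \<forall>v<n. (\<Sum>t<m. h i t * incidence (arc_at t) v) = l * placement_demand I vs i v))" for l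
    unfolding sat valid
  proof safe
    fix h :: "nat \<Rightarrow> nat \<Rightarrow> real"
    assume h: "\<forall>t<m. (\<Sum>i<k. \<bar>h i t\<bar>) \<le> cp t"
      "\<forall>i<k. \<forall>v<n. (\<Sum>t<m. h i t * incidence (arc_at t) v) = l * placement_demand I vs i v"
    define f where "f i a = h i (the_inv_into {..<m} arc_at a)" for i a
    have "f i (arc_at t) = h i t" if "t < m" for i t
      using that by (simp add: f_def the_inv_into_f_f[OF inj_arc_at])
    then show "\<exists>f. (\<forall>t<m. (\<Sum>i<k. \<bar>f i (arc_at t)\<bar>) \<le> cp t) \<and>
       (\<forall>i<k. \<forall>v<n. (\<Sum>t<m. f i (arc_at t) * incidence (arc_at t) v) = l * placement_demand I vs i v)"
      using h by (intro exI[of _ f]) simp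
  next
    fix f
    assume "\<forall>t<m. (\<Sum>i<k. \<bar>f i (arc_at t)\<bar>) \<le> cp t"
      "\<forall>i<k. \<forall>v<n. (\<Sum>t<m. f i (arc_at t) * incidence (arc_at t) v) = l * placement_demand I vs i v"
    then show "\<exists>h. (\<forall>t<m. (\<Sum>i<k. \<bar>h i t\<bar>) \<le> cp t) \<and>
       (\<forall>i<k. \<forall>v<n. (\<Sum>t<m. h i t * incidence (arc_at t) v) = l * placement_demand I vs i v)"
      by (intro exI[of _ "\<lambda>i t. f i (arc_at t)"]) simp
  qed
  then show ?thesis
    by (simp add: undirected_placement_value_def undirected_lambda_def flow_value_def k_def[symmetric]
        undirected_feasible_def)
qed

section \<open>Arcs and balances in the directed instance\<close>

abbreviation X where "X t \<equiv> sink (n + t)"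
abbreviation Y where "Y t \<equiv> mid (n + t)"

lemma set_cap_arcs_D: "set (cap_arcs D) =
    (\<Union>v<n. {((mid v, sink v), 2 ^ slack I), ((0, sink v), 2 ^ slack I)}) \<union>
    (\<Union>t<m. let c = snd (cap_arcs I ! t) in {((mid (src t), X t), c), ((mid (tgt t), X t), c),
       ((X t, Y t), c), ((Y t, mid (src t)), c), ((Y t, mid (tgt t)), c)})"
  by (simp add: D_def to_directed_def vertex_arcs_def edge_arcs_def case_prod_unfold mid_def sink_def
      n_def m_def src_def tgt_def atLeast0LessThan Let_def)

lemma distinct_arcs_D: "distinct (map fst (cap_arcs D))"
proof -
  have "map fst (cap_arcs D) = concat (map (\<lambda>v. [(mid v, sink v), (0, sink v)]) [0..<n]) @
      concat (map (\<lambda>t. [(mid (src t), X t), (mid (tgt t), X t), (X t, Y t),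
        (Y t, mid (src t)), (Y t, mid (tgt t))]) [0..<m])"
    by (simp add: D_def to_directed_def vertex_arcs_def edge_arcs_def case_prod_unfold mid_def sink_def map_concat o_def
      n_def m_def src_def tgt_def)
  moreover have "distinct (concat (map (\<lambda>v. [(mid v, sink v), (0 :: nat, sink v)]) [0..<n]))"
    by (rule distinct_concat_upt) auto
  moreover have "distinct (concat (map (\<lambda>t. [(mid (src t), X t), (mid (tgt t), X t), (X t, Y t),
        (Y t, mid (src t)), (Y t, mid (tgt t))]) [0..<m]))"
  proof (rule distinct_concat_upt)
    fix t assume "t < m"
    then show "distinct [(mid (src t), X t), (mid (tgt t), X t), (X t, Y t),
        (Y t, mid (src t)), (Y t, mid (tgt t))]"
      using endpoints[of t] by auto
  next
    fix t t' assume "t < t'" "t' < m"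
    then show "set [(mid (src t), X t), (mid (tgt t), X t), (X t, Y t),
        (Y t, mid (src t)), (Y t, mid (tgt t))] \<inter>
      set [(mid (src t'), X t'), (mid (tgt t'), X t'), (X t', Y t'),
        (Y t', mid (src t')), (Y t', mid (tgt t'))] = {}"
      using endpoints[of t] endpoints[of t'] by auto
  qed
  ultimately show ?thesis
    using endpoints by auto
qed

lemma sum_arcs_D:
  fixes F :: "nat \<times> nat \<Rightarrow> real"
  shows "(\<Sum>(a, c)\<leftarrow>cap_arcs D. F a) = (\<Sum>v<n. F (mid v, sink v) + F (0, sink v)) +
    (\<Sum>t<m. F (mid (src t), X t) + F (mid (tgt t), X t) + F (X t, Y t) +
       F (Y t, mid (src t)) + F (Y t, mid (tgt t)))"
  by (simp add: D_def to_directed_def sum_list_concat_upt vertex_arcs_def edge_arcs_def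
      case_prod_unfold mid_def sink_def n_def m_def src_def tgt_def add.assoc)

definition net :: "(nat \<times> nat \<Rightarrow> real) \<Rightarrow> nat \<Rightarrow> real" where
  "net g w = (\<Sum>(a, c)\<leftarrow>cap_arcs D. g a * incidence a w)"

lemma net_eq: "net g w =
    (\<Sum>v<n. g (mid v, sink v) * (of_bool (sink v = w) - of_bool (mid v = w)) +
       g (0, sink v) * (of_bool (sink v = w) - of_bool (0 = w))) +
    (\<Sum>t<m. g (mid (src t), X t) * (of_bool (X t = w) - of_bool (mid (src t) = w)) +
       g (mid (tgt t), X t) * (of_bool (X t = w) - of_bool (mid (tgt t) = w)) +
       g (X t, Y t) * (of_bool (Y t = w) - of_bool (X t = w)) +
       g (Y t, mid (src t)) * (of_bool (mid (src t) = w) - of_bool (Y t = w)) +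
       g (Y t, mid (tgt t)) * (of_bool (mid (tgt t) = w) - of_bool (Y t = w)))"
  unfolding net_def sum_arcs_D incidence_def fst_conv snd_conv ..

lemma sum_single: "(t :: nat) < m' \<Longrightarrow> (\<And>t'. t' < m' \<Longrightarrow> t' \<noteq> t \<Longrightarrow> F t' = 0) \<Longrightarrow> (\<Sum>t'<m'. F t') = (F t :: real)"
  by (subst sum.mono_neutral_right[of "{..<m'}" "{t}"]) auto

lemma net_0: "net g 0 = - (\<Sum>v<n. g (0, sink v))"
  by (simp add: net_eq sum_negf)

text \<open>Any number of edges may end at \<open>v\<close>, so the gadgets enter as a sum with
  indicators. Each term is what the gadget delivers to \<open>v\<close> minus what it takes from
  \<open>v\<close>.\<close>

lemma net_mid:
  assumes "v < n"
  shows "net g (mid v) = - g (mid v, sink v) +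
    (\<Sum>t<m. of_bool (src t = v) * (g (Y t, mid (src t)) - g (mid (src t), X t)) +
      of_bool (tgt t = v) * (g (Y t, mid (tgt t)) - g (mid (tgt t), X t)))"
  unfolding net_eq
proof (rule arg_cong2[where f = "(+)"])
  show "(\<Sum>u<n. g (mid u, sink u) * (of_bool (sink u = mid v) - of_bool (mid u = mid v)) +
       g (0, sink u) * (of_bool (sink u = mid v) - of_bool (0 = mid v))) = - g (mid v, sink v)"
    by (subst sum_single[OF assms]) auto
qed (use assms in \<open>auto intro!: sum.cong simp: algebra_simps\<close>)

lemma net_Y:
  assumes "t < m"
  shows "net g (Y t) = g (X t, Y t) - g (Y t, mid (src t)) - g (Y t, mid (tgt t))"
  unfolding net_eq using assms endpoints(1,2)
  by (subst sum_single[OF assms]) (fastforce intro!: sum.neutral)+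

text \<open>Both terms are inflow, as a copy has no outgoing arcs; this confines the sinks.\<close>

lemma net_sink: "v < n \<Longrightarrow> net g (sink v) = g (mid v, sink v) + g (0, sink v)"
  unfolding net_eq using endpoints(1,2)
  by (subst sum_single[of v n]) (auto intro!: sum.neutral)

lemma net_X:
  assumes "t < m"
  shows "net g (X t) = g (mid (src t), X t) + g (mid (tgt t), X t) - g (X t, Y t)"
  unfolding net_eq using assms endpoints(1,2)
  by (subst sum_single[OF assms]) (fastforce intro!: sum.neutral)+

lemma net_junk:
  assumes "w \<noteq> 0" "\<And>v. v < n + m \<Longrightarrow> w \<noteq> mid v \<and> w \<noteq> sink v"
  shows "net g w = 0"
proof -
  have "mid v \<noteq> w" "sink v \<noteq> w" if "v < n + m" for v using assms(2)[OF that] by auto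
  then show ?thesis unfolding net_eq using assms(1) endpoints(1,2)
    by (auto intro!: sum.neutral simp: add.commute trans_less_add1 trans_less_add2)
qed


section \<open>Feasibility and demands in the directed instance\<close>

lemma commodities_D: "commodities D = k"
  by (simp add: commodities_def k_def D_def to_directed_def)

lemma N_eq: "N = 1 + 2 * n + slack I"
  by (simp add: N_def D_def to_directed_def n_def)

text \<open>Every vertex and every edge takes at least one input symbol, so \<open>n + m\<close> is
  at most the input length and \<open>4 * v + 2\<close> stays below \<open>slack I\<close>.\<close>

lemma index_bound: "v < n + m \<Longrightarrow> sink v < N" "v < n + m \<Longrightarrow> mid v < N"
proof -
  have "n + m \<le> length (enc_instance I)"
    using length_le_enc_list[of "cap_arcs I" enc_cap_arc]
    by (simp add: enc_instance_items enc_list_items n_def m_def)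
  then show "v < n + m \<Longrightarrow> sink v < N" "v < n + m \<Longrightarrow> mid v < N"
    by (simp_all add: N_eq slack_def sink_def mid_def)
qed

definition cap_ok :: "(nat \<Rightarrow> nat \<times> nat \<Rightarrow> real) \<Rightarrow> nat \<times> nat \<Rightarrow> real \<Rightarrow> bool" where
  "cap_ok g a c \<longleftrightarrow> (\<forall>i<k. 0 \<le> g i a) \<and> (\<Sum>i<k. g i a) \<le> c"

definition flow_ok :: "(nat \<Rightarrow> nat \<times> nat \<Rightarrow> real) \<Rightarrow> bool" where
  "flow_ok g \<longleftrightarrow> (\<forall>v<n. cap_ok g (mid v, sink v) big \<and> cap_ok g (0, sink v) big) \<and>
     (\<forall>t<m. cap_ok g (mid (src t), X t) (cp t) \<and> cap_ok g (mid (tgt t), X t) (cp t) \<and>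
       cap_ok g (X t, Y t) (cp t) \<and> cap_ok g (Y t, mid (src t)) (cp t) \<and> cap_ok g (Y t, mid (tgt t)) (cp t))"

lemma directed_valid_D: "directed_valid (graph_of D) (capacity D) k g \<longleftrightarrow> flow_ok g"
proof -
  have "directed_valid (graph_of D) (capacity D) k g \<longleftrightarrow>
      (\<forall>(a, c)\<in>set (cap_arcs D). cap_ok g a (real_of_rat c))"
    using capacity_eq[OF distinct_arcs_D]
    by (auto simp: directed_valid_def graph_of_def cap_ok_def)
  also have "\<dots> \<longleftrightarrow> flow_ok g"
    unfolding set_cap_arcs_D flow_ok_def
    by (simp add: ball_Un Let_def cp_def big_def of_rat_power Ball_def[of "{..<_}"])
  finally show ?thesis .
qed

definition directed_feasible :: "real \<Rightarrow> nat list \<Rightarrow> bool" where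
  "directed_feasible l ws \<longleftrightarrow> 0 \<le> l \<and> (\<exists>g. flow_ok g \<and>
     (\<forall>i<k. \<forall>w<N. net (g i) w = l * placement_demand D ws i w))"

lemma directed_value_eq:
  "directed_placement_value D ws = Sup {ereal l | l. directed_feasible l ws}"
  unfolding directed_placement_value_def directed_lambda_def flow_value_def commodities_D
    directed_valid_D satisfies_demand_iff[OF distinct_arcs_D] directed_feasible_def net_def N_def ..

definition sD :: "nat \<Rightarrow> nat \<Rightarrow> real" where
  "sD = supply_at D"

lemma sD_eq:
  assumes "i < k" "w < N"
  shows "sD i w = (if w = 0 then - 1 else if odd w \<and> w div 2 < n then s i (w div 2) else 0)"
proof -
  let ?r = "spread_row (slack I) (supplies I ! i)"
  have l: "length (supplies I ! i) = n" using assms by (simp add: row_length)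
  have sD: "sD i w = real_of_rat (?r ! w)"
    using assms(1) by (simp add: sD_def supply_at_def D_def to_directed_def k_def commodities_def)
  show ?thesis
  proof (cases "w = 0")
    case True
    then show ?thesis using sD by (simp add: nth_spread_row(1))
  next
    case False
    define v where "v = (w - 1) div 2"
    have "w = 2 * v + 1 \<and> odd w \<or> w = 2 * v + 2 \<and> even w" using False unfolding v_def by presburger
    then show ?thesis
    proof
      assume w: "w = 2 * v + 1 \<and> odd w"
      then have "?r ! w = (if v < n then supplies I ! i ! v else 0)"
        using nth_spread_row(2)[of v "supplies I ! i" "slack I"] assms(2) l by (simp add: N_eq)
      then show ?thesis using w sD by (simp add: s_def supply_at_def)
    next
      assume w: "w = 2 * v + 2 \<and> even w"
      then have "?r ! w = 0"
        using nth_spread_row(3)[of v "supplies I ! i" "slack I"] assms(2) l by (simp add: N_eq)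
      then show ?thesis using w sD by simp
    qed
  qed
qed

lemma sD_simps:
  "i < k \<Longrightarrow> sD i 0 = - 1"
  "i < k \<Longrightarrow> v < n \<Longrightarrow> sD i (mid v) = s i v"
  "i < k \<Longrightarrow> n \<le> v \<Longrightarrow> mid v < N \<Longrightarrow> sD i (mid v) = 0"
  "i < k \<Longrightarrow> sink v < N \<Longrightarrow> sD i (sink v) = 0"
  using index_bound(2)[of v] sD_eq[of i 0] sD_eq[of i "mid v"] sD_eq[of i "sink v"]
  by (simp_all add: mid_def sink_def N_eq)

lemma sD_nonpos: "i < k \<Longrightarrow> w < N \<Longrightarrow> sD i w \<le> 0"
  by (simp add: sD_eq s_nonpos)

lemma sum_sD:
  assumes "i < k"
  shows "(\<Sum>w<N. sD i w) = - 1 + (\<Sum>v<n. s i v)"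
proof -
  have "(\<Sum>w<N. sD i w) = (\<Sum>w\<in>insert 0 (mid ` {..<n}). sD i w)"
  proof (rule sum.mono_neutral_right)
    show "insert 0 (mid ` {..<n}) \<subseteq> {..<N}" using index_bound(2) by (auto simp: N_eq)
    show "\<forall>w\<in>{..<N} - insert 0 (mid ` {..<n}). sD i w = 0"
    proof
      fix w assume w: "w \<in> {..<N} - insert 0 (mid ` {..<n})"
      have "w = mid (w div 2)" if "odd w" using that unfolding mid_def by presburger
      then have "\<not> (odd w \<and> w div 2 < n)" using w by auto
      then show "sD i w = 0" using w assms by (auto simp: sD_eq)
    qed
  qed simp
  also have "\<dots> = sD i 0 + (\<Sum>v<n. sD i (mid v))"
    by (subst sum.insert) (auto simp: sum.reindex inj_on_def)
  finally show ?thesis using assms by (simp add: sD_simps)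
qed

lemma demand_I: "placement_demand I vs i v =
    (if v = vs ! i then - (\<Sum>u\<in>{..<n} - {vs ! i}. s i u) else s i v)"
  by (simp add: placement_demand_def located_demand_def graph_of_def n_def s_def)

lemma demand_D: "placement_demand D ws i w =
    (if w = ws ! i then - (\<Sum>u\<in>{..<N} - {ws ! i}. sD i u) else sD i w)"
  by (simp add: placement_demand_def located_demand_def graph_of_def N_def sD_def)

lemma sink_origin_sink: "v < n \<Longrightarrow> sink_origin n (sink v) = v"
proof -
  have "sink v mod 4 = 2" "sink v div 4 = v" unfolding sink_def by presburger+
  then show "v < n \<Longrightarrow> sink_origin n (sink v) = v" by (simp add: sink_origin_def)
qed

section \<open>From directed to undirected flows\<close>

lemma sum_incidence: "t < m \<Longrightarrow> (\<Sum>v<n. incidence (arc_at t) v) = 0"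
  using endpoints(1,2)[of t] by (simp add: incidence_def arc_at_def sum_subtractf)

text \<open>Each gadget acts as an edge that carries its net throughput. If the sink is at a copy,
  the balances at the vertices give the demands; otherwise the demand to be met is zero.\<close>

lemma recover_flow:
  assumes i: "i < k" and l: "0 \<le> l" and ok: "flow_ok g"
    and net: "\<And>w. w < N \<Longrightarrow> net (g i) w = l * placement_demand D ws i w"
    and v0: "vs ! i = sink_origin n (ws ! i)"
  shows "\<exists>h. (\<forall>t<m. \<bar>h t\<bar> \<le> g i (X t, Y t)) \<and>
    (\<forall>v<n. (\<Sum>t<m. h t * incidence (arc_at t) v) = l * placement_demand I vs i v)"
proof -
  have pos: "v < n \<Longrightarrow> 0 \<le> g i (mid v, sink v)" "v < n \<Longrightarrow> 0 \<le> g i (0, sink v)"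
    "t < m \<Longrightarrow> 0 \<le> g i (mid (src t), X t)" "t < m \<Longrightarrow> 0 \<le> g i (mid (tgt t), X t)"
    "t < m \<Longrightarrow> 0 \<le> g i (X t, Y t)" "t < m \<Longrightarrow> 0 \<le> g i (Y t, mid (src t))"
    "t < m \<Longrightarrow> 0 \<le> g i (Y t, mid (tgt t))" for v t
    using ok i by (simp_all add: flow_ok_def cap_ok_def)
  \<comment> \<open>A copy without the sink has demand \<open>0\<close> and only incoming arcs, so
    nonnegativity stops all flow into it.\<close>
  have no_sink: "g i (mid v, sink v) = 0 \<and> g i (0, sink v) = 0" if "v < n" "ws ! i \<noteq> sink v" for v
  proof -
    have "net (g i) (sink v) = 0"
      using net[of "sink v"] that i index_bound(1)[of v] by (simp add: demand_D sD_simps)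
    then show ?thesis using pos(1,2)[of v] that by (simp add: net_sink)
  qed
  show ?thesis
  proof (cases "\<exists>v<n. ws ! i = sink v")
    case False
    have "l * placement_demand I vs i v = 0" if "v < n" for v
    proof -
      \<comment> \<open>Nothing can leave \<open>z\<close>, so its demand times \<open>l\<close> is
        \<open>0\<close>. For \<open>l \<noteq> 0\<close> this contradicts the supply
        \<open>- 1\<close> unless the sink is at \<open>z\<close>; there the demand is a sum of
        nonnegative terms, which must all vanish.\<close>
      have "net (g i) 0 = 0" using no_sink False by (simp add: net_0)
      then have z: "l * placement_demand D ws i 0 = 0" using net[of 0] by (simp add: N_eq)
      show ?thesis
      proof (cases "l = 0")
        case False
        with z have d0: "placement_demand D ws i 0 = 0" by simp
        then have ws: "ws ! i = 0" using i by (auto simp: demand_D sD_simps split: if_splits)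
        with d0 have "(\<Sum>u\<in>{..<N} - {0}. - sD i u) = 0" by (simp add: demand_D sum_negf)
        then have zero: "\<forall>u\<in>{..<N} - {0}. - sD i u = 0"
          using sD_nonpos[OF i] by (subst (asm) sum_nonneg_eq_0_iff) auto
        have "s i u = 0" if "u < n" for u
          using zero sD_simps(2)[OF i that] index_bound(2)[of u] that by simp
        then show ?thesis using that by (simp add: demand_I)
      qed simp
    qed
    then show ?thesis using pos(5) by (intro exI[of _ "\<lambda>_. 0"]) simp
  next
    case True
    then obtain v0 where v0': "v0 < n" "ws ! i = sink v0" by blast
    then have vs: "vs ! i = v0" using v0 by (simp add: sink_origin_sink)
    \<comment> \<open>This is what the gadget delivers to the target minus what it takes there. By
      the balances of \<open>x\<close> and \<open>y\<close> it does the opposite at the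
      source.\<close>
    define h where "h t = g i (Y t, mid (tgt t)) - g i (mid (tgt t), X t)" for t
    have X: "g i (mid (src t), X t) + g i (mid (tgt t), X t) = g i (X t, Y t)"
      and Y: "g i (X t, Y t) = g i (Y t, mid (src t)) + g i (Y t, mid (tgt t))" if "t < m" for t
      using net[of "X t"] net[of "Y t"] that i v0' index_bound[of "n + t"]
      by (simp_all add: demand_D sD_simps net_X net_Y)
    have h_src: "g i (Y t, mid (src t)) - g i (mid (src t), X t) = - h t" if "t < m" for t
      using X[OF that] Y[OF that] by (simp add: h_def)
    define F where "F v = (\<Sum>t<m. h t * incidence (arc_at t) v)" for v
    have F: "net (g i) (mid v) = - g i (mid v, sink v) + F v" if "v < n" for v
      unfolding net_mid[OF that] F_def
      by (intro arg_cong2[where f = "(+)"] sum.cong)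
        (auto simp: h_src h_def[symmetric] incidence_def arc_at_def of_bool_def)
    have F_other: "F v = l * s i v" if "v < n" "v \<noteq> v0" for v
      using F[OF that(1)] net[of "mid v"] no_sink[of v] that v0' i index_bound(2)[of v]
      by (simp add: demand_D sD_simps)
    \<comment> \<open>The balance at \<open>mid v0\<close> involves the unknown flow to the copy, so
      the value at \<open>v0\<close> is obtained from the total instead.\<close>
    have "(\<Sum>v<n. F v) = (\<Sum>t<m. h t * (\<Sum>v<n. incidence (arc_at t) v))"
      unfolding F_def by (subst sum.swap) (simp add: sum_distrib_left)
    also have "\<dots> = 0" by (simp add: sum_incidence)
    finally have "F v0 = - (\<Sum>v\<in>{..<n} - {v0}. F v)"
      using v0' by (simp add: sum.remove[of "{..<n}" v0])
    then have F_v0: "F v0 = - (\<Sum>v\<in>{..<n} - {v0}. l * s i v)"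
      using F_other by simp
    have "F v = l * placement_demand I vs i v" if "v < n" for v
      using F_other[OF that] F_v0 by (auto simp: demand_I vs sum_distrib_left)
    \<comment> \<open>Both terms of \<open>h t\<close> lie between \<open>0\<close> and the flow
      through the bottleneck.\<close>
    moreover have "\<bar>h t\<bar> \<le> g i (X t, Y t)" if "t < m" for t
      using X[OF that] Y[OF that] pos(3-7)[OF that] by (simp add: h_def)
    ultimately show ?thesis unfolding F_def by blast
  qed
qed

text \<open>The capacity of the bottleneck bounds the sum of the \<open>\<bar>h i t\<bar>\<close>
  over all commodities, whichever way each of them uses the edge.\<close>

lemma feasible_from_directed:
  assumes "directed_feasible l ws" "placement D ws"
  shows "undirected_feasible l (from_directed I ws)"
proof -
  obtain g where l: "0 \<le> l" and g: "flow_ok g"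
    "\<And>i w. i < k \<Longrightarrow> w < N \<Longrightarrow> net (g i) w = l * placement_demand D ws i w"
    using assms(1) by (auto simp: directed_feasible_def)
  have "\<forall>i. \<exists>h. i < k \<longrightarrow> (\<forall>t<m. \<bar>h t\<bar> \<le> g i (X t, Y t)) \<and>
    (\<forall>v<n. (\<Sum>t<m. h t * incidence (arc_at t) v) = l * placement_demand I (from_directed I ws) i v)"
  proof
    fix i
    show "\<exists>h. i < k \<longrightarrow> (\<forall>t<m. \<bar>h t\<bar> \<le> g i (X t, Y t)) \<and>
    (\<forall>v<n. (\<Sum>t<m. h t * incidence (arc_at t) v) = l * placement_demand I (from_directed I ws) i v)"
    proof (cases "i < k")
      case True
      then have "from_directed I ws ! i = sink_origin n (ws ! i)"
        using assms(2) by (simp add: from_directed_def n_def placement_def commodities_D)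
      from recover_flow[OF True l g(1) g(2)[OF True] this] show ?thesis by blast
    qed simp
  qed
  then obtain h where h: "\<And>i t. i < k \<Longrightarrow> t < m \<Longrightarrow> \<bar>h i t\<bar> \<le> g i (X t, Y t)"
    "\<And>i v. i < k \<Longrightarrow> v < n \<Longrightarrow>
      (\<Sum>t<m. h i t * incidence (arc_at t) v) = l * placement_demand I (from_directed I ws) i v"
    by metis
  have "(\<Sum>i<k. \<bar>h i t\<bar>) \<le> cp t" if "t < m" for t
  proof -
    have "(\<Sum>i<k. \<bar>h i t\<bar>) \<le> (\<Sum>i<k. g i (X t, Y t))" using h(1) that by (intro sum_mono) simp
    also have "\<dots> \<le> cp t" using g(1) that by (simp add: flow_ok_def cap_ok_def)
    finally show ?thesis .
  qed
  then show ?thesis using l h(2) by (auto simp: undirected_feasible_def)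
qed


section \<open>From undirected to directed flows\<close>

definition lift_flow :: "real \<Rightarrow> real \<Rightarrow> nat \<Rightarrow> (nat \<Rightarrow> real) \<Rightarrow> nat \<times> nat \<Rightarrow> real" where
  "lift_flow l r v0 h a = of_bool (a = (0, sink v0)) * l + of_bool (a = (mid v0, sink v0)) * r +
     (\<Sum>t<m. of_bool (a = (mid (src t), X t) \<or> a = (Y t, mid (tgt t))) * max (h t) 0 +
        of_bool (a = (mid (tgt t), X t) \<or> a = (Y t, mid (src t))) * max (- h t) 0 +
        of_bool (a = (X t, Y t)) * \<bar>h t\<bar>)"

lemma lift_flow_vertex:
  assumes "v < n"
  shows "lift_flow l r v0 h (0, sink v) = (if v = v0 then l else 0)"
    "lift_flow l r v0 h (mid v, sink v) = (if v = v0 then r else 0)"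
  unfolding lift_flow_def using assms by (auto intro!: sum.neutral)

text \<open>The positive part of \<open>h t\<close> crosses the gadget from source to target and the
  negative part the other way. One of them is zero, so the bottleneck carries
  \<open>\<bar>h t\<bar>\<close>.\<close>

lemma lift_flow_edge:
  assumes "t < m" "v0 < n"
  shows "lift_flow l r v0 h (mid (src t), X t) = max (h t) 0"
    "lift_flow l r v0 h (mid (tgt t), X t) = max (- h t) 0"
    "lift_flow l r v0 h (X t, Y t) = \<bar>h t\<bar>"
    "lift_flow l r v0 h (Y t, mid (src t)) = max (- h t) 0"
    "lift_flow l r v0 h (Y t, mid (tgt t)) = max (h t) 0"
proof -
  have ne: "t' < m \<Longrightarrow> n + t \<noteq> src t'" "t' < m \<Longrightarrow> n + t \<noteq> tgt t'" "t' < m \<Longrightarrow> src t \<noteq> n + t'"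
    "t' < m \<Longrightarrow> tgt t \<noteq> n + t'" for t'
    using endpoints(1,2)[of t] endpoints(1,2)[of t'] assms by auto
  show "lift_flow l r v0 h (mid (src t), X t) = max (h t) 0"
    "lift_flow l r v0 h (mid (tgt t), X t) = max (- h t) 0"
    "lift_flow l r v0 h (X t, Y t) = \<bar>h t\<bar>"
    "lift_flow l r v0 h (Y t, mid (src t)) = max (- h t) 0"
    "lift_flow l r v0 h (Y t, mid (tgt t)) = max (h t) 0"
    unfolding lift_flow_def using ne[OF assms(1)] endpoints(3)[OF assms(1)] assms
    by (subst sum_single[OF assms(1)]; use ne in auto)+
qed

text \<open>At \<open>mid v0\<close> the undirected flow collects the supplies of the other
  vertices, and \<open>r\<close> forwards them to the copy together with the supply of
  \<open>v0\<close> itself. The copy gets another \<open>l\<close> from \<open>z\<close>, which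
  completes its demand.\<close>

lemma net_lift_flow:
  assumes i: "i < k" and v0: "v0 < n" "vs ! i = v0" "ws ! i = sink v0" and r: "r = - l * (\<Sum>v<n. s i v)"
    and h: "\<And>v. v < n \<Longrightarrow> (\<Sum>t<m. h t * incidence (arc_at t) v) = l * placement_demand I vs i v"
    and w: "w < N"
  shows "net (lift_flow l r v0 h) w = l * placement_demand D ws i w"
proof -
  let ?g = "lift_flow l r v0 h"
  consider "w = 0" | v where "v < n" "w = mid v" | v where "v < n" "w = sink v"
    | t where "t < m" "w = X t" | t where "t < m" "w = Y t"
    | "w \<noteq> 0" "\<And>v. v < n + m \<Longrightarrow> w \<noteq> mid v \<and> w \<noteq> sink v"
  proof -
    have "v < n \<or> (\<exists>t<m. v = n + t)" if "v < n + m" for v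
      using that by (metis add_diff_inverse_nat nat_add_left_cancel_less)
    then show thesis using that by metis
  qed
  then show ?thesis
  proof cases
    case 1
    have "(\<Sum>v<n. ?g (0, sink v)) = l" using v0(1) by (simp add: lift_flow_vertex)
    then show ?thesis using 1 i v0 by (simp add: net_0 demand_D sD_simps)
  next
    case (2 v)
    have "(\<Sum>t<m. of_bool (src t = v) * (?g (Y t, mid (src t)) - ?g (mid (src t), X t)) +
        of_bool (tgt t = v) * (?g (Y t, mid (tgt t)) - ?g (mid (tgt t), X t))) =
      (\<Sum>t<m. h t * incidence (arc_at t) v)"
      using v0(1) by (intro sum.cong) (auto simp: lift_flow_edge incidence_def arc_at_def of_bool_def)
    then have "net ?g w = - (if v = v0 then r else 0) + l * placement_demand I vs i v"
      unfolding 2(2) net_mid[OF 2(1)] h[OF 2(1)] by (simp only: lift_flow_vertex[OF 2(1)])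
    also have "\<dots> = l * s i v"
    proof (cases "v = v0")
      case True
      have "(\<Sum>u<n. s i u) = s i v0 + (\<Sum>u\<in>{..<n} - {v0}. s i u)"
        using v0(1) by (simp add: sum.remove[of "{..<n}" v0])
      then show ?thesis using True v0 by (simp add: r demand_I algebra_simps)
    qed (use v0 in \<open>simp add: demand_I\<close>)
    finally show ?thesis using 2 v0 i by (simp add: demand_D sD_simps)
  next
    case (3 v)
    have "(\<Sum>u<N. sD i u) = sD i (sink v0) + (\<Sum>u\<in>{..<N} - {sink v0}. sD i u)"
      using index_bound(1)[of v0] v0(1) by (simp add: sum.remove[of "{..<N}" "sink v0"])
    then have "(\<Sum>u\<in>{..<N} - {sink v0}. sD i u) = - 1 + (\<Sum>v<n. s i v)"
      using sum_sD[OF i] sD_simps(4)[OF i] index_bound(1)[of v0] v0(1) by simp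
    then have "placement_demand D ws i (sink v0) = 1 - (\<Sum>v<n. s i v)"
      by (simp add: demand_D v0)
    then show ?thesis
      using 3 w i v0 by (auto simp: net_sink lift_flow_vertex r demand_D sD_simps algebra_simps)
  next
    case (4 t)
    then have "w \<noteq> sink v0" using v0(1) by auto
    then show ?thesis using 4 w i v0(1,3)
      by (auto simp: net_X lift_flow_edge demand_D sD_simps)
  next
    case (5 t)
    then show ?thesis using w i v0(1,3)
      by (auto simp: net_Y lift_flow_edge demand_D sD_simps)
  next
    case 6
    have "sD i w = 0"
    proof -
      have "w = mid (w div 2)" if "odd w" using that unfolding mid_def by presburger
      then show ?thesis using 6(1) 6(2)[of "w div 2"] w i by (auto simp: sD_eq)
    qed
    moreover have "w \<noteq> sink v0" using 6(2)[of v0] v0(1) by simp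
    ultimately show ?thesis using net_junk[OF 6] v0 by (simp add: demand_D)
  qed
qed

text \<open>In the worst case all sinks coincide, and the two arcs into that copy carry one unit per
  commodity and the total supply, both times \<open>l\<close>. These are the two premises on
  \<open>big\<close>.\<close>

lemma feasible_to_directed:
  assumes u: "undirected_feasible l vs" and vs: "placement I vs"
    and big: "real k * l \<le> big" "l * (\<Sum>i<k. - (\<Sum>v<n. s i v)) \<le> big"
  shows "directed_feasible l (map sink vs)"
proof -
  obtain h where l: "0 \<le> l" and h: "\<And>t. t < m \<Longrightarrow> (\<Sum>i<k. \<bar>h i t\<bar>) \<le> cp t"
    "\<And>i v. i < k \<Longrightarrow> v < n \<Longrightarrow> (\<Sum>t<m. h i t * incidence (arc_at t) v) = l * placement_demand I vs i v"
    using u by (auto simp: undirected_feasible_def)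
  have vsn: "length vs = k" "i < k \<Longrightarrow> vs ! i < n" for i
  proof -
    show len: "length vs = k" using vs by (simp add: placement_def k_def)
    assume "i < k"
    then have "vs ! i \<in> set vs" using len by simp
    then show "vs ! i < n" using vs by (auto simp: placement_def n_def graph_of_def)
  qed
  define r where "r i = - l * (\<Sum>v<n. s i v)" for i
  define g where "g i = lift_flow l (r i) (vs ! i) (h i)" for i
  have r: "0 \<le> r i" if "i < k" for i
    unfolding r_def using l sum_s_nonpos[OF that] by (simp add: mult_nonneg_nonpos)
  have "flow_ok g"
    unfolding flow_ok_def
  proof (intro conjI allI impI)
    fix v assume v: "v < n"
    have "(\<Sum>i<k. r i) = l * (\<Sum>i<k. - (\<Sum>v<n. s i v))"
      by (simp add: r_def sum_distrib_left sum_negf)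
    moreover have "(\<Sum>i<k. g i (mid v, sink v)) \<le> (\<Sum>i<k. r i)"
      using r v by (intro sum_mono) (simp add: g_def lift_flow_vertex)
    ultimately show "cap_ok g (mid v, sink v) big"
      using big(2) r v by (simp add: cap_ok_def g_def lift_flow_vertex)
    have "(\<Sum>i<k. g i (0, sink v)) \<le> (\<Sum>i<k. l)"
      using l v by (intro sum_mono) (simp add: g_def lift_flow_vertex)
    then show "cap_ok g (0, sink v) big"
      using big(1) l v by (simp add: cap_ok_def g_def lift_flow_vertex)
  next
    fix t assume t: "t < m"
    have *: "cap_ok g a (cp t)" if "\<And>i. i < k \<Longrightarrow> 0 \<le> g i a \<and> g i a \<le> \<bar>h i t\<bar>" for a
    proof -
      have "(\<Sum>i<k. g i a) \<le> (\<Sum>i<k. \<bar>h i t\<bar>)" using that by (intro sum_mono) simp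
      then show ?thesis using h(1)[OF t] that by (simp add: cap_ok_def)
    qed
    show "cap_ok g (mid (src t), X t) (cp t)" "cap_ok g (mid (tgt t), X t) (cp t)"
      "cap_ok g (X t, Y t) (cp t)" "cap_ok g (Y t, mid (src t)) (cp t)" "cap_ok g (Y t, mid (tgt t)) (cp t)"
      using vsn(2) t by (intro *; simp add: g_def lift_flow_edge)+
  qed
  moreover have "net (g i) w = l * placement_demand D (map sink vs) i w" if "i < k" "w < N" for i w
    unfolding g_def using that vsn h(2)
    by (intro net_lift_flow[where vs = vs]) (simp_all add: r_def)
  ultimately show ?thesis using l by (auto simp: directed_feasible_def)
qed

section \<open>Scaling and bounding undirected values\<close>

lemma undirected_feasible_mono:
  assumes "undirected_feasible l vs" "0 \<le> l'" "l' \<le> l"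
  shows "undirected_feasible l' vs"
proof -
  obtain h where h: "\<And>t. t < m \<Longrightarrow> (\<Sum>i<k. \<bar>h i t\<bar>) \<le> cp t"
    "\<And>i v. i < k \<Longrightarrow> v < n \<Longrightarrow> (\<Sum>t<m. h i t * incidence (arc_at t) v) = l * placement_demand I vs i v"
    using assms(1) by (auto simp: undirected_feasible_def)
  \<comment> \<open>For \<open>l = 0\<close> the quotient is \<open>0\<close>, as required, since
    then \<open>l' = 0\<close>.\<close>
  define q where "q = l' / l"
  have q: "0 \<le> q" "q \<le> 1" "q * l = l'" using assms by (auto simp: q_def divide_simps)
  have "(\<Sum>i<k. \<bar>q * h i t\<bar>) \<le> cp t" if "t < m" for t
  proof -
    have "(\<Sum>i<k. \<bar>q * h i t\<bar>) = q * (\<Sum>i<k. \<bar>h i t\<bar>)"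
      using q(1) by (simp add: abs_mult sum_distrib_left)
    also have "\<dots> \<le> 1 * (\<Sum>i<k. \<bar>h i t\<bar>)" using q(2) by (intro mult_right_mono sum_nonneg) simp_all
    finally show ?thesis using h(1)[OF that] by simp
  qed
  moreover have "(\<Sum>t<m. q * h i t * incidence (arc_at t) v) = l' * placement_demand I vs i v"
    if "i < k" "v < n" for i v
    using h(2)[OF that] q(3) by (simp add: mult.assoc flip: sum_distrib_left)
  ultimately show ?thesis using assms(2) by (auto simp: undirected_feasible_def intro!: exI[of _ "\<lambda>i t. q * h i t"])
qed

text \<open>A supply away from the sink has to leave its vertex through edges, each of which
  contributes at most its capacity.\<close>

lemma undirected_feasible_bound:
  assumes "undirected_feasible l vs" "i < k" "v < n" "v \<noteq> vs ! i"
  shows "l * \<bar>s i v\<bar> \<le> (\<Sum>t<m. cp t)"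
proof -
  obtain h where l: "0 \<le> l" and h: "\<And>t. t < m \<Longrightarrow> (\<Sum>i<k. \<bar>h i t\<bar>) \<le> cp t"
    "\<And>i v. i < k \<Longrightarrow> v < n \<Longrightarrow> (\<Sum>t<m. h i t * incidence (arc_at t) v) = l * placement_demand I vs i v"
    using assms(1) by (auto simp: undirected_feasible_def)
  have "l * \<bar>s i v\<bar> = \<bar>\<Sum>t<m. h i t * incidence (arc_at t) v\<bar>"
    using h(2)[OF assms(2,3)] l assms(4) by (simp add: demand_I abs_mult)
  also have "\<dots> \<le> (\<Sum>t<m. \<bar>h i t * incidence (arc_at t) v\<bar>)" by (rule sum_abs)
  also have "\<dots> \<le> (\<Sum>t<m. cp t)"
  proof (rule sum_mono)
    fix t assume t: "t \<in> {..<m}"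
    have "\<bar>h i t * incidence (arc_at t) v\<bar> \<le> \<bar>h i t\<bar>" by (simp add: abs_mult incidence_def of_bool_def)
    also have "\<dots> \<le> (\<Sum>i<k. \<bar>h i t\<bar>)" using assms(2) by (intro member_le_sum) auto
    finally show "\<bar>h i t * incidence (arc_at t) v\<bar> \<le> cp t" using h(1)[of t] t by simp
  qed
  finally show ?thesis .
qed

text \<open>All demands vanish, and the zero flow serves every \<open>l\<close>.\<close>

lemma undirected_value_infinite:
  assumes "\<And>i v. i < k \<Longrightarrow> v < n \<Longrightarrow> v \<noteq> vs ! i \<Longrightarrow> s i v = 0"
  shows "undirected_placement_value I vs = \<infinity>"
proof -
  have "undirected_feasible l vs" if "0 \<le> l" for l
  proof -
    have "placement_demand I vs i v = 0" if "i < k" "v < n" for i v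
      using assms[OF that(1)] that(2) by (auto simp: demand_I)
    then show ?thesis using that cp_nonneg by (auto simp: undirected_feasible_def intro!: exI[of _ "\<lambda>_ _. 0"])
  qed
  then have "ereal (real j) \<le> undirected_placement_value I vs" for j
    unfolding undirected_value_eq by (intro Sup_upper) auto
  then show ?thesis by (intro ereal_top) (metis order_trans ereal_less_eq(3) real_arch_simple)
qed


lemma placement_from_directed: "placement D ws \<Longrightarrow> placement I (from_directed I ws)"
  using n_pos by (auto simp: placement_def from_directed_def commodities_D k_def[symmetric] n_def
      graph_of_def sink_origin_def)

lemma placement_to_directed: "placement I vs \<Longrightarrow> placement D (map sink vs)"
  using index_bound(1) by (auto simp: placement_def commodities_D k_def[symmetric] n_def[symmetric]
      N_def[symmetric] graph_of_def)

end

section \<open>The size of numbers against the length of their codes\<close>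

lemma nat_less_power_enc: "j < 2 ^ length (enc_nat j)"
proof -
  have "j < 2 ^ length (binary_digits j)"
  proof (induction j rule: less_induct)
    case (less j)
    show ?case
    proof (cases "j = 0")
      case False
      then have "j div 2 < 2 ^ length (binary_digits (j div 2))" using less by simp
      then show ?thesis using False binary_digits.simps[of j] by simp
    qed simp
  qed
  also have "\<dots> \<le> 2 ^ length (enc_nat j)" by (simp add: enc_nat_def length_enc_bits)
  finally show ?thesis .
qed

text \<open>Numerator and denominator are both bounded by the power, and a nonzero fraction is in
  absolute value at least the reciprocal of its denominator.\<close>

lemma rat_bounds:
  "\<bar>real_of_rat q\<bar> \<le> 2 ^ length (enc_rat q)"
  "q \<noteq> 0 \<Longrightarrow> 1 \<le> \<bar>real_of_rat q\<bar> * 2 ^ length (enc_rat q)"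
proof -
  obtain a b where ab: "quotient_of q = (a, b)" by fastforce
  have b: "0 < b" using quotient_of_denom_pos[OF ab] .
  have q: "real_of_rat q = of_int a / of_int b"
    using quotient_of_div[OF ab] by (simp add: of_rat_divide)
  have "nat \<bar>a\<bar> < 2 ^ length (enc_nat (nat \<bar>a\<bar>))" "nat \<bar>b\<bar> < 2 ^ length (enc_nat (nat \<bar>b\<bar>))"
    by (rule nat_less_power_enc)+
  moreover have "(2::nat) ^ length (enc_nat (nat \<bar>a\<bar>)) \<le> 2 ^ length (enc_rat q)"
    "(2::nat) ^ length (enc_nat (nat \<bar>b\<bar>)) \<le> 2 ^ length (enc_rat q)"
    by (intro power_increasing; simp add: enc_rat_def enc_int_def ab)+
  ultimately have "nat \<bar>a\<bar> \<le> 2 ^ length (enc_rat q)" "nat \<bar>b\<bar> \<le> 2 ^ length (enc_rat q)" by linarith+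
  then have "real (nat \<bar>a\<bar>) \<le> 2 ^ length (enc_rat q)" "real (nat \<bar>b\<bar>) \<le> 2 ^ length (enc_rat q)"
    by (metis of_nat_le_iff of_nat_numeral of_nat_power)+
  then have ineq: "\<bar>real_of_int a\<bar> \<le> 2 ^ length (enc_rat q)" "real_of_int b \<le> 2 ^ length (enc_rat q)"
    using b by simp_all
  have b1: "1 \<le> real_of_int b" using b by simp
  have "\<bar>real_of_rat q\<bar> \<le> \<bar>real_of_int a\<bar>"
    using b1 by (simp add: q divide_le_eq mult_le_cancel_left1)
  then show "\<bar>real_of_rat q\<bar> \<le> 2 ^ length (enc_rat q)" using ineq by linarith
  assume "q \<noteq> 0"
  then have "a \<noteq> 0" using q by auto
  then have "1 \<le> \<bar>real_of_int a\<bar>" by linarith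
  also have "\<bar>real_of_int a\<bar> = \<bar>real_of_rat q\<bar> * real_of_int b" using b by (simp add: q)
  also have "\<dots> \<le> \<bar>real_of_rat q\<bar> * 2 ^ length (enc_rat q)" using ineq by (intro mult_left_mono) simp_all
  finally show "1 \<le> \<bar>real_of_rat q\<bar> * 2 ^ length (enc_rat q)" .
qed

text \<open>Since \<open>a + b \<le> 2 * (a * b)\<close> for \<open>a, b \<ge> 1\<close>,
  concatenated codes absorb sums; the item marker pays for the factor \<open>2\<close>. The summand
  \<open>1\<close>, paid for by the closing symbol, allows nesting: with it, rows of supplies bound
  the number of commodities and the total supply together.\<close>

lemma sum_power_enc:
  assumes "\<And>x. x \<in> set xs \<Longrightarrow> f x \<le> (2 :: real) ^ length (enc x)"
  shows "1 + (\<Sum>x\<leftarrow>xs. f x) \<le> 2 ^ length (enc_list enc xs)"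
  using assms
proof (induction xs)
  case (Cons x xs)
  have "1 + (\<Sum>x\<leftarrow>x # xs. f x) = f x + (1 + (\<Sum>x\<leftarrow>xs. f x))" by simp
  also have "\<dots> \<le> 2 ^ length (enc x) + 2 ^ length (enc_list enc xs)"
    using Cons by (intro add_mono) auto
  also have "\<dots> \<le> 2 * (2 ^ length (enc x) * 2 ^ length (enc_list enc xs))"
  proof -
    have "a + b \<le> 2 * (a * b)" if "1 \<le> a" "1 \<le> b" for a b :: real
    proof -
      have "a * 1 \<le> a * b" "1 * b \<le> a * b" using that by (intro mult_left_mono mult_right_mono; simp)+
      then show ?thesis by simp
    qed
    then show ?thesis by simp
  qed
  finally show ?case by (simp add: power_add)
qed simp

context lomuf_instance
begin

lemma encoding_bounds:
  defines "p \<equiv> (2 :: real) ^ length (enc_instance I)"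
  shows "(\<Sum>t<m. cp t) \<le> p"
    "real k + (\<Sum>i<k. - (\<Sum>v<n. s i v)) \<le> p"
    "i < k \<Longrightarrow> v < n \<Longrightarrow> s i v \<noteq> 0 \<Longrightarrow> 1 \<le> \<bar>s i v\<bar> * p"
proof -
  have mono: "x \<le> p" if "x \<le> 2 ^ j" "j \<le> length (enc_instance I)" for x j
    using that power_increasing[of j "length (enc_instance I)" "2 :: real"] unfolding p_def by linarith
  have l1: "length (enc_list enc_cap_arc (cap_arcs I)) \<le> length (enc_instance I)"
    and l2: "length (enc_list (enc_list enc_rat) (supplies I)) \<le> length (enc_instance I)"
    by (simp_all add: enc_instance_def)
  have "(\<Sum>t<m. cp t) = (\<Sum>e\<leftarrow>cap_arcs I. real_of_rat (snd e))"
    by (simp add: sum_list_sum_nth m_def cp_def atLeast0LessThan)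
  moreover have "1 + (\<Sum>e\<leftarrow>cap_arcs I. real_of_rat (snd e)) \<le> 2 ^ length (enc_list enc_cap_arc (cap_arcs I))"
  proof (rule sum_power_enc)
    fix e :: "(nat \<times> nat) \<times> rat"
    have "real_of_rat (snd e) \<le> 2 ^ length (enc_rat (snd e))" using rat_bounds(1)[of "snd e"] by linarith
    also have "\<dots> \<le> 2 ^ length (enc_cap_arc e)" by (simp add: enc_cap_arc_def case_prod_unfold)
    finally show "real_of_rat (snd e) \<le> 2 ^ length (enc_cap_arc e)" .
  qed
  ultimately show "(\<Sum>t<m. cp t) \<le> p" using l1 by (intro mono) auto
  have row: "1 + (\<Sum>q\<leftarrow>r. \<bar>real_of_rat q\<bar>) \<le> 2 ^ length (enc_list enc_rat r)" for r
    by (rule sum_power_enc) (rule rat_bounds)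
  have "1 - (\<Sum>v<n. s i v) = 1 + (\<Sum>q\<leftarrow>supplies I ! i. \<bar>real_of_rat q\<bar>)" if "i < k" for i
  proof -
    have "- (\<Sum>v<n. s i v) = (\<Sum>v<n. \<bar>s i v\<bar>)"
      unfolding sum_negf[symmetric] using s_nonpos[OF that] by (intro sum.cong) auto
    also have "\<dots> = (\<Sum>q\<leftarrow>supplies I ! i. \<bar>real_of_rat q\<bar>)"
      by (simp add: sum_list_sum_nth row_length[OF that] s_def supply_at_def atLeast0LessThan)
    finally show ?thesis by simp
  qed
  then have "(\<Sum>i<k. 1 - (\<Sum>v<n. s i v)) = (\<Sum>i<k. 1 + (\<Sum>q\<leftarrow>supplies I ! i. \<bar>real_of_rat q\<bar>))"
    by (intro sum.cong) simp_all
  moreover have "real k + (\<Sum>i<k. - (\<Sum>v<n. s i v)) = (\<Sum>i<k. 1 - (\<Sum>v<n. s i v))"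
    by (simp add: sum_subtractf sum_negf)
  ultimately have "real k + (\<Sum>i<k. - (\<Sum>v<n. s i v)) =
      (\<Sum>i<k. 1 + (\<Sum>q\<leftarrow>supplies I ! i. \<bar>real_of_rat q\<bar>))" by simp
  also have "\<dots> = (\<Sum>r\<leftarrow>supplies I. 1 + (\<Sum>q\<leftarrow>r. \<bar>real_of_rat q\<bar>))"
    by (simp add: sum_list_sum_nth k_def commodities_def atLeast0LessThan)
  finally have "1 + (real k + (\<Sum>i<k. - (\<Sum>v<n. s i v))) \<le> 2 ^ length (enc_list (enc_list enc_rat) (supplies I))"
    using sum_power_enc[of "supplies I" "\<lambda>r. 1 + (\<Sum>q\<leftarrow>r. \<bar>real_of_rat q\<bar>)" "enc_list enc_rat", OF row] by simp
  then show "real k + (\<Sum>i<k. - (\<Sum>v<n. s i v)) \<le> p" using l2 by (intro mono) auto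
  assume i: "i < k" "v < n" "s i v \<noteq> 0"
  define q where "q = supplies I ! i ! v"
  have "length (enc_rat q) \<le> length (enc_list enc_rat (supplies I ! i))"
    using i row_length[OF i(1)] by (intro length_enc_le) (simp add: q_def)
  also have "\<dots> \<le> length (enc_list (enc_list enc_rat) (supplies I))"
    using i(1) by (intro length_enc_le) (simp add: k_def commodities_def)
  finally have "(2 :: real) ^ length (enc_rat q) \<le> p" using l2 unfolding p_def by simp
  moreover have "s i v = real_of_rat q" by (simp add: s_def supply_at_def q_def)
  ultimately show "1 \<le> \<bar>s i v\<bar> * p"
    using rat_bounds(2)[of q] i(3) by (auto intro: order_trans mult_left_mono)
qed

text \<open>A strict bound on the finite values, which the large capacities still accommodate.\<close>

definition bound :: real where
  "bound = (2 ^ length (enc_instance I)) ^ 2 + 1"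

text \<open>A finite value leaves a nonzero supply away from its sink. The total capacity over the
  least size of such a supply gives \<open>l \<le> ?p ^ 2\<close>, and the \<open>+ 1\<close> in
  \<open>bound\<close> makes the estimate strict.\<close>

lemma undirected_value_le_bound:
  assumes "undirected_placement_value I vs \<noteq> \<infinity>"
  shows "undirected_placement_value I vs < ereal bound"
proof -
  let ?p = "(2 :: real) ^ length (enc_instance I)"
  obtain i v where iv: "i < k" "v < n" "v \<noteq> vs ! i" "s i v \<noteq> 0"
    using assms undirected_value_infinite by blast
  have "l \<le> ?p ^ 2" if "undirected_feasible l vs" for l
  proof -
    have l: "0 \<le> l" using that by (simp add: undirected_feasible_def)
    have "l * 1 \<le> l * (\<bar>s i v\<bar> * ?p)"
      using encoding_bounds(3)[OF iv(1,2,4)] l by (intro mult_left_mono)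
    also have "\<dots> = (l * \<bar>s i v\<bar>) * ?p" by simp
    also have "\<dots> \<le> ?p * ?p"
      using undirected_feasible_bound[OF that iv(1-3)] encoding_bounds(1) by (intro mult_right_mono) auto
    finally show ?thesis by (simp add: power2_eq_square)
  qed
  then have "undirected_placement_value I vs \<le> ereal (?p ^ 2)"
    unfolding undirected_value_eq by (intro Sup_least) auto
  also have "\<dots> < ereal bound" by (simp add: bound_def)
  finally show ?thesis .
qed

text \<open>As codes are nonempty, \<open>?p\<close> is at least \<open>2\<close>, which gives
  \<open>bound \<le> ?p ^ 3\<close>. One more factor \<open>?p\<close> covers the number of
  commodities or the total supply.\<close>

lemma bound_le_big:
  assumes "0 \<le> l" "l \<le> bound"
  shows "real k * l \<le> big" "l * (\<Sum>i<k. - (\<Sum>v<n. s i v)) \<le> big"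
proof -
  let ?p = "(2 :: real) ^ length (enc_instance I)" and ?S = "\<Sum>i<k. - (\<Sum>v<n. s i v)"
  have S: "0 \<le> ?S" using sum_s_nonpos by (intro sum_nonneg) simp
  have "1 \<le> length (enc_instance I)" by (simp add: enc_instance_items)
  then have p: "2 \<le> ?p" using power_increasing[of 1 "length (enc_instance I)" "2 :: real"] by simp
  have "?p ^ 2 + 1 \<le> 2 * ?p ^ 2" using p power_mono[of 1 ?p 2] by simp
  also have "\<dots> \<le> ?p * ?p ^ 2" using p by (intro mult_right_mono) auto
  finally have b: "bound \<le> ?p ^ 3" by (simp add: bound_def power3_eq_cube power2_eq_square mult.assoc)
  have le_big: "l * x \<le> big" if "0 \<le> x" "x \<le> ?p" for x
  proof -
    have "l * x \<le> ?p ^ 3 * ?p" using b assms that by (intro mult_mono) auto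
    also have "\<dots> = big" unfolding big_def slack_def by (simp add: power_add[symmetric] power_mult[symmetric] mult.commute)
    finally show ?thesis .
  qed
  have "real k \<le> ?p" "?S \<le> ?p" using encoding_bounds(2) S by linarith+
  then show "real k * l \<le> big" "l * ?S \<le> big"
    using le_big[of "real k"] le_big[OF S] by (simp_all only: mult.commute[of "real k"] of_nat_0_le_iff)
qed

text \<open>A placement better than the pull-back of \<open>ws\<close> would have a feasible
  \<open>l\<close> above the value of that pull-back; lifting \<open>l\<close>, cut at
  \<open>bound\<close>, would then beat \<open>ws\<close>.\<close>

lemma optimal_from_directed:
  assumes "is_arg_max (directed_placement_value D) (placement D) ws"
  shows "is_arg_max (undirected_placement_value I) (placement I) (from_directed I ws)"
proof -
  have ws: "placement D ws" using assms by (simp add: is_arg_max_def)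
  let ?vs = "from_directed I ws"
  have le: "directed_placement_value D ws \<le> undirected_placement_value I ?vs"
    unfolding directed_value_eq undirected_value_eq
    using feasible_from_directed[OF _ ws] by (intro Sup_subset_mono) auto
  have False if us: "placement I us" "undirected_placement_value I ?vs < undirected_placement_value I us" for us
  proof -
    obtain l where l: "undirected_feasible l us" "undirected_placement_value I ?vs < ereal l"
      using us(2) unfolding undirected_value_eq[of us] less_Sup_iff by auto
    \<comment> \<open>The cut matters for \<open>us\<close> of infinite value, where
      \<open>l\<close> may be too large for the capacities. The value of \<open>?vs\<close> is
      finite, being exceeded by another one, and therefore below \<open>bound\<close>, so that
      \<open>l'\<close> still exceeds it.\<close>
    define l' where "l' = min l bound"
    have "undirected_placement_value I ?vs < ereal l'"
      using l(2) undirected_value_le_bound[of ?vs] us(2) less_ereal.simps(2)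
      by (cases "undirected_placement_value I ?vs = \<infinity>") (auto simp: l'_def min_def)
    moreover have "0 \<le> l'" using l(1) by (simp add: l'_def undirected_feasible_def bound_def)
    then have "directed_feasible l' (map sink us)"
      using undirected_feasible_mono[OF l(1), of l'] us(1) bound_le_big[of l']
      by (intro feasible_to_directed) (auto simp: l'_def)
    then have "ereal l' \<le> directed_placement_value D (map sink us)"
      unfolding directed_value_eq by (intro Sup_upper) auto
    moreover have "directed_placement_value D (map sink us) \<le> directed_placement_value D ws"
      using assms placement_to_directed[OF us(1)] by (auto simp: is_arg_max_def not_less)
    ultimately show False using le by simp
  qed
  then show ?thesis using placement_from_directed[OF ws] by (auto simp: is_arg_max_def)
qed

lemma directed_instance_D: "directed_instance D"
proof -
  have arcs: "arcs (graph_of D) = fst ` set (cap_arcs D)" "verts (graph_of D) = {..<N}"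
    by (simp_all add: graph_of_def N_def)
  \<comment> \<open>Gadget indices start at \<open>n\<close>, above the ends of all edges; this
    excludes loops at \<open>y\<close>.\<close>
  have "t < m \<Longrightarrow> n + t \<noteq> src t" "t < m \<Longrightarrow> n + t \<noteq> tgt t" for t
    using endpoints[of t] by auto
  note ne = this
  have *: "fst a < N \<and> snd a < N \<and> fst a \<noteq> snd a" if "(a, c) \<in> set (cap_arcs D)" for a c
    using that endpoints index_bound ne unfolding set_cap_arcs_D
    by (auto simp: Let_def N_eq trans_less_add1)
  have "digraph (graph_of D)"
    by unfold_locales (use * in \<open>auto simp: graph_of_def N_def[symmetric] arc_to_ends_def\<close>)
  moreover have "0 \<le> c" if "(a, c) \<in> set (cap_arcs D)" for a c
    using that cp_nonneg unfolding set_cap_arcs_D by (auto simp: Let_def cp_def)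
  moreover have "length r = n_verts D \<and> (\<forall>q\<in>set r. q \<le> 0)" if r: "r \<in> set (supplies D)" for r
  proof -
    obtain r' where r': "r' \<in> set (supplies I)" "r = spread_row (slack I) r'"
      using r by (auto simp: D_def to_directed_def)
    then have "length r' = n" "\<forall>q\<in>set r'. q \<le> 0"
      using directed_instance_I by (auto simp: directed_instance_def n_def)
    then show ?thesis using N_eq r'(2)
      by (auto simp: length_spread_row N_def) (auto simp: spread_row_def)
  qed
  ultimately show ?thesis
    using distinct_arcs_D N_eq by (auto simp: directed_instance_def N_def)
qed

end

text \<open>There are only finitely many placements, and vertex \<open>0\<close> provides one, so
  the constructed instance is always solvable.\<close>

lemma ex_optimal_placement:
  fixes f :: "nat list \<Rightarrow> ereal"
  assumes "0 < n_verts J"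
  shows "\<exists>vs. is_arg_max f (placement J) vs"
proof -
  let ?P = "{vs. placement J vs}"
  have "?P = {vs. set vs \<subseteq> {..<n_verts J} \<and> length vs = commodities J}"
    by (auto simp: placement_def graph_of_def)
  then have fin: "finite (f ` ?P)" by (simp add: finite_lists_length_eq)
  have "replicate (commodities J) 0 \<in> ?P" using assms by (auto simp: placement_def graph_of_def)
  then have "Max (f ` ?P) \<in> f ` ?P" using fin by (intro Max_in) auto
  then obtain vs where "placement J vs" "f vs = Max (f ` ?P)" by auto
  then show ?thesis using fin by (auto simp: is_arg_max_def not_less intro!: exI[of _ vs])
qed

theorem theorem4:
  shows "polytime_reducible LoMuF Di_LoMuF"
proof -
  have "to_directed I \<in> instances Di_LoMuF \<and>
      (solutions LoMuF I \<noteq> {} \<longrightarrow> solutions Di_LoMuF (to_directed I) \<noteq> {}) \<and>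
      (\<forall>ws\<in>solutions Di_LoMuF (to_directed I). from_directed I ws \<in> solutions LoMuF I)"
    if "I \<in> instances LoMuF" for I
  proof -
    interpret lomuf_instance I using that by unfold_locales (simp add: LoMuF_def)
    show ?thesis
      using directed_instance_D optimal_from_directed ex_optimal_placement[of D "directed_placement_value D"]
      by (simp add: LoMuF_def Di_LoMuF_def D_def directed_instance_def)
  qed
  moreover have "polytime_computable (instances LoMuF) (instance_code LoMuF) (instance_code Di_LoMuF) to_directed"
    by (simp add: LoMuF_def Di_LoMuF_def polytime_to_directed)
  moreover have "polytime_computable {(I, ws). I \<in> instances LoMuF \<and> ws \<in> solutions Di_LoMuF (to_directed I)}
      (\<lambda>(I, ws). instance_code LoMuF I @ solution_code Di_LoMuF ws) (solution_code LoMuF)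
      (\<lambda>(I, ws). from_directed I ws)"
    using polytime_from_directed by (simp add: LoMuF_def Di_LoMuF_def)
  ultimately show ?thesis unfolding polytime_reducible_def by blast
qed

end
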